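(* Let $0<t<2\pi$, and let $f(r):=\left(\frac{r}{\sin\frac{tr}2}-\frac1{\sin\frac t2}\right)\cdot\frac1{t(1-r^2)}$, continuously extended to $r\in\,]-\frac{2\pi}{t},\frac{2\pi}{t}[$. For $\tilde\ell:=|\ell+1|$, the summands of $T_{tX}(\mathbb P^1\mathbb C,\mathcal O(\ell))$ have the following asymptotic expansions for $\tilde\ell\to\infty$. For every $N\in\mathbb Z^+$ $$ \begin{aligned} \sum_{k=1}^{\tilde\ell}\frac{\sin(2k-\tilde\ell)\frac t2}{\sin\frac t2}\log k=&-\frac{\cos\frac{(\tilde\ell+1)t}2}{2\sin^2\frac t2}\log\tilde\ell\\ &-\frac1{2i\sin\frac t2}\left(e^{\frac{-i(\tilde\ell-2)t}2}\frac{\partial\Phi}{\partial s}(e^{it},0,1)-e^{\frac{i(\tilde\ell-2)t}2}\frac{\partial\Phi}{\partial s}(e^{-it},0,1)\right)\\ &+\frac1{2i\sin\frac t2}\sum_{m=1}^{N-1}\frac{(-\tilde\ell)^{-m}}m\left(e^{\frac{i(\tilde\ell+2)t}2}\Phi(e^{it},-m,1)-e^{-\frac{i(\tilde\ell+2)t}2}\Phi(e^{-it},-m,1)\right)\\ &+\frac1{2i\sin\frac t2}\frac{(-\tilde\ell)^{-N}}N\left(e^{\frac{i(\tilde\ell+2)t}2}R(e^{it},-N,1,0,\tilde\ell)-e^{-\frac{i(\tilde\ell+2)t}2}R(e^{-it},-N,1,0,\tilde\ell)\right) \end{aligned} $$ and $$ \begin{aligned} \left(\frac{\cos\frac{\tilde\ell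 t}2}{t\sin\frac t2}\right)^\#\sim&-\frac1{t\sin\frac t2}\Bigg(\sin\frac{\tilde\ell t}2\cdot\left(\frac\pi2+\sum_{m=0}^\infty\frac{(-1)^m(2m)!}{(\tilde\ell t)^{2m+1}}\right)\\ &+\cos\frac{\tilde\ell t}2\cdot\left(-\log(\tilde\ell t)+\Gamma'(1)+\sum_{m=1}^\infty\frac{(-1)^m(2m-1)!}{(\tilde\ell t)^{2m}}\right)\Bigg)\\ &+\sum_{m=1}^\infty2\left(\frac2{\tilde\ell t}\right)^m\cos\frac{\tilde\ell t+\pi m}2\cdot f^{(m-1)}(1). \end{aligned} $$
   Context: $X$ is a generator of an isometric circle action on $\mathbb P^1\mathbb C$ whose flow has period $2\pi$, and $T_{tX}(\mathbb P^1\mathbb C,\mathcal O(\ell))$ is Bismut–Goette's $X$-equivariant (Lie-algebra-equivariant) holomorphic torsion, which by a known result equals, for $|t|<2\pi$, $$-\frac{\cos\frac{(\ell+1)t}2}{\sin\frac t2}\sum_{k\ge1,\,k\ \mathrm{odd}}\left(2\zeta'(-k)+\mathcal H_k\zeta(-k)\right)\frac{(-1)^{\frac{k+1}2}t^k}{k!}+\sum_{k=1}^{|\ell+1|}\frac{\sin(2k-|\ell+1|)\frac t2}{\sin\frac t2}\log k+\left(\frac{\cos\frac{(\ell+1)t}2}{t\sin\frac t2}\right)^\#.$$ Here $\mathcal H_k=\sum_{j=1}^k\frac1j$ and $^\#$ is the linear operator on even Laurent series in $t$ (convergent for $0<|t|<2\pi$, with terms $t^{2k}$, $k\ge-1$)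 given by $(t^{2k})^\#:=(2\mathcal H_{2k+1}-\mathcal H_k)t^{2k}$ for $k\ge0$ and $(t^{-2})^\#:=0$. $\Phi(z,s,v)=\sum_{k\ge0}z^k(k+v)^{-s}$ is the Lerch zeta function, for $|z|\le1$, $z\ne1$ analytically continued to $s\in\mathbb C$; $\frac{\partial\Phi}{\partial s}(z,0,1)$ is its $s$-derivative at $s=0$. For $|z|=1$, $z\neq1$, $N\in\mathbb Z^+$, $v>0$, $$R(z,-N,1,0,v):=(-1)^Nv^NN\int_0^\infty\left(\frac{e^{-u}}{1-ze^{-u}}-\sum_{m=0}^{N-1}\frac{(-u)^m\Phi(z,-m,1)}{m!}\right)\frac{du}{u\,e^{vu}};$$ it is bounded in $v$ for fixed $z,N$: for $z=e^{i\varphi}$, $0<\varphi<2\pi$, $|R(z,-N,1,0,v)|<\frac{N!}{(2\pi)^{N+1}}\left(\zeta(N+1,\frac\varphi{2\pi})+\zeta(N+1,1-\frac\varphi{2\pi})\right)$ with the Hurwitz zeta function. The sign $\sim$ denotes an asymptotic expansion for $\tilde\ell\to\infty$ with $t$ fixed. *)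

theory Defs
  imports "HOL-Complex_Analysis.Complex_Analysis" "HOL-Library.Landau_Symbols"
begin

text \<open>
  The Lerch zeta function for $|z| \le 1$, $z \ne 1$, $v > 0$: the unique entire function of $s$
  that is given by the absolutely convergent series $\sum_k z^k (k+v)^{-s}$ for $\Re s > 1$.
\<close>

definition lerch_phi :: "complex \<Rightarrow> complex \<Rightarrow> real \<Rightarrow> complex" where
  "lerch_phi z s v =
     (THE F. F holomorphic_on UNIV \<and>
             (\<forall>w. Re w > 1 \<longrightarrow>
                (\<lambda>k. z ^ k * (of_nat k + of_real v) powr (-w)) sums F w)) s"

definition lerch_phi_ds :: "complex \<Rightarrow> complex \<Rightarrow> real \<Rightarrow> complex" where
  "lerch_phi_ds z s v = deriv (\<lambda>w. lerch_phi z w v) s"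

text \<open>
  \<open>lerch_R z N v\<close> is the remainder $R(z,-N,1,0,v)$, for $|z| = 1$, $z \ne 1$, $N \ge 1$, $v > 0$.
  The subtracted sum is the Taylor polynomial at $u = 0$ of the first term, so the integrand is
  $O(u^{N-1})$ at $0$ and the integral converges absolutely.
\<close>

definition lerch_R :: "complex \<Rightarrow> nat \<Rightarrow> real \<Rightarrow> complex" where
  "lerch_R z N v =
     (-1) ^ N * of_real v ^ N * of_nat N *
     (LINT u:{0<..}|lborel.
        (of_real (exp (-u)) / (1 - z * of_real (exp (-u)))
          - (\<Sum>m<N. of_real (-u) ^ m * lerch_phi z (- of_nat m) 1 / fact m))
        / of_real (u * exp (v * u)))"

text \<open>
  The operator $^\#$ acts on functions $g$ with an even Laurent expansion
  $g(t) = \sum_{k\ge -1} a_k t^{2k}$ at $0$, sending $t^{2k}$ to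
  $(2\mathcal H_{2k+1} - \mathcal H_k)\,t^{2k}$ for $k \ge 0$ and $t^{-2}$ to $0$; the coefficient
  of $t^{-2}$ therefore does not occur in the result.
\<close>

definition sharp :: "(complex \<Rightarrow> complex) \<Rightarrow> complex \<Rightarrow> complex" where
  "sharp g t =
     (\<Sum>k. (2 * harm (2 * k + 1) - harm k) * fls_nth (laurent_expansion g 0) (2 * int k)
           * t ^ (2 * k))"

text \<open>
  For $0 < t < 2\pi$, the only zeros of the denominators in $]-2\pi/t, 2\pi/t[$ are
  $r \in \{-1, 0, 1\}$, and all three are removable singularities.
\<close>

definition f_raw :: "real \<Rightarrow> real \<Rightarrow> real" where
  "f_raw t r = (r / sin (t * r / 2) - 1 / sin (t / 2)) * (1 / (t * (1 - r\<^sup>2)))"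

definition f_ext :: "real \<Rightarrow> real \<Rightarrow> real" where
  "f_ext t r = (if r \<in> {-1, 0, 1} then Lim (at r) (f_raw t) else f_raw t r)"

end

theory Submission
  imports Defs
begin

text \<open>
  For the first expansion, write the sum as the imaginary part of a sum of \<open>z ^ k * ln k\<close> with
  \<open>z = cis t\<close>, i.e. minus the derivative at \<open>s = 0\<close> of a partial sum of \<open>z \<Phi>(z,s,1)\<close>. The tail of
  the Lerch series beyond the index \<open>l\<close> is the Mellin transform of \<open>exp (-l u) g(u)\<close>, where
  \<open>g(u) = exp (-u) / (1 - z exp (-u))\<close>, divided by \<open>\<Gamma>(s)\<close>. Subtracting the Taylor polynomial of \<open>g\<close> of
  degree \<open>N - 1\<close> continues this to \<open>Re s > -N\<close>; the Taylor coefficients give \<open>\<Phi>(z,-m,1)\<close>, and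
  differentiating at \<open>s = 0\<close> turns the transform of the Taylor remainder into \<open>R\<close>.

  For the second expansion, \<open>2 H\<^bsub>2k+1\<^esub> - H\<^sub>k\<close> is twice the integral of \<open>(1 - r\<^bsup>2k+2\<^esup>) / (1 - r\<^sup>2)\<close> over \<open>[0,1]\<close>,
  so the operator is an integral transform. Applied to \<open>cos (l t / 2) / (t sin (t / 2))\<close>
  it splits, with \<open>a = l t / 2\<close>, into the integral of \<open>2 (cos a - cos (a r)) / (1 - r\<^sup>2)\<close>, which is an
  exponential integral, and the oscillatory integral of \<open>cos (a r) f(r)\<close>, expanded by
  repeated integration by parts; \<open>f\<close> is even, so only the end point 1 contributes.
\<close>

section \<open>Parametric integrals\<close>

text \<open>The cut-off \<open>l\<close> in \<open>lerch_cont z N l\<close> is a free parameter, and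
  this links the pieces. For \<open>Re s > 0\<close> every \<open>N\<close> and
  \<open>l \<ge> 1\<close> gives the sum of the same series, so by the identity theorem all choices
  continue one function. Growing \<open>N\<close> produces the entire function that the description
  in \<open>lerch_phi\<close> asks for, \<open>l = 1\<close> at negative integers gives its values
  there, and a general \<open>l\<close> at \<open>s = 0\<close> gives the finite sum as an exact
  identity. No derivative of a Mellin transform survives at \<open>s = 0\<close>, because
  \<open>rGamma\<close> vanishes there.

  In the second expansion the obstacle is that \<open>exp (\<i> * y) / y\<close> is singular at
  \<open>0\<close> and only conditionally integrable at infinity. Instead, the entire primitive
  \<open>E\<close> of \<open>(1 - exp (\<i> * y)) / y\<close> is paired with an absolutely
  convergent Laplace integral. The function \<open>f\<close> is the correction, divided by
  \<open>t * (1 - r\<^sup>2)\<close>, for replacing \<open>r / sin (t * r / 2)\<close> by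
  \<open>1 / sin (t / 2)\<close>. It is holomorphic up to radius \<open>2 * pi / t > 1\<close>, so
  integration by parts on the unit interval can be repeated without limit.\<close>

lemma has_field_derivative_lebesgue_integral:
  fixes f :: "complex \<Rightarrow> 'a \<Rightarrow> complex"
  assumes r: "r > 0"
    and meas: "\<And>s. s \<in> ball s0 r \<Longrightarrow> f s \<in> borel_measurable M"
    and hol: "\<And>x. x \<in> space M \<Longrightarrow> (\<lambda>s. f s x) holomorphic_on ball s0 r"
    and B: "integrable M B"
    and bound: "\<And>s x. s \<in> ball s0 r \<Longrightarrow> x \<in> space M \<Longrightarrow> norm (f s x) \<le> B x"
  shows "((\<lambda>s. \<integral>x. f s x \<partial>M) has_field_derivative (\<integral>x. deriv (\<lambda>s. f s x) s0 \<partial>M)) (at s0)"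
proof -
  define U where "U = ball s0 (r / 2)"
  have U: "open U" "s0 \<in> U" "U \<subseteq> ball s0 r" and cU: "convex U"
    using r by (auto simp: U_def)
  \<comment> \<open>Points of \<open>U\<close> lie within \<open>r / 2\<close> of \<open>s0\<close>,
    so discs of radius \<open>r / 3\<close> around them stay inside the large ball. Cauchy's
    inequality there turns the bound \<open>B\<close> on \<open>f\<close> into the bound
    \<open>3 / r * B\<close> on its derivative, hence on all difference quotients.\<close>
  have lip: "norm (f s x - f s0 x) \<le> (3 / r * B x) * norm (s - s0)" if "s \<in> U" "x \<in> space M" for s x
  proof (rule field_differentiable_bound[OF cU, of _ "deriv (\<lambda>s. f s x)"])
    fix w assume w: "w \<in> U"
    have sub: "cball w (r / 3) \<subseteq> ball s0 r"
    proof
      fix y assume "y \<in> cball w (r / 3)"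
      then show "y \<in> ball s0 r"
        using w r dist_triangle[of s0 y w] by (auto simp: U_def)
    qed
    show "((\<lambda>s. f s x) has_field_derivative deriv (\<lambda>s. f s x) w) (at w within U)"
      using hol[OF that(2)] w U by (intro holomorphic_derivI[of _ "ball s0 r"]) auto
    have "norm ((deriv ^^ 1) (\<lambda>s. f s x) w) \<le> fact 1 * B x / (r / 3) ^ 1"
    proof (rule Cauchy_inequality)
      show "(\<lambda>s. f s x) holomorphic_on ball w (r / 3)"
        using hol[OF that(2)] sub ball_subset_cball by (blast intro: holomorphic_on_subset)
      show "continuous_on (cball w (r / 3)) (\<lambda>s. f s x)"
        using hol[OF that(2)] sub by (blast intro: holomorphic_on_imp_continuous_on holomorphic_on_subset)
      show "norm (f y x) \<le> B x" if "norm (w - y) = r / 3" for y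
        using sub that \<open>x \<in> space M\<close> by (intro bound) (auto simp: dist_norm)
    qed (use r in auto)
    then show "norm (deriv (\<lambda>s. f s x) w) \<le> 3 / r * B x"
      by (simp add: field_simps)
  qed (use that U in auto)
  have int: "integrable M (f s)" if "s \<in> U" for s
    by (rule Bochner_Integration.integrable_bound[OF B])
       (use that U meas order_trans[OF bound abs_ge_self] in \<open>auto intro!: AE_I2\<close>)
  have "((\<lambda>s. ((\<integral>x. f s x \<partial>M) - (\<integral>x. f s0 x \<partial>M)) / (s - s0)) \<longlongrightarrow> (\<integral>x. deriv (\<lambda>s. f s x) s0 \<partial>M))
          (at s0 within U)"
    unfolding tendsto_at_iff_sequentially
  proof (intro allI impI)
    fix X assume X: "\<forall>i. X i \<in> U - {s0}" and lim: "X \<longlonglongrightarrow> s0"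
    have XF: "filterlim X (at s0) sequentially"
      using X lim by (auto simp: filterlim_at)
    have XU: "X n \<in> ball s0 r" for n
      using X U by blast
    have ptw: "(\<lambda>n. (f (X n) x - f s0 x) / (X n - s0)) \<longlonglongrightarrow> deriv (\<lambda>s. f s x) s0" if "x \<in> space M" for x
    proof -
      have "((\<lambda>s. f s x) has_field_derivative deriv (\<lambda>s. f s x) s0) (at s0 within UNIV)"
        using hol[OF that] r by (intro holomorphic_derivI[of _ "ball s0 r"]) auto
      then show ?thesis
        unfolding has_field_derivative_iff by (rule filterlim_compose[OF _ XF])
    qed
    have mX: "(\<lambda>x. (f (X n) x - f s0 x) / (X n - s0)) \<in> borel_measurable M" for n
    proof -
      have [measurable]: "f (X n) \<in> borel_measurable M" "f s0 \<in> borel_measurable M"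
        using meas[OF XU] meas[of s0] r by auto
      show ?thesis by measurable
    qed
    have "(\<lambda>n. \<integral>x. (f (X n) x - f s0 x) / (X n - s0) \<partial>M) \<longlonglongrightarrow> (\<integral>x. deriv (\<lambda>s. f s x) s0 \<partial>M)"
    proof (rule integral_dominated_convergence)
      \<comment> \<open>Measurability of the derivative in \<open>x\<close> is inherited from the
        difference quotients, whose pointwise limit it is.\<close>
      show "(\<lambda>x. deriv (\<lambda>s. f s x) s0) \<in> borel_measurable M"
        by (rule borel_measurable_LIMSEQ_metric[OF mX ptw])
      show "integrable M (\<lambda>x. 3 / r * B x)"
        using B by simp
      show "AE x in M. norm ((f (X n) x - f s0 x) / (X n - s0)) \<le> 3 / r * B x" for n
      proof (rule AE_I2)
        fix x assume "x \<in> space M"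
        moreover have "X n \<in> U" "X n \<noteq> s0" using X by auto
        ultimately show "norm ((f (X n) x - f s0 x) / (X n - s0)) \<le> 3 / r * B x"
          using lip[of "X n" x] by (simp add: norm_divide pos_divide_le_eq)
      qed
      show "AE x in M. (\<lambda>n. (f (X n) x - f s0 x) / (X n - s0)) \<longlonglongrightarrow> deriv (\<lambda>s. f s x) s0"
        using ptw by (rule AE_I2)
    qed (rule mX)
    moreover have "(\<integral>x. (f (X n) x - f s0 x) / (X n - s0) \<partial>M)
        = ((\<integral>x. f (X n) x \<partial>M) - (\<integral>x. f s0 x \<partial>M)) / (X n - s0)" for n
    proof -
      have "integrable M (f (X n))" "integrable M (f s0)" using int X U(2) by auto
      then show ?thesis by (simp only: integral_divide_zero Bochner_Integration.integral_diff)
    qed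
    ultimately show "((\<lambda>s. ((\<integral>x. f s x \<partial>M) - (\<integral>x. f s0 x \<partial>M)) / (s - s0)) \<circ> X)
        \<longlonglongrightarrow> (\<integral>x. deriv (\<lambda>s. f s x) s0 \<partial>M)"
      by (simp only: o_def)
  qed
  then show ?thesis
    unfolding has_field_derivative_iff using at_within_open[OF U(2,1)] by simp
qed

lemma has_field_derivative_set_lebesgue_integral:
  fixes f :: "complex \<Rightarrow> 'a \<Rightarrow> complex"
  assumes r: "r > 0"
    and meas: "\<And>s. s \<in> ball s0 r \<Longrightarrow> set_borel_measurable M A (f s)"
    and hol: "\<And>x. x \<in> A \<Longrightarrow> (\<lambda>s. f s x) holomorphic_on ball s0 r"
    and B: "set_integrable M A B"
    and bound: "\<And>s x. s \<in> ball s0 r \<Longrightarrow> x \<in> A \<Longrightarrow> norm (f s x) \<le> B x"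
  shows "((\<lambda>s. LINT x:A|M. f s x) has_field_derivative (LINT x:A|M. deriv (\<lambda>s. f s x) s0)) (at s0)"
proof -
  have "((\<lambda>s. \<integral>x. indicator A x *\<^sub>R f s x \<partial>M) has_field_derivative
          (\<integral>x. deriv (\<lambda>s. indicator A x *\<^sub>R f s x) s0 \<partial>M)) (at s0)"
  proof (rule has_field_derivative_lebesgue_integral[OF r])
    show "(\<lambda>s. indicator A x *\<^sub>R f s x) holomorphic_on ball s0 r" for x
      by (cases "x \<in> A") (simp_all add: hol)
    show "norm (indicator A x *\<^sub>R f s x) \<le> indicator A x *\<^sub>R B x" if "s \<in> ball s0 r" for s x
      using bound[OF that, of x] by (cases "x \<in> A") simp_all
    show "(\<lambda>x. indicator A x *\<^sub>R f s x) \<in> borel_measurable M" if "s \<in> ball s0 r" for s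
      using meas[OF that] unfolding set_borel_measurable_def .
    show "integrable M (\<lambda>x. indicator A x *\<^sub>R B x)"
      using B unfolding set_integrable_def .
  qed
  moreover have "deriv (\<lambda>s. indicator A x *\<^sub>R f s x) s0 = indicator A x *\<^sub>R deriv (\<lambda>s. f s x) s0" for x
    by (cases "x \<in> A") simp_all
  ultimately show ?thesis
    by (simp add: set_lebesgue_integral_def)
qed

section \<open>Gamma and Mellin integrals on the positive half-line\<close>

lemma set_borel_measurable_Ioi_continuous:
  fixes f :: "real \<Rightarrow> 'b::{real_normed_vector, second_countable_topology}"
  assumes "continuous_on {0<..} f"
  shows "set_borel_measurable lborel {0<..} f"
  using assms borel_measurable_continuous_on_indicator[of "{0<..}" f]
  by (simp add: set_borel_measurable_def)

text \<open>Euler's integral after the substitution of \<open>c * u\<close> for \<open>u\<close>.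
  Absolute integrability is known for \<open>lebesgue\<close>, the completion of
  \<open>lborel\<close>; the integrand is Borel measurable by continuity, so it carries
  over.\<close>

lemma Gamma_set_integral_complex:
  assumes s: "Re s > 0" and c: "c > 0"
  shows "set_integrable lborel {0<..} (\<lambda>u. of_real u powr (s - 1) * of_real (exp (- (c * u))))"
    and "(LINT u:{0<..}|lborel. of_real u powr (s - 1) * of_real (exp (- (c * u))))
          = Gamma s * of_real c powr (- s)"
proof -
  have meas: "set_borel_measurable lborel {0<..} (\<lambda>u. complex_of_real u powr (s - 1) * of_real (exp (- (c * u))))"
    if "c > 0" for c
    by (intro set_borel_measurable_Ioi_continuous continuous_intros) (auto simp: complex_nonpos_Reals_iff)
  have int: "set_integrable lborel {0<..} (\<lambda>u. of_real u powr (s - 1) * of_real (exp (- (c * u))))"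
    if "c > 0" for c
  proof -
    have "set_integrable lebesgue {0<..} (\<lambda>u. of_real u powr (s - 1) * of_real (exp (- (c * u))))"
      using absolutely_integrable_Gamma_integral[OF s that] by (simp add: exp_minus field_simps)
    then show ?thesis
      using meas[OF that] unfolding set_integrable_def set_borel_measurable_def
      by (subst (asm) integrable_completion) auto
  qed
  show "set_integrable lborel {0<..} (\<lambda>u. of_real u powr (s - 1) * of_real (exp (- (c * u))))"
    by (rule int[OF c])
  have one: "(LINT u:{0<..}|lborel. of_real u powr (s - 1) * of_real (exp (- (1 * u)))) = Gamma s"
    using set_borel_integral_eq_integral(2)[OF int[of 1]] integral_unique[OF Gamma_integral_complex'[OF s]]
    by (simp add: exp_minus field_simps)
  have "(LINT u:{0<..}|lborel. of_real u powr (s - 1) * of_real (exp (- (1 * u))))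
      = \<bar>c\<bar> *\<^sub>R (\<integral>u. indicator {0<..} (0 + c * u) *\<^sub>R
          (of_real (0 + c * u) powr (s - 1) * of_real (exp (- (1 * (0 + c * u))))) \<partial>lborel)"
    unfolding set_lebesgue_integral_def using c by (intro lborel_integral_real_affine) auto
  also have "(\<lambda>u. indicator {0<..} (0 + c * u) *\<^sub>R
          (complex_of_real (0 + c * u) powr (s - 1) * of_real (exp (- (1 * (0 + c * u))))))
      = (\<lambda>u. of_real c powr (s - 1) * (indicator {0<..} u *\<^sub>R (of_real u powr (s - 1) * of_real (exp (- (c * u))))))"
    using c by (intro ext) (auto simp: indicator_def zero_less_mult_iff powr_times_real)
  also have "\<bar>c\<bar> *\<^sub>R (\<integral>u. of_real c powr (s - 1) * (indicator {0<..} u *\<^sub>R (of_real u powr (s - 1) * of_real (exp (- (c * u))))) \<partial>lborel)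
      = of_real c powr s * (LINT u:{0<..}|lborel. of_real u powr (s - 1) * of_real (exp (- (c * u))))"
    unfolding set_lebesgue_integral_def using c
    by (simp only: integral_mult_right_zero) (simp add: powr_diff scaleR_conv_of_real)
  finally show "(LINT u:{0<..}|lborel. of_real u powr (s - 1) * of_real (exp (- (c * u))))
          = Gamma s * of_real c powr (- s)"
    using c one by (simp add: powr_minus field_simps)
qed

lemma Gamma_set_integral_real:
  fixes a c :: real
  assumes a: "a > 0" and c: "c > 0"
  shows "set_integrable lborel {0<..} (\<lambda>u. u powr (a - 1) * exp (- (c * u)))"
    and "(LINT u:{0<..}|lborel. u powr (a - 1) * exp (- (c * u))) = Gamma a * c powr (- a)"
proof -
  have eq: "complex_of_real u powr (of_real a - 1) * of_real (exp (- (c * u)))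
      = of_real (u powr (a - 1) * exp (- (c * u)))" if "u \<in> {0<..}" for u
    using that powr_of_real[of u "a - 1"] by simp
  have "set_integrable lborel {0<..} (\<lambda>u. complex_of_real u powr (of_real a - 1) * of_real (exp (- (c * u))))"
    using Gamma_set_integral_complex(1)[of "of_real a" c] a c by simp
  then have int: "set_integrable lborel {0<..} (\<lambda>u. complex_of_real (u powr (a - 1) * exp (- (c * u))))"
    by (subst (asm) set_integrable_cong[OF refl refl eq])
  then show "set_integrable lborel {0<..} (\<lambda>u. u powr (a - 1) * exp (- (c * u)))"
    unfolding set_integrable_def by (simp add: scaleR_conv_of_real complex_of_real_integrable_eq flip: of_real_mult)
  have "complex_of_real (LINT u:{0<..}|lborel. u powr (a - 1) * exp (- (c * u)))
      = (LINT u:{0<..}|lborel. complex_of_real (u powr (a - 1) * exp (- (c * u))))"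
    by (rule set_integral_complex_of_real[symmetric])
  also have "\<dots> = (LINT u:{0<..}|lborel. complex_of_real u powr (of_real a - 1) * of_real (exp (- (c * u))))"
    by (rule set_lebesgue_integral_cong) (auto simp: eq)
  also have "\<dots> = of_real (Gamma a * c powr (- a))"
    using Gamma_set_integral_complex(2)[of "of_real a" c] a c
    by (simp add: Gamma_complex_of_real powr_of_real flip: of_real_minus)
  finally show "(LINT u:{0<..}|lborel. u powr (a - 1) * exp (- (c * u))) = Gamma a * c powr (- a)"
    by (simp only: of_real_eq_iff)
qed

lemma has_field_derivative_Mellin:
  fixes h :: "real \<Rightarrow> complex"
  assumes cont: "continuous_on {0<..} h" and c: "c > 0" and s: "Re s > - a"
    and bound: "\<And>u. u > 0 \<Longrightarrow> norm (h u) \<le> C * u powr a * exp (- (c * u))"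
  shows "((\<lambda>s. LINT u:{0<..}|lborel. of_real u powr (s - 1) * h u) has_field_derivative
          (LINT u:{0<..}|lborel. of_real (ln u) * of_real u powr (s - 1) * h u)) (at s)"
proof -
  define r where "r = (Re s + a) / 2"
  have r: "r > 0" using s by (simp add: r_def)
  \<comment> \<open>In the disc of radius \<open>r\<close> the factor
    \<open>u powr (Re w - 1)\<close> is below one of two extreme powers, depending on whether
    \<open>u \<ge> 1\<close>; their sum is a majorant for all \<open>u\<close>. The choice of
    \<open>r\<close> leaves \<open>Re s - r + a = r > 0\<close>, so the lower power is still
    integrable at \<open>0\<close>.\<close>
  define B where "B = (\<lambda>u. C * (u powr ((Re s - r + a) - 1) * exp (- (c * u)) + u powr ((Re s + r + a) - 1) * exp (- (c * u))))"
  have C: "C \<ge> 0"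
  proof -
    have "0 \<le> C * exp (- c)"
      using order_trans[OF norm_ge_zero bound[of 1]] by simp
    then show ?thesis by (simp add: zero_le_mult_iff)
  qed
  have "((\<lambda>s. LINT u:{0<..}|lborel. of_real u powr (s - 1) * h u) has_field_derivative
          (LINT u:{0<..}|lborel. deriv (\<lambda>s. of_real u powr (s - 1) * h u) s)) (at s)"
  proof (rule has_field_derivative_set_lebesgue_integral[OF r])
    show "set_borel_measurable lborel {0<..} (\<lambda>u. of_real u powr (w - 1) * h u)" for w
      by (intro set_borel_measurable_Ioi_continuous continuous_intros cont) (auto simp: complex_nonpos_Reals_iff)
    show "(\<lambda>s. of_real u powr (s - 1) * h u) holomorphic_on ball s r" if "u \<in> {0<..}" for u
      using that by (intro holomorphic_intros) auto
    show "set_integrable lborel {0<..} B"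
      unfolding B_def using c r s
      by (intro set_integrable_mult_right set_integral_add Gamma_set_integral_real) (auto simp: r_def field_simps)
    show "norm (of_real u powr (w - 1) * h u) \<le> B u" if w: "w \<in> ball s r" and "u \<in> {0<..}" for w u
    proof -
      have u: "u > 0" using that by simp
      have "\<bar>Re s - Re w\<bar> < r"
        using w abs_Re_le_cmod[of "s - w"] by (simp add: dist_norm)
      then have "u powr (Re w - 1) \<le> u powr (Re s - r - 1) + u powr (Re s + r - 1)"
        using powr_mono[of "Re w - 1" "Re s + r - 1" u] powr_mono'[of "Re s - r - 1" "Re w - 1" u] u
        by (cases "u \<ge> 1") (auto intro: order_trans add_increasing add_increasing2)
      then have "u powr (Re w - 1) * norm (h u)
          \<le> (u powr (Re s - r - 1) + u powr (Re s + r - 1)) * (C * u powr a * exp (- (c * u)))"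
        using bound[OF u] by (intro mult_mono) auto
      also have "\<dots> = B u"
        using powr_add[of u "Re s - r - 1" a] powr_add[of u "Re s + r - 1" a]
        by (simp add: B_def algebra_simps)
      finally show ?thesis
        using u by (simp add: norm_mult norm_powr_real_powr)
    qed
  qed
  also have "(LINT u:{0<..}|lborel. deriv (\<lambda>s. of_real u powr (s - 1) * h u) s)
      = (LINT u:{0<..}|lborel. of_real (ln u) * of_real u powr (s - 1) * h u)"
  proof (rule set_lebesgue_integral_cong)
    show "\<forall>u. u \<in> {0<..} \<longrightarrow> deriv (\<lambda>s. of_real u powr (s - 1) * h u) s = of_real (ln u) * of_real u powr (s - 1) * h u"
    proof (intro allI impI DERIV_imp_deriv)
      fix u :: real assume u: "u \<in> {0<..}"
      have "((\<lambda>s. of_real u powr (s - 1)) has_field_derivative Ln (of_real u) * of_real u powr (s - 1) * 1) (at s)"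
        using u by (intro DERIV_chain2[OF has_field_derivative_powr_right]) (auto intro!: derivative_eq_intros)
      from DERIV_cmult_right[OF this, of "h u"] u
      show "((\<lambda>s. of_real u powr (s - 1) * h u) has_field_derivative of_real (ln u) * of_real u powr (s - 1) * h u) (at s)"
        by (simp add: Ln_of_real)
    qed
  qed simp
  finally show ?thesis .
qed

text \<open>Both sides are the derivative of \<open>Gamma\<close> at \<open>1\<close>: one by
  differentiating Euler's integral under the integral sign, the other as
  \<open>Gamma 1 * Digamma 1\<close>.\<close>

lemma Digamma_one_integral:
  "(LINT u:{0<..}|lborel. of_real (ln u) * of_real (exp (- u))) = (- euler_mascheroni :: complex)"
proof -
  have "((\<lambda>s. LINT u:{0<..}|lborel. of_real u powr (s - 1) * complex_of_real (exp (- u))) has_field_derivative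
          (LINT u:{0<..}|lborel. of_real (ln u) * of_real u powr (1 - 1) * complex_of_real (exp (- u)))) (at 1)"
    by (rule has_field_derivative_Mellin[where c = 1 and a = 0 and C = 1]) (auto intro!: continuous_intros)
  then have "(Gamma has_field_derivative
          (LINT u:{0<..}|lborel. of_real (ln u) * of_real u powr (1 - 1) * of_real (exp (- u)))) (at (1::complex))"
    by (rule has_field_derivative_transform_within_open[where S = "{s. Re s > 0}"])
       (use Gamma_set_integral_complex(2)[of _ 1] in \<open>auto simp: open_halfspace_Re_gt\<close>)
  moreover have "(Gamma has_field_derivative Gamma 1 * Digamma 1) (at (1::complex))"
    by (rule has_field_derivative_Gamma) auto
  ultimately have "(LINT u:{0<..}|lborel. of_real (ln u) * of_real u powr (1 - 1) * of_real (exp (- u))) = (- euler_mascheroni :: complex)"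
    by (simp add: DERIV_unique Digamma_1)
  moreover have "(LINT u:{0<..}|lborel. of_real (ln u) * of_real u powr (1 - 1) * of_real (exp (- u)))
      = (LINT u:{0<..}|lborel. of_real (ln u) * complex_of_real (exp (- u)))"
    by (rule set_lebesgue_integral_cong) auto
  ultimately show ?thesis by simp
qed

section \<open>Analytic continuation of the Lerch zeta function\<close>

definition lerch_gen :: "complex \<Rightarrow> complex \<Rightarrow> complex" where
  "lerch_gen z w = exp (- w) / (1 - z * exp (- w))"

text \<open>Formally \<open>lerch_gen z u\<close> is the sum of
  \<open>z ^ k * exp (- (k + 1) * u)\<close>, so \<open>(-1) ^ m\<close> times its
  \<open>m\<close>-th derivative at \<open>0\<close> is the divergent series for \<Phi>(z,-m,1). The
  coefficient is defined by that derivative, since its identity with the Lerch value can be proved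
  only once the continuation exists.\<close>

definition lerch_coeff :: "complex \<Rightarrow> nat \<Rightarrow> complex" where
  "lerch_coeff z m = (-1) ^ m * fact m * fps_nth (fps_exp (-1) / (1 - fps_const z * fps_exp (-1))) m"

definition lerch_rest :: "complex \<Rightarrow> nat \<Rightarrow> real \<Rightarrow> complex" where
  "lerch_rest z N u = lerch_gen z (of_real u) - (\<Sum>m<N. of_real (- u) ^ m * lerch_coeff z m / fact m)"

context
  fixes z :: complex
  assumes z: "norm z = 1" "z \<noteq> 1"
begin

lemma lerch_gen_fps:
  "lerch_gen z has_fps_expansion fps_exp (-1) / (1 - fps_const z * fps_exp (-1))"
  unfolding lerch_gen_def using z
  by (auto intro!: fps_expansion_intros)

text \<open>Coefficient comparison in \<open>G * (1 - fps_const z * E) = E\<close>. It mirrors the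
  shift \<Phi>(z,s,1) = 1 + z \<Phi>(z,s,2) at \<open>s = -m\<close>, with
  \<open>(k + 2) ^ m\<close> expanded in powers of \<open>k + 1\<close>. The sum includes
  \<open>j = m\<close>, so the equation is implicit in \<open>lerch_coeff z m\<close>.\<close>

lemma lerch_coeff_rec:
  "lerch_coeff z m = 1 + z * (\<Sum>j\<le>m. of_nat (m choose j) * lerch_coeff z j)"
proof -
  define E :: "complex fps" where "E = fps_exp (-1)"
  define G where "G = E / (1 - fps_const z * E)"
  have "fps_nth (1 - fps_const z * E) 0 \<noteq> 0"
    using z by (simp add: E_def)
  then have "G * (1 - fps_const z * E) = E"
    unfolding G_def by (simp add: fps_divide_unit mult.assoc inverse_mult_eq_1)
  then have "G = E + fps_const z * (G * E)"
    by (simp add: algebra_simps)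
  then have Gm: "fps_nth G m = fps_nth E m + z * (\<Sum>j\<le>m. fps_nth G j * fps_nth E (m - j))"
    by (metis fps_add_nth fps_mult_left_const_nth fps_mult_nth atLeast0AtMost)
  have E1: "(-1) ^ m * fact m * fps_nth E m = 1"
    by (simp add: E_def flip: power_mult_distrib)
  have binom: "(-1) ^ m * fact m * (fps_nth G j * fps_nth E (m - j)) = of_nat (m choose j) * lerch_coeff z j"
    if "j \<le> m" for j
  proof -
    have "(-1 :: complex) ^ m = (-1) ^ j * (-1) ^ (m - j)"
      using that by (simp flip: power_add)
    moreover have "(-1 :: complex) ^ (m - j) * (-1) ^ (m - j) = 1"
      by (simp flip: power_mult_distrib)
    ultimately have "(-1) ^ m * fact m * (fps_nth G j * fps_nth E (m - j)) = (-1) ^ j * (fact m / fact (m - j)) * fps_nth G j"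
      by (simp add: E_def)
    also have "\<dots> = of_nat (m choose j) * lerch_coeff z j"
      using that by (simp add: lerch_coeff_def binomial_fact G_def E_def)
    finally show ?thesis .
  qed
  have "lerch_coeff z m = (-1) ^ m * fact m * fps_nth G m"
    by (simp add: lerch_coeff_def G_def E_def)
  also have "\<dots> = (-1) ^ m * fact m * fps_nth E m
      + z * (\<Sum>j\<le>m. (-1) ^ m * fact m * (fps_nth G j * fps_nth E (m - j)))"
    unfolding Gm sum_distrib_left[symmetric] by (simp only: distrib_left mult_ac)
  also have "\<dots> = 1 + z * (\<Sum>j\<le>m. of_nat (m choose j) * lerch_coeff z j)"
    unfolding E1 by (simp add: binom)
  finally show ?thesis .
qed

lemma lerch_coeff_0: "lerch_coeff z 0 = 1 / (1 - z)"
proof -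
  define a where "a = lerch_coeff z 0"
  have "a = 1 + z * a"
    unfolding a_def by (rule trans[OF lerch_coeff_rec]) simp
  then have "a - z * a = 1" by (metis add_diff_cancel_right')
  then have "a * (1 - z) = 1" by (simp add: algebra_simps)
  then show ?thesis using z(2) by (simp add: nonzero_eq_divide_eq a_def)
qed

lemma lerch_denom_nonzero: "u > 0 \<Longrightarrow> 1 - z * of_real (exp (- u)) \<noteq> 0"
proof
  assume u: "u > 0" and "1 - z * of_real (exp (- u)) = 0"
  then have "norm (z * of_real (exp (- u))) = norm (1 :: complex)"
    by (metis eq_iff_diff_eq_0)
  then show False using u z by (simp add: norm_mult)
qed

lemma lerch_gen_of_real:
  "lerch_gen z (of_real u) = of_real (exp (- u)) / (1 - z * of_real (exp (- u)))"
  by (simp add: lerch_gen_def flip: exp_of_real)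

lemma continuous_on_lerch_rest: "continuous_on {0<..} (lerch_rest z N)"
  unfolding lerch_rest_def lerch_gen_of_real using lerch_denom_nonzero
  by (auto intro!: continuous_intros)

lemma lerch_rest_near_0:
  "\<exists>C r. r > 0 \<and> (\<forall>u. 0 < u \<and> u < r \<longrightarrow> norm (lerch_rest z N u) \<le> C * u ^ N)"
proof -
  define G where "G = fps_exp (-1) / (1 - fps_const z * fps_exp (-1))"
  define P where "P = (\<Sum>m<N. fps_const (fps_nth G m) * fps_X ^ m)"
  define q where "q = (\<lambda>w. lerch_gen z w - (\<Sum>m<N. fps_nth G m * w ^ m))"
  have q: "q has_fps_expansion (G - P)"
    unfolding q_def P_def using lerch_gen_fps[folded G_def]
    by (intro fps_expansion_intros) auto
  have nth: "fps_nth (G - P) n = 0" if "n < N" for n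
    using that by (simp add: P_def fps_sum_nth if_distrib[of "(*) _"] cong: if_cong)
  have rest: "lerch_rest z N u = q (of_real u)" for u
  proof -
    have "of_real (- u) ^ m * lerch_coeff z m / fact m = fps_nth G m * of_real u ^ m" for m
    proof -
      have "of_real (- u) ^ m * lerch_coeff z m / fact m = ((-1) ^ m * (-1) ^ m) * (fps_nth G m * of_real u ^ m)"
        using power_minus[of "complex_of_real u" m] by (simp add: lerch_coeff_def G_def mult_ac)
      also have "(-1 :: complex) ^ m * (-1) ^ m = 1"
        by (simp flip: power_mult_distrib)
      finally show ?thesis by simp
    qed
    then show ?thesis by (simp add: lerch_rest_def q_def)
  qed
  show ?thesis
  \<comment> \<open>The zero series has \<open>subdegree\<close> equal to \<open>0\<close>, so the
    vanishing of its first \<open>N\<close> coefficients does not give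
    \<open>N \<le> subdegree\<close>; in that case the remainder is identically \<open>0\<close>
    near the origin.\<close>
  proof (cases "G - P = 0")
    case True
    then have "eventually (\<lambda>w. q w = 0) (nhds 0)"
      using q has_fps_expansion_0_iff[of q] by simp
    then obtain r where "r > 0" "\<And>w. dist w 0 < r \<Longrightarrow> q w = 0"
      unfolding eventually_nhds_metric by auto
    then show ?thesis
      by (intro exI[of _ 0] exI[of _ r]) (auto simp: rest)
  next
    case False
    then have "N \<le> subdegree (G - P)"
      using nth by (meson leI nth_subdegree_nonzero)
    from has_fps_expansion_shift[OF q this refl]
    have "isCont (\<lambda>w. if w = 0 then fps_nth (G - P) N else q w / w ^ N) 0" (is "isCont ?k 0")
      by (rule has_fps_expansion_imp_continuous)
    then obtain r where r: "r > 0" "\<And>w. dist w 0 < r \<Longrightarrow> dist (?k w) (?k 0) < 1"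
      unfolding continuous_at_eps_delta by (metis zero_less_one)
    have "norm (lerch_rest z N u) \<le> (norm (?k 0) + 1) * u ^ N" if "0 < u" "u < r" for u
    proof -
      have "norm (?k (of_real u)) \<le> norm (?k 0) + 1"
        using r(2)[of "of_real u"] that norm_triangle_sub[of "?k (of_real u)" "?k 0"]
        by (simp add: dist_norm)
      then show ?thesis
        using that by (simp add: rest norm_divide norm_power pos_divide_le_eq)
    qed
    then show ?thesis using r(1) by blast
  qed
qed

text \<open>Near \<open>0\<close> this is Taylor's estimate. For \<open>u \<ge> r\<close> the
  generating function is bounded, and each subtracted term has degree \<open>m < N\<close>, so
  everything is at most a constant times \<open>u ^ N\<close>. The exponential factor of the Mellin
  kernels takes care of the growth.\<close>

lemma lerch_rest_bound: "\<exists>C\<ge>0. \<forall>u>0. norm (lerch_rest z N u) \<le> C * u ^ N"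
proof -
  obtain C0 r where r: "r > 0" and near: "\<And>u. 0 < u \<Longrightarrow> u < r \<Longrightarrow> norm (lerch_rest z N u) \<le> C0 * u ^ N"
    using lerch_rest_near_0[of N] by blast
  define C1 where "C1 = 1 / (1 - exp (- r)) / r ^ N + (\<Sum>m<N. norm (lerch_coeff z m) / fact m * r ^ m / r ^ N)"
  have er: "exp (- r) < 1" using r by simp
  have far: "norm (lerch_rest z N u) \<le> C1 * u ^ N" if "u \<ge> r" for u
  proof -
    have u: "u > 0" using that r by simp
    have mono: "r ^ N * u ^ m \<le> r ^ m * u ^ N" if "m \<le> N" for m
    proof -
      have "r ^ (N - m) * (r ^ m * u ^ m) \<le> u ^ (N - m) * (r ^ m * u ^ m)"
        using \<open>u \<ge> r\<close> r u by (intro mult_right_mono power_mono) auto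
      also have "r ^ (N - m) * (r ^ m * u ^ m) = r ^ N * u ^ m"
        using that by (simp flip: power_add mult.assoc)
      also have "u ^ (N - m) * (r ^ m * u ^ m) = r ^ m * u ^ N"
        using that by (simp add: mult.left_commute[of _ "r ^ m"] flip: power_add)
      finally show ?thesis .
    qed
    have "1 - exp (- r) \<le> norm (1 - z * of_real (exp (- u)))"
      using norm_triangle_ineq2[of 1 "z * of_real (exp (- u))"] that by (simp add: norm_mult z)
        (smt (verit) exp_le_cancel_iff)
    then have "norm (lerch_gen z (of_real u)) \<le> 1 / (1 - exp (- r))"
      unfolding lerch_gen_of_real norm_divide using er u by (intro frac_le) auto
    also have "\<dots> = 1 / (1 - exp (- r)) / r ^ N * r ^ N"
      using r by simp
    also have "\<dots> \<le> 1 / (1 - exp (- r)) / r ^ N * u ^ N"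
      using that r er by (intro mult_left_mono power_mono) auto
    finally have 1: "norm (lerch_gen z (of_real u)) \<le> 1 / (1 - exp (- r)) / r ^ N * u ^ N" .
    have "norm (of_real (- u) ^ m * lerch_coeff z m / fact m) \<le> norm (lerch_coeff z m) / fact m * r ^ m / r ^ N * u ^ N"
      if "m < N" for m
    proof -
      have "u ^ m \<le> r ^ m / r ^ N * u ^ N"
        using mono[of m] that r by (simp add: field_simps)
      then have "norm (lerch_coeff z m) / fact m * u ^ m \<le> norm (lerch_coeff z m) / fact m * (r ^ m / r ^ N * u ^ N)"
        by (intro mult_left_mono) auto
      also have "norm (lerch_coeff z m) / fact m * u ^ m = norm (of_real (- u) ^ m * lerch_coeff z m / fact m)"
        using u by (simp add: norm_mult norm_divide norm_power)
      finally show ?thesis by (simp only: times_divide_eq_right mult.assoc times_divide_eq_left)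
    qed
    then have "norm (\<Sum>m<N. of_real (- u) ^ m * lerch_coeff z m / fact m)
       \<le> (\<Sum>m<N. norm (lerch_coeff z m) / fact m * r ^ m / r ^ N * u ^ N)"
      by (intro sum_norm_le) simp
    from order_trans[OF norm_triangle_ineq4 add_mono[OF 1 this]] show ?thesis
      unfolding lerch_rest_def C1_def distrib_right sum_distrib_right .
  qed
  have "norm (lerch_rest z N u) \<le> (\<bar>C0\<bar> + \<bar>C1\<bar>) * u ^ N" if "u > 0" for u
  proof -
    have "norm (lerch_rest z N u) \<le> max C0 C1 * u ^ N"
    proof (cases "u < r")
      case True
      then have "norm (lerch_rest z N u) \<le> C0 * u ^ N" using near that by simp
      also have "\<dots> \<le> max C0 C1 * u ^ N" using that by (intro mult_right_mono) auto
      finally show ?thesis .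
    next
      case False
      then have "norm (lerch_rest z N u) \<le> C1 * u ^ N" using far by simp
      also have "\<dots> \<le> max C0 C1 * u ^ N" using that by (intro mult_right_mono) auto
      finally show ?thesis .
    qed
    also have "\<dots> \<le> (\<bar>C0\<bar> + \<bar>C1\<bar>) * u ^ N"
      using that by (intro mult_right_mono) auto
    finally show ?thesis .
  qed
  then show ?thesis by (intro exI[of _ "\<bar>C0\<bar> + \<bar>C1\<bar>"]) auto
qed

end

section \<open>Continuation of the Lerch series by Taylor subtraction under the Mellin
  integral\<close>

lemma set_integrable_Mellin:
  fixes h :: "real \<Rightarrow> complex"
  assumes cont: "continuous_on {0<..} h" and c: "c > 0" and s: "Re s > - a"
    and bound: "\<And>u. u > 0 \<Longrightarrow> norm (h u) \<le> C * u powr a * exp (- (c * u))"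
  shows "set_integrable lborel {0<..} (\<lambda>u. of_real u powr (s - 1) * h u)"
proof (rule set_integrable_bound)
  show "set_integrable lborel {0<..} (\<lambda>u. C * (u powr ((Re s + a) - 1) * exp (- (c * u))))"
    using c s by (intro set_integrable_mult_right Gamma_set_integral_real) auto
  show "set_borel_measurable lborel {0<..} (\<lambda>u. of_real u powr (s - 1) * h u)"
    by (intro set_borel_measurable_Ioi_continuous continuous_intros cont) (auto simp: complex_nonpos_Reals_iff)
  show "AE u in lborel. u \<in> {0<..} \<longrightarrow> norm (of_real u powr (s - 1) * h u)
      \<le> norm (C * (u powr ((Re s + a) - 1) * exp (- (c * u))))"
  proof (intro AE_I2 impI)
    fix u :: real assume "u \<in> {0<..}"
    then have u: "u > 0" by simp
    have "norm (of_real u powr (s - 1) * h u) = u powr (Re s - 1) * norm (h u)"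
      using u by (simp add: norm_mult norm_powr_real_powr)
    also have "\<dots> \<le> u powr (Re s - 1) * (C * u powr a * exp (- (c * u)))"
      by (intro mult_left_mono bound u) auto
    also have "\<dots> = C * (u powr ((Re s + a) - 1) * exp (- (c * u)))"
      using powr_add[of u "Re s - 1" a] by (simp add: algebra_simps)
    finally show "norm (of_real u powr (s - 1) * h u) \<le> norm (C * (u powr ((Re s + a) - 1) * exp (- (c * u))))"
      by simp
  qed
qed

lemma set_integral_finite_sum:
  fixes f :: "'i \<Rightarrow> 'a \<Rightarrow> 'b::{banach, second_countable_topology}"
  assumes "\<And>i. i \<in> I \<Longrightarrow> set_integrable M A (f i)"
  shows "set_integrable M A (\<lambda>x. \<Sum>i\<in>I. f i x)"
    and "(LINT x:A|M. (\<Sum>i\<in>I. f i x)) = (\<Sum>i\<in>I. LINT x:A|M. f i x)"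
  using assms unfolding set_integrable_def set_lebesgue_integral_def scaleR_sum_right
  by (intro Bochner_Integration.integrable_sum Bochner_Integration.integral_sum; simp)+

text \<open>
  For \<open>Re s > 0\<close> this is the series of \<open>z ^ k * (k + l + 1) powr (-s)\<close>, rewritten by subtracting \<open>N\<close> terms
  of the Taylor expansion under the Mellin integral.
\<close>

definition lerch_tail :: "complex \<Rightarrow> nat \<Rightarrow> nat \<Rightarrow> complex \<Rightarrow> complex" where
  "lerch_tail z N l s =
     (\<Sum>m<N. lerch_coeff z m * (-1) ^ m / fact m * pochhammer s m * of_nat l powr (- s - of_nat m))
     + rGamma s * (LINT u:{0<..}|lborel. of_real u powr (s - 1) * (of_real (exp (- (real l * u))) * lerch_rest z N u))"

definition lerch_cont :: "complex \<Rightarrow> nat \<Rightarrow> nat \<Rightarrow> complex \<Rightarrow> complex" where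
  "lerch_cont z N l s = (\<Sum>k<l. z ^ k * of_nat (Suc k) powr (- s)) + z ^ l * lerch_tail z N l s"

text \<open>The Mellin transform of a power \<open>u ^ m\<close> times an exponential carries
  \<open>Gamma (s + m)\<close>; after division by \<open>Gamma s\<close> only a polynomial in
  \<open>s\<close> is left, which continues to the whole plane.\<close>

lemma rGamma_mult_Gamma_add:
  fixes s :: complex
  assumes "Re s > 0"
  shows "rGamma s * Gamma (s + of_nat m) = pochhammer s m"
proof -
  have "s + of_nat m \<notin> \<int>\<^sub>\<le>\<^sub>0"
    using assms by (auto elim!: nonpos_Ints_cases simp: complex_eq_iff)
  then show ?thesis
    using pochhammer_rGamma[of s m] by (simp add: rGamma_inverse_Gamma[of "s + _"] Gamma_eq_zero_iff)
qed

context
  fixes z :: complex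
  assumes z: "norm z = 1" "z \<noteq> 1"
begin

lemma continuous_on_lerch_kernel:
  "continuous_on {0<..} (\<lambda>u. of_real (exp (- (c * u))) * lerch_rest z N u)"
  by (intro continuous_intros continuous_on_lerch_rest z)

lemma lerch_kernel_bound:
  "\<exists>C\<ge>0. \<forall>c. \<forall>u>0. norm (of_real (exp (- (c * u))) * lerch_rest z N u) \<le> C * u powr real N * exp (- (c * u))"
proof -
  obtain C where C: "C \<ge> 0" "\<And>u. u > 0 \<Longrightarrow> norm (lerch_rest z N u) \<le> C * u ^ N"
    using lerch_rest_bound[OF z, of N] by auto
  then show ?thesis
    by (intro exI[of _ C]) (auto simp: norm_mult powr_realpow mult.commute[of "exp _"] intro!: mult_right_mono)
qed

lemma lerch_kernel_integrable:
  assumes "c > 0" "Re s > - real N"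
  shows "set_integrable lborel {0<..} (\<lambda>u. of_real u powr (s - 1) * (of_real (exp (- (c * u))) * lerch_rest z N u))"
proof -
  obtain C where C: "\<And>c u. u > 0 \<Longrightarrow> norm (of_real (exp (- (c * u))) * lerch_rest z N u) \<le> C * u powr real N * exp (- (c * u))"
    using lerch_kernel_bound[of N] by auto
  show ?thesis
    by (rule set_integrable_Mellin[OF continuous_on_lerch_kernel assms C])
qed

lemma lerch_kernel_holomorphic:
  assumes "c > 0"
  shows "(\<lambda>s. LINT u:{0<..}|lborel. of_real u powr (s - 1) * (of_real (exp (- (c * u))) * lerch_rest z N u))
    holomorphic_on {s. Re s > - real N}"
proof -
  obtain C where C: "\<And>c u. u > 0 \<Longrightarrow> norm (of_real (exp (- (c * u))) * lerch_rest z N u) \<le> C * u powr real N * exp (- (c * u))"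
    using lerch_kernel_bound[of N] by auto
  have "\<exists>D. ((\<lambda>s. LINT u:{0<..}|lborel. of_real u powr (s - 1) * (of_real (exp (- (c * u))) * lerch_rest z N u))
      has_field_derivative D) (at s)" if "Re s > - real N" for s
    by (rule exI, rule has_field_derivative_Mellin[OF continuous_on_lerch_kernel assms that C])
  then show ?thesis
    by (subst holomorphic_on_open) (auto simp: open_halfspace_Re_gt)
qed

text \<open>For \<open>Re s > 0\<close> each subtracted Taylor term has a convergent Mellin
  transform of its own, a Gamma integral. Multiplied by \<open>rGamma s\<close> it becomes the
  Pochhammer summand, so the explicit sum restores exactly what was subtracted inside the
  integral.\<close>

lemma lerch_tail_0:
  assumes "l \<ge> 1" and s: "Re s > 0"
  shows "lerch_tail z N l s = lerch_tail z 0 l s"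
proof -
  let ?I = "\<lambda>N. LINT u:{0<..}|lborel. of_real u powr (s - 1) * (of_real (exp (- (real l * u))) * lerch_rest z N u)"
  define T where "T = (\<lambda>m u. lerch_coeff z m * (-1) ^ m / fact m *
      (complex_of_real u powr (s + of_nat m - 1) * of_real (exp (- (real l * u)))))"
  have l: "real l > 0" using assms by simp
  have intT: "set_integrable lborel {0<..} (T m)" for m
    unfolding T_def using l s by (intro set_integrable_mult_right Gamma_set_integral_complex) auto
  have "of_real u powr (s - 1) * (of_real (exp (- (real l * u))) * lerch_rest z 0 u)
      = of_real u powr (s - 1) * (of_real (exp (- (real l * u))) * lerch_rest z N u) + (\<Sum>m<N. T m u)"
    if "u \<in> {0<..}" for u
  proof -
    have "of_real u powr (s - 1) * (of_real (exp (- (real l * u))) * (of_real (- u) ^ m * lerch_coeff z m / fact m)) = T m u" for m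
    proof -
      have "complex_of_real u powr (s + of_nat m - 1) = of_real u powr (s - 1) * of_real u ^ m"
        using that powr_add[of "complex_of_real u" "s - 1" "of_nat m"] by (simp add: powr_nat' algebra_simps)
      then show ?thesis
        using power_minus[of "complex_of_real u" m] by (simp add: T_def mult_ac)
    qed
    moreover have "lerch_rest z 0 u = lerch_rest z N u + (\<Sum>m<N. of_real (- u) ^ m * lerch_coeff z m / fact m)"
      by (simp add: lerch_rest_def)
    ultimately show ?thesis
      by (simp only: distrib_left sum_distrib_left)
  qed
  then have "?I 0 = (LINT u:{0<..}|lborel. of_real u powr (s - 1) * (of_real (exp (- (real l * u))) * lerch_rest z N u) + (\<Sum>m<N. T m u))"
    by (intro set_lebesgue_integral_cong) auto
  also have "\<dots> = ?I N + (LINT u:{0<..}|lborel. (\<Sum>m<N. T m u))"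
    using intT s by (intro set_integral_add lerch_kernel_integrable l set_integral_finite_sum(1)) auto
  also have "(LINT u:{0<..}|lborel. (\<Sum>m<N. T m u)) = (\<Sum>m<N. LINT u:{0<..}|lborel. T m u)"
    using intT by (intro set_integral_finite_sum(2)) auto
  also have "\<dots> = (\<Sum>m<N. lerch_coeff z m * (-1) ^ m / fact m * (Gamma (s + of_nat m) * of_nat l powr (- s - of_nat m)))"
    unfolding T_def using Gamma_set_integral_complex(2)[OF _ l, of "s + of_nat _"] s by simp
  finally show ?thesis
    using rGamma_mult_Gamma_add[OF s]
    by (simp add: lerch_tail_def distrib_left sum_distrib_left mult_ac flip: rGamma_mult_Gamma_add[OF s])
qed

text \<open>For \<open>0 < Re s \<le> 1\<close> the series does not converge absolutely, so sum and
  integral cannot be exchanged term by term. Its partial sums are geometric: they equal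
  \<open>1 - q ^ n\<close> times the full integrand with \<open>q = z * exp (- u)\<close> of modulus
  below \<open>1\<close>, and are dominated by twice that integrand.\<close>

lemma lerch_tail_0_sums:
  assumes "l \<ge> 1" and s: "Re s > 0"
  shows "(\<lambda>k. z ^ k * of_nat (Suc (k + l)) powr (- s)) sums lerch_tail z 0 l s"
proof -
  have l: "real l > 0" using assms by simp
  obtain C where C: "\<And>c u. u > 0 \<Longrightarrow> norm (of_real (exp (- (c * u))) * lerch_rest z 0 u) \<le> C * u powr real 0 * exp (- (c * u))"
    using lerch_kernel_bound[of 0] by auto
  define w where "w = (\<lambda>u. complex_of_real u powr (s - 1) * (of_real (exp (- (real l * u))) * lerch_rest z 0 u))"
  define S where "S = (\<lambda>n u. complex_of_real u powr (s - 1) * (\<Sum>k<n. z ^ k * of_real (exp (- (real (Suc (k + l)) * u)))))"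
  have Sw: "S n u = (1 - (z * of_real (exp (- u))) ^ n) * w u" if "u > 0" for n u
  proof -
    have "exp (- (real (Suc (k + l)) * u)) = exp (- (real l * u)) * (exp (- u) * exp (- u) ^ k)" for k
      by (simp add: exp_of_nat_mult[symmetric] algebra_simps flip: exp_add)
    then have "(\<Sum>k<n. z ^ k * of_real (exp (- (real (Suc (k + l)) * u))))
        = of_real (exp (- (real l * u))) * (of_real (exp (- u)) * (\<Sum>k<n. (z * of_real (exp (- u))) ^ k))"
      by (simp only: sum_distrib_left power_mult_distrib of_real_mult of_real_power mult_ac)
    also have "(\<Sum>k<n. (z * of_real (exp (- u))) ^ k) = (1 - (z * of_real (exp (- u))) ^ n) / (1 - z * of_real (exp (- u)))"
      using lerch_denom_nonzero[OF z that] by (simp add: sum_gp_strict)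
    finally show ?thesis
      by (simp add: S_def w_def lerch_rest_def lerch_gen_of_real[OF z])
  qed
  have intS: "set_integrable lborel {0<..} (\<lambda>u. z ^ k * (complex_of_real u powr (s - 1) * of_real (exp (- (real (Suc (k + l)) * u)))))" for k
    using s by (intro set_integrable_mult_right Gamma_set_integral_complex) auto
  have S: "S n u = (\<Sum>k<n. z ^ k * (complex_of_real u powr (s - 1) * of_real (exp (- (real (Suc (k + l)) * u)))))" for n u
    unfolding S_def sum_distrib_left by (intro sum.cong refl) (simp only: mult_ac)
  have intw: "set_integrable lborel {0<..} w"
    unfolding w_def using s by (intro lerch_kernel_integrable l) auto
  have "(\<lambda>n. LINT u:{0<..}|lborel. S n u) \<longlonglongrightarrow> (LINT u:{0<..}|lborel. w u)"
    unfolding set_lebesgue_integral_def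
  proof (rule integral_dominated_convergence)
    show "(\<lambda>u. indicator {0<..} u *\<^sub>R w u) \<in> borel_measurable lborel"
      using intw unfolding set_integrable_def by (rule borel_measurable_integrable)
    show "(\<lambda>u. indicator {0<..} u *\<^sub>R S n u) \<in> borel_measurable lborel" for n
    proof -
      have "set_integrable lborel {0<..} (S n)"
        unfolding S using intS by (intro set_integral_finite_sum(1)) auto
      then show ?thesis
        unfolding set_integrable_def by (rule borel_measurable_integrable)
    qed
    show "integrable lborel (\<lambda>u. norm (indicator {0<..} u *\<^sub>R w u) * 2)"
      using intw unfolding set_integrable_def by (intro integrable_mult_left) (rule integrable_norm)
    have q: "norm (z * of_real (exp (- u))) < 1" if "u > 0" for u
      using that by (simp add: norm_mult z)
    show "AE u in lborel. (\<lambda>n. indicator {0<..} u *\<^sub>R S n u) \<longlonglongrightarrow> indicator {0<..} u *\<^sub>R w u"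
    proof (rule AE_I2)
      fix u :: real
      show "(\<lambda>n. indicator {0<..} u *\<^sub>R S n u) \<longlonglongrightarrow> indicator {0<..} u *\<^sub>R w u"
      proof (cases "u > 0")
        case True
        have "(\<lambda>n. (1 - (z * of_real (exp (- u))) ^ n) * w u) \<longlonglongrightarrow> (1 - 0) * w u"
          by (intro tendsto_intros LIMSEQ_power_zero q True)
        then show ?thesis using True by (simp add: Sw)
      qed simp
    qed
    show "AE u in lborel. norm (indicator {0<..} u *\<^sub>R S n u) \<le> norm (indicator {0<..} u *\<^sub>R w u) * 2" for n
    proof (rule AE_I2)
      fix u :: real
      show "norm (indicator {0<..} u *\<^sub>R S n u) \<le> norm (indicator {0<..} u *\<^sub>R w u) * 2"
      proof (cases "u > 0")
        case True
        have "norm ((z * of_real (exp (- u))) ^ n) \<le> 1"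
          unfolding norm_power using q[OF True] by (intro power_le_one) auto
        then have "norm (1 - (z * of_real (exp (- u))) ^ n) \<le> 2"
          using norm_triangle_ineq4[of 1 "(z * of_real (exp (- u))) ^ n"] by simp
        then have "norm (1 - (z * of_real (exp (- u))) ^ n) * norm (w u) \<le> 2 * norm (w u)"
          by (intro mult_right_mono) auto
        then show ?thesis using True by (simp add: Sw norm_mult mult.commute)
      qed simp
    qed
  qed
  moreover have "(LINT u:{0<..}|lborel. S n u) = (\<Sum>k<n. z ^ k * (Gamma s * of_nat (Suc (k + l)) powr (- s)))" for n
  proof -
    have "(LINT u:{0<..}|lborel. S n u) = (\<Sum>k<n. LINT u:{0<..}|lborel. z ^ k * (complex_of_real u powr (s - 1) * of_real (exp (- (real (Suc (k + l)) * u)))))"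
      unfolding S using intS by (intro set_integral_finite_sum(2)) auto
    also have "\<dots> = (\<Sum>k<n. z ^ k * (Gamma s * of_nat (Suc (k + l)) powr (- s)))"
    proof (intro sum.cong refl)
      fix k
      have "0 < real (Suc (k + l))" by simp
      from Gamma_set_integral_complex(2)[OF s this]
      show "(LINT u:{0<..}|lborel. z ^ k * (complex_of_real u powr (s - 1) * of_real (exp (- (real (Suc (k + l)) * u)))))
          = z ^ k * (Gamma s * of_nat (Suc (k + l)) powr (- s))"
        by (simp only: set_integral_mult_right of_real_of_nat_eq)
    qed
    finally show ?thesis .
  qed
  ultimately have "(\<lambda>n. rGamma s * (\<Sum>k<n. z ^ k * (Gamma s * of_nat (Suc (k + l)) powr (- s))))
      \<longlonglongrightarrow> rGamma s * (LINT u:{0<..}|lborel. w u)"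
    by (intro tendsto_intros) simp
  moreover have "rGamma s * (\<Sum>k<n. z ^ k * (Gamma s * of_nat (Suc (k + l)) powr (- s)))
      = (\<Sum>k<n. z ^ k * of_nat (Suc (k + l)) powr (- s))" for n
    using rGamma_mult_Gamma_add[OF s, of 0] by (simp add: sum_distrib_left mult_ac)
       (simp add: mult.assoc[symmetric])
  ultimately show ?thesis
    by (simp add: sums_def lerch_tail_def w_def)
qed

lemma lerch_cont_sums:
  assumes "l \<ge> 1" and s: "Re s > 0"
  shows "(\<lambda>k. z ^ k * of_nat (Suc k) powr (- s)) sums lerch_cont z N l s"
proof -
  have "(\<lambda>k. z ^ l * (z ^ k * of_nat (Suc (k + l)) powr (- s))) sums (z ^ l * lerch_tail z N l s)"
    unfolding lerch_tail_0[OF assms, of N] by (intro sums_mult lerch_tail_0_sums assms)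
  moreover have "z ^ l * (z ^ k * of_nat (Suc (k + l)) powr (- s)) = z ^ (k + l) * of_nat (Suc (k + l)) powr (- s)" for k
    by (subst power_add) (simp only: mult_ac)
  ultimately have "(\<lambda>k. z ^ (k + l) * of_nat (Suc (k + l)) powr (- s)) sums (z ^ l * lerch_tail z N l s)"
    by (simp only:)
  from iffD1[OF sums_iff_shift[where f = "\<lambda>k. z ^ k * of_nat (Suc k) powr (- s)"] this]
  show ?thesis
    unfolding lerch_cont_def by (subst add.commute)
qed

lemma lerch_cont_holomorphic:
  assumes "l \<ge> 1"
  shows "lerch_cont z N l holomorphic_on {s. Re s > - real N}"
proof -
  have "(\<lambda>s. pochhammer s m) holomorphic_on A" for m and A :: "complex set"
    by (simp add: pochhammer_prod) (intro holomorphic_intros)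
  moreover have "of_nat (Suc k) \<noteq> (0 :: complex)" for k
    by (simp del: of_nat_Suc)
  ultimately show ?thesis
    using assms unfolding lerch_cont_def lerch_tail_def
    by (intro holomorphic_intros lerch_kernel_holomorphic) auto
qed

end

text \<open>Only the value \<open>h 0\<close> enters. This evaluates the derivatives at
  \<open>0\<close> of the Pochhammer terms and of \<open>rGamma s\<close> times the Mellin integral,
  each of which has a factor \<open>s\<close>.\<close>

lemma has_field_derivative_times_at_0:
  fixes h :: "'a::real_normed_field \<Rightarrow> 'a"
  assumes "h field_differentiable at 0"
  shows "((\<lambda>s. s * h s) has_field_derivative h 0) (at 0)"
proof -
  obtain D where "(h has_field_derivative D) (at 0)"
    using assms by (auto simp: field_differentiable_def)
  from DERIV_mult[OF DERIV_ident this] show ?thesis by simp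
qed

lemma field_differentiable_pochhammer:
  "(\<lambda>s::complex. pochhammer (s + a) m) field_differentiable at s0"
proof -
  have "(\<lambda>s::complex. pochhammer (s + a) m) holomorphic_on UNIV"
    by (simp add: pochhammer_prod) (intro holomorphic_intros)
  then show ?thesis by (simp add: holomorphic_on_def)
qed

lemma field_differentiable_of_real_powr:
  "x > 0 \<Longrightarrow> (\<lambda>s. complex_of_real x powr (- s - a)) field_differentiable at s0"
proof -
  assume "x > 0"
  then have "(\<lambda>s. complex_of_real x powr (- s - a)) holomorphic_on UNIV"
    by (intro holomorphic_intros) auto
  then show ?thesis by (simp add: holomorphic_on_def)
qed

lemma has_field_derivative_powr_uminus_at_0:
  assumes "x > 0"
  shows "((\<lambda>s. complex_of_real x powr (- s)) has_field_derivative - of_real (ln x)) (at 0)"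
proof -
  have "((\<lambda>s. complex_of_real x powr (- s)) has_field_derivative
      Ln (of_real x) * of_real x powr (- 0) * (- 1)) (at 0)"
    using assms by (intro DERIV_chain2[OF has_field_derivative_powr_right]) (auto intro!: derivative_eq_intros)
  then show ?thesis using assms by (simp add: Ln_of_real)
qed

section \<open>Identification with \<open>lerch_phi\<close>, its values at negative integers and its
  derivative at \<open>0\<close>\<close>

context
  fixes z :: complex
  assumes z: "norm z = 1" "z \<noteq> 1"
begin

lemma lerch_cont_unique:
  assumes "l \<ge> 1" "k \<ge> 1" "Re s > - real N" "Re s > - real M"
  shows "lerch_cont z N l s = lerch_cont z M k s"
proof (rule analytic_continuation_open[of "{s. Re s > 0}" "{s. Re s > - real (min N M)}"
      "lerch_cont z N l" "lerch_cont z M k"])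
  show "{s. Re s > 0} \<noteq> {}" by (auto intro!: exI[of _ 1])
  show "connected {s. Re s > - real (min N M)}"
    by (intro convex_connected convex_halfspace_Re_gt)
  show "lerch_cont z N l holomorphic_on {s. Re s > - real (min N M)}"
    by (rule holomorphic_on_subset[OF lerch_cont_holomorphic[OF z assms(1)]]) auto
  show "lerch_cont z M k holomorphic_on {s. Re s > - real (min N M)}"
    by (rule holomorphic_on_subset[OF lerch_cont_holomorphic[OF z assms(2)]]) auto
  show "lerch_cont z N l w = lerch_cont z M k w" if "w \<in> {s. Re s > 0}" for w
    using that assms by (intro sums_unique2[OF lerch_cont_sums[OF z] lerch_cont_sums[OF z]]) auto
  show "s \<in> {s. - real (min N M) < Re s}" using assms by (auto simp: min_def)
qed (auto simp: open_halfspace_Re_gt)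

lemma lerch_phi_eq_lerch_cont:
  assumes "l \<ge> 1" "Re s > - real N"
  shows "lerch_phi z s 1 = lerch_cont z N l s"
proof -
  \<comment> \<open>No single \<open>N\<close> reaches the whole plane. Each point takes its own
    \<open>N\<close> with \<open>Re s > - N\<close>, and holomorphy is glued over the increasing
    half-planes, on each of which \<open>F\<close> agrees with one
    \<open>lerch_cont\<close>.\<close>
  define F where "F = (\<lambda>s. lerch_cont z (Suc (nat \<lceil>\<bar>Re s\<bar>\<rceil>)) 1 s)"
  have F: "F s = lerch_cont z N l s" if "l \<ge> 1" "Re s > - real N" for N l s
    unfolding F_def using that by (intro lerch_cont_unique) linarith+
  let ?P = "\<lambda>F. F holomorphic_on UNIV \<and>
       (\<forall>w. Re w > 1 \<longrightarrow> (\<lambda>k. z ^ k * (of_nat k + of_real 1) powr (- w)) sums F w)"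
  have "F holomorphic_on (\<Union>N\<in>UNIV. {s. Re s > - real N})"
  proof (rule holomorphic_on_UN_open)
    show "F holomorphic_on {s. Re s > - real N}" for N
    proof (rule holomorphic_transform[OF lerch_cont_holomorphic[OF z order_refl]])
      show "lerch_cont z N 1 w = F w" if "w \<in> {s. Re s > - real N}" for w
        using F[OF order_refl, of N w] that by simp
    qed
  qed (auto simp: open_halfspace_Re_gt)
  also have "(\<Union>N\<in>UNIV. {s. Re s > - real N}) = UNIV"
  proof -
    have "\<exists>N. Re s > - real N" for s
      using reals_Archimedean2[of "- Re s"] by (metis minus_less_iff)
    then show ?thesis by auto
  qed
  finally have hol: "F holomorphic_on UNIV" .
  have sums: "(\<lambda>k. z ^ k * (of_nat k + of_real 1) powr (- w)) sums F w" if "Re w > 0" for w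
    using lerch_cont_sums[OF z _ that, of 1 0] F[of 1 0 w] that by (simp add: add.commute)
  have "(THE F. ?P F) = F"
  proof (rule the_equality)
    show "?P F" using hol sums by auto
    fix G assume G: "?P G"
    show "G = F"
    proof
      fix s
      show "G s = F s"
      proof (rule analytic_continuation_open[of "{s. Re s > 1}" UNIV G F])
        show "{s. Re s > 1} \<noteq> {}" by (auto intro!: exI[of _ 2])
        show "G w = F w" if "w \<in> {s. Re s > 1}" for w
          using that G by (intro sums_unique2[OF _ sums]) auto
      qed (use G hol in \<open>auto simp: open_halfspace_Re_gt\<close>)
    qed
  qed
  then show ?thesis
    using F[OF assms] by (simp add: lerch_phi_def)
qed

text \<open>At \<open>l = 1\<close> the continuation at \<open>s = -m\<close> is the right-hand side of \<open>lerch_coeff_rec\<close>.\<close>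

lemma lerch_phi_minus_of_nat: "lerch_phi z (- of_nat m) 1 = lerch_coeff z m"
proof -
  have "lerch_phi z (- of_nat m) 1 = lerch_cont z (Suc m) 1 (- of_nat m)"
    by (rule lerch_phi_eq_lerch_cont) auto
  also have "\<dots> = 1 + z * (\<Sum>j<Suc m. lerch_coeff z j * (-1) ^ j / fact j * pochhammer (- of_nat m) j)"
    by (simp add: lerch_cont_def lerch_tail_def del: sum.lessThan_Suc)
  also have "(\<Sum>j<Suc m. lerch_coeff z j * (-1) ^ j / fact j * pochhammer (- of_nat m) j)
      = (\<Sum>j\<le>m. of_nat (m choose j) * lerch_coeff z j)"
    unfolding lessThan_Suc_atMost
    by (intro sum.cong refl) (simp add: binomial_gbinomial gbinomial_pochhammer mult_ac)
  finally show ?thesis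
    by (simp only: lerch_coeff_rec[OF z, of m, symmetric])
qed

text \<open>With the Lerch values recognised as Taylor coefficients, the integral in
  \<open>lerch_R\<close> is the Mellin transform of the Taylor remainder at \<open>s = 0\<close>.
  The exponent stays in the form \<open>0 - 1\<close> to match the general
  \<open>s - 1\<close>.\<close>

lemma lerch_R_eq:
  "lerch_R z N v = (-1) ^ N * of_real v ^ N * of_nat N *
     (LINT u:{0<..}|lborel. of_real u powr (0 - 1) * (of_real (exp (- (v * u))) * lerch_rest z N u))"
proof -
  have "(LINT u:{0<..}|lborel.
        (of_real (exp (-u)) / (1 - z * of_real (exp (-u)))
          - (\<Sum>m<N. of_real (-u) ^ m * lerch_phi z (- of_nat m) 1 / fact m))
        / of_real (u * exp (v * u)))
     = (LINT u:{0<..}|lborel. of_real u powr (0 - 1) * (of_real (exp (- (v * u))) * lerch_rest z N u))"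
    by (rule set_lebesgue_integral_cong)
       (auto simp: lerch_rest_def lerch_gen_of_real[OF z] lerch_phi_minus_of_nat powr_minus exp_minus field_simps)
  then show ?thesis
    by (simp only: lerch_R_def)
qed

text \<open>Since the remainder is at most \<open>C * u ^ N\<close>, the integral is at most
  \<open>C * Gamma N * v powr (- N)\<close>, and the prefactor \<open>v ^ N\<close> cancels this
  decay exactly.\<close>

lemma bounded_lerch_R:
  assumes N: "N \<ge> 1"
  shows "bounded (lerch_R z N ` {0<..})"
proof -
  obtain C where C: "C \<ge> 0" "\<And>c u. u > 0 \<Longrightarrow> norm (of_real (exp (- (c * u))) * lerch_rest z N u) \<le> C * u powr real N * exp (- (c * u))"
    using lerch_kernel_bound[OF z, of N] by auto
  have "norm (lerch_R z N v) \<le> real N * C * Gamma (real N)" if v: "v > 0" for v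
  proof -
    let ?J = "LINT u:{0<..}|lborel. of_real u powr (0 - 1) * (of_real (exp (- (v * u))) * lerch_rest z N u)"
    have "norm ?J \<le> (LINT u:{0<..}|lborel. C * (u powr (real N - 1) * exp (- (v * u))))"
      unfolding set_lebesgue_integral_def
    proof (rule Bochner_Integration.integral_norm_bound_integral)
      show "integrable lborel (\<lambda>u. indicator {0<..} u *\<^sub>R (of_real u powr (0 - 1) * (of_real (exp (- (v * u))) * lerch_rest z N u)))"
        using lerch_kernel_integrable[OF z v, of N 0] N by (simp add: set_integrable_def)
      show "integrable lborel (\<lambda>u. indicator {0<..} u *\<^sub>R (C * (u powr (real N - 1) * exp (- (v * u)))))"
        using set_integrable_mult_right[OF Gamma_set_integral_real(1)[of "real N" v], of C] N v
        by (simp add: set_integrable_def)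
      fix u :: real
      show "norm (indicator {0<..} u *\<^sub>R (of_real u powr (0 - 1) * (of_real (exp (- (v * u))) * lerch_rest z N u)))
          \<le> indicator {0<..} u *\<^sub>R (C * (u powr (real N - 1) * exp (- (v * u))))"
      proof (cases "u > 0")
        case True
        have "norm (complex_of_real u powr (0 - 1)) = u powr (- 1)"
          using True norm_powr_real_powr[of u "0 - 1"] by simp
        then have "norm (of_real u powr (0 - 1) * (of_real (exp (- (v * u))) * lerch_rest z N u))
            \<le> u powr (- 1) * (C * u powr real N * exp (- (v * u)))"
          unfolding norm_mult[of "_ powr _"] using C(2)[OF True] by (intro mult_mono) auto
        also have "\<dots> = C * (u powr (real N - 1) * exp (- (v * u)))"
          using powr_add[of u "- 1" "real N"] by (simp add: mult_ac)
        finally show ?thesis using True by simp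
      qed simp
    qed
    also have "\<dots> = C * (Gamma (real N) * v powr (- real N))"
      using Gamma_set_integral_real(2)[of "real N" v] N v by simp
    finally have "norm ?J \<le> C * (Gamma (real N) * v powr (- real N))" .
    then have "v ^ N * real N * norm ?J \<le> v ^ N * real N * (C * (Gamma (real N) * v powr (- real N)))"
      using v by (intro mult_left_mono) auto
    also have "\<dots> = real N * C * Gamma (real N)"
      using v by (simp add: powr_minus powr_realpow field_simps)
    finally show ?thesis
      unfolding lerch_R_eq using v by (simp add: norm_mult norm_power)
  qed
  then show ?thesis
    unfolding bounded_iff by blast
qed

lemma has_field_derivative_lerch_tail_at_0:
  assumes l: "l \<ge> 1" and N: "N \<ge> 1"
  shows "(lerch_tail z N l has_field_derivative
      (- of_real (ln (real l)) / (1 - z)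
       + (\<Sum>m=1..<N. (- of_nat l) powi (- int m) / of_nat m * lerch_phi z (- of_nat m) 1)
       + (- of_nat l) powi (- int N) / of_nat N * lerch_R z N (real l))) (at 0)"
proof -
  have l': "real l > 0" using l by simp
  have npow: "(- of_nat l) powi (- int m) = (-1) ^ m * inverse (complex_of_nat l ^ m)" for m
    using power_minus[of "complex_of_nat l" m] by (cases "even m") (simp_all add: power_int_minus)
  \<comment> \<open>Only the term \<open>m = 0\<close> feels the derivative of
    \<open>of_nat l powr (- s)\<close>. For \<open>m > 0\<close> the factor
    \<open>pochhammer s m\<close> has a simple zero at \<open>0\<close> with cofactor
    \<open>fact (m - 1)\<close>, which against \<open>fact m\<close> leaves
    \<open>1 / m\<close>.\<close>
  define d where "d = (\<lambda>m. if m = 0 then - of_real (ln (real l)) / (1 - z)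
      else (- of_nat l) powi (- int m) / of_nat m * lerch_phi z (- of_nat m) 1)"
  have d: "((\<lambda>s. lerch_coeff z m * (-1) ^ m / fact m * pochhammer s m * of_nat l powr (- s - of_nat m))
      has_field_derivative d m) (at 0)" for m
  proof (cases m)
    case 0
    show ?thesis
      using DERIV_cmult[OF has_field_derivative_powr_uminus_at_0[OF l'], of "lerch_coeff z 0"]
      by (simp add: 0 d_def lerch_coeff_0[OF z])
  next
    case (Suc k)
    define h where "h = (\<lambda>s. pochhammer (s + 1) k * complex_of_real (real l) powr (- s - of_nat m))"
    have "h field_differentiable at 0"
      unfolding h_def using l'
      by (intro field_differentiable_mult field_differentiable_pochhammer field_differentiable_of_real_powr)
    from DERIV_cmult[OF has_field_derivative_times_at_0[OF this], of "lerch_coeff z m * (-1) ^ m / fact m"]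
    have "((\<lambda>s. lerch_coeff z m * (-1) ^ m / fact m * (s * h s)) has_field_derivative
        lerch_coeff z m * (-1) ^ m / fact m * h 0) (at 0)" .
    moreover have "lerch_coeff z m * (-1) ^ m / fact m * h 0 = d m"
    proof -
      have "h 0 = fact k * inverse (of_nat l ^ m)"
        using l' by (simp add: h_def pochhammer_fact[symmetric] powr_minus powr_nat')
      moreover have "fact m = of_nat m * (fact k :: complex)"
        using Suc by simp
      moreover have "m \<noteq> 0" using Suc by simp
      ultimately show ?thesis
        by (simp add: d_def lerch_phi_minus_of_nat npow)
    qed
    moreover have "(\<lambda>s. lerch_coeff z m * (-1) ^ m / fact m * (s * h s))
       = (\<lambda>s. lerch_coeff z m * (-1) ^ m / fact m * pochhammer s m * of_nat l powr (- s - of_nat m))"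
      by (simp add: h_def Suc pochhammer_rec mult_ac)
    ultimately show ?thesis by simp
  qed
  let ?I = "\<lambda>s. LINT u:{0<..}|lborel. of_real u powr (s - 1) * (of_real (exp (- (real l * u))) * lerch_rest z N u)"
  \<comment> \<open>As \<open>rGamma s = s * rGamma (s + 1)\<close>, the derivative at
    \<open>0\<close> is just \<open>?I 0\<close>. The assumption \<open>N \<ge> 1\<close> puts
    \<open>0\<close> inside the half-plane where the integral is holomorphic.\<close>
  have "(\<lambda>s. rGamma (s + 1) * ?I s) holomorphic_on {s. Re s > - real N}"
    by (intro holomorphic_intros lerch_kernel_holomorphic z l')
  then have "(\<lambda>s. rGamma (s + 1) * ?I s) field_differentiable at 0"
    using N by (intro holomorphic_on_imp_differentiable_at[of _ "{s. Re s > - real N}"]) (auto simp: open_halfspace_Re_gt)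
  from has_field_derivative_times_at_0[OF this]
  have "((\<lambda>s. s * rGamma (s + 1) * ?I s) has_field_derivative ?I 0) (at 0)"
    by (simp add: mult_ac)
  then have "((\<lambda>s. rGamma s * ?I s) has_field_derivative ?I 0) (at 0)"
    by (simp only: rGamma_plus1)
  then have "(lerch_tail z N l has_field_derivative (\<Sum>m<N. d m) + ?I 0) (at 0)"
    unfolding lerch_tail_def by (intro DERIV_add DERIV_sum d)
  moreover have "(\<Sum>m<N. d m) = d 0 + (\<Sum>m=1..<N. d m)"
    using N by (metis One_nat_def lessThan_atLeast0 less_le_trans sum.atLeast_Suc_lessThan zero_less_one)
  moreover have "(\<Sum>m=1..<N. d m) = (\<Sum>m=1..<N. (- of_nat l) powi (- int m) / of_nat m * lerch_phi z (- of_nat m) 1)"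
    by (intro sum.cong) (auto simp: d_def)
  moreover have "(- of_nat l) powi (- int N) / of_nat N * lerch_R z N (real l) = ?I 0"
  proof -
    have "((-1) ^ N * inverse (complex_of_nat l ^ N)) / of_nat N * ((-1) ^ N * of_nat l ^ N * of_nat N * X) = X" for X
    proof -
      have "(-1 :: complex) ^ N * (-1) ^ N = 1" by (simp flip: power_mult_distrib)
      then show ?thesis using l N by (simp add: field_simps)
    qed
    then show ?thesis
      by (simp only: lerch_R_eq npow of_real_of_nat_eq)
  qed
  ultimately show ?thesis
    by (simp add: d_def)
qed

text \<open>The derivative at \<open>0\<close> of the continuation is the derivative of the finite
  head, which is minus a logarithmic sum, plus that of the tail; solving for the head gives the sum
  exactly. The extra factor \<open>z\<close> is the shift between \<open>k\<close> and
  \<open>Suc k\<close>.\<close>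

lemma sum_power_mult_ln:
  assumes l: "l \<ge> 1" and N: "N \<ge> 1"
  shows "(\<Sum>k=1..l. z ^ k * of_real (ln (real k))) = - z * lerch_phi_ds z 0 1
      + z ^ (l + 1) * (- of_real (ln (real l)) / (1 - z)
       + (\<Sum>m=1..<N. (- of_nat l) powi (- int m) / of_nat m * lerch_phi z (- of_nat m) 1)
       + (- of_nat l) powi (- int N) / of_nat N * lerch_R z N (real l))" (is "_ = _ + _ * ?D")
proof -
  have D: "((\<lambda>s. z ^ k * of_real (real (Suc k)) powr (- s)) has_field_derivative z ^ k * - of_real (ln (real (Suc k)))) (at 0)" for k
    by (intro DERIV_cmult has_field_derivative_powr_uminus_at_0) auto
  have "(lerch_cont z N l has_field_derivative
      (\<Sum>k<l. z ^ k * - of_real (ln (real (Suc k)))) + z ^ l * ?D) (at 0)"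
    unfolding lerch_cont_def
    by (intro DERIV_add DERIV_sum D[unfolded of_real_of_nat_eq] DERIV_cmult[OF has_field_derivative_lerch_tail_at_0[OF l N]])
  then have "((\<lambda>s. lerch_phi z s 1) has_field_derivative
      (\<Sum>k<l. z ^ k * - of_real (ln (real (Suc k)))) + z ^ l * ?D) (at 0)"
    by (rule has_field_derivative_transform_within_open[where S = "{s. Re s > - real N}"])
       (use N in \<open>auto simp: open_halfspace_Re_gt lerch_phi_eq_lerch_cont[OF l]\<close>)
  then have ds: "lerch_phi_ds z 0 1 = - (\<Sum>k<l. z ^ k * of_real (ln (real (Suc k)))) + z ^ l * ?D"
    unfolding lerch_phi_ds_def by (simp add: DERIV_imp_deriv sum_negf)
  have "(\<Sum>k=1..l. z ^ k * of_real (ln (real k))) = (\<Sum>k<l. z ^ Suc k * of_real (ln (real (Suc k))))"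
    by (intro sum.reindex_bij_witness[of _ Suc "\<lambda>k. k - 1"]) auto
  also have "\<dots> = z * (\<Sum>k<l. z ^ k * of_real (ln (real (Suc k))))"
    by (simp add: sum_distrib_left mult.assoc)
  also have "\<dots> = - z * lerch_phi_ds z 0 1 + z ^ (l + 1) * ?D"
  proof -
    have "z * S = - z * (- S + z ^ l * D) + z ^ (l + 1) * D" for S D :: complex
      by (simp add: algebra_simps)
    then show ?thesis unfolding ds .
  qed
  finally show ?thesis .
qed

end

section \<open>The logarithmic sum\<close>

lemma cis_neq_1:
  assumes "0 < \<bar>t\<bar>" "\<bar>t\<bar> < 2 * pi"
  shows "cis t \<noteq> 1"
proof
  assume "cis t = 1"
  then have "cos t = 1" by (simp add: complex_eq_iff)
  then obtain n :: int where "t = of_int n * (2 * pi)"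
    by (auto simp: cos_one_2pi_int)
  then have "\<bar>t\<bar> = of_int \<bar>n\<bar> * (2 * pi)"
    by (simp add: abs_mult)
  with assms have "of_int \<bar>n\<bar> > (0::real)" "of_int \<bar>n\<bar> < (1::real)"
    by (auto simp: zero_less_mult_iff)
  then have "0 < \<bar>n\<bar>" "\<bar>n\<bar> < 1"
    by (simp_all only: of_int_0_less_iff of_int_less_1_iff)
  then show False by linarith
qed

lemma one_minus_cis: "1 - cis t = - 2 * \<i> * of_real (sin (t / 2)) * cis (t / 2)"
proof -
  have "cos t = 1 - 2 * (sin (t / 2))\<^sup>2" "sin t = 2 * sin (t / 2) * cos (t / 2)"
    using cos_double_sin[of "t / 2"] sin_double[of "t / 2"] by simp_all
  then show ?thesis
    by (simp add: complex_eq_iff power2_eq_square)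
qed

lemma sin_eq_cis: "complex_of_real (sin x) = (cis x - cis (- x)) / (2 * \<i>)"
  by (simp add: complex_eq_iff)

lemma cos_eq_cis: "complex_of_real (cos x) = (cis x + cis (- x)) / 2"
  by (simp add: complex_eq_iff)

lemma cis_sum_ln:
  assumes t: "0 < \<bar>t\<bar>" "\<bar>t\<bar> < 2 * pi" and l: "l \<ge> 1" and N: "N \<ge> 1"
  shows "(\<Sum>k=1..l. cis ((2 * real k - real l) * t / 2) * of_real (ln (real k))) =
      - cis (- (real l - 2) * t / 2) * lerch_phi_ds (cis t) 0 1
      + cis ((real l + 1) * t / 2) / (2 * \<i> * of_real (sin (t / 2))) * of_real (ln (real l))
      + (\<Sum>m=1..<N. (- of_nat l) powi (- int m) / of_nat m * (cis ((real l + 2) * t / 2) * lerch_phi (cis t) (- of_nat m) 1))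
      + (- of_nat l) powi (- int N) / of_nat N * (cis ((real l + 2) * t / 2) * lerch_R (cis t) N (real l))"
proof -
  let ?c = "cis (- (real l) * t / 2)"
  have c1: "?c * cis t ^ k = cis ((2 * real k - real l) * t / 2)" for k
  proof -
    have "?c * cis t ^ k = cis (- (real l) * t / 2 + real k * t)"
      by (simp only: Complex.DeMoivre cis_mult)
    also have "- (real l) * t / 2 + real k * t = (2 * real k - real l) * t / 2"
      by (simp add: field_simps)
    finally show ?thesis .
  qed
  have c2: "?c * cis t = cis (- (real l - 2) * t / 2)"
    using c1[of 1] by (simp add: field_simps)
  have c3: "?c * cis t ^ (l + 1) = cis ((real l + 2) * t / 2)"
    using c1[of "l + 1"] by (simp add: field_simps)
  have s: "cis t \<noteq> 1" by (rule cis_neq_1[OF t])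
  then have "sin (t / 2) \<noteq> 0"
    using one_minus_cis[of t] by auto
  \<comment> \<open>By \<open>one_minus_cis\<close>, dividing by \<open>1 - cis t\<close> removes
    half a step \<open>cis (t / 2)\<close> from the phase, which turns \<open>l + 2\<close> into
    \<open>l + 1\<close>, and absorbs the minus sign.\<close>
  then have c4: "cis ((real l + 2) * t / 2) * (- L / (1 - cis t)) = cis ((real l + 1) * t / 2) / (2 * \<i> * of_real (sin (t / 2))) * L" for L
  proof -
    have "cis ((real l + 2) * t / 2) = cis ((real l + 1) * t / 2) * cis (t / 2)"
      by (simp add: cis_mult field_simps)
    then show ?thesis
      unfolding one_minus_cis using \<open>sin (t / 2) \<noteq> 0\<close> by (simp add: field_simps)
  qed
  have "(\<Sum>k=1..l. cis ((2 * real k - real l) * t / 2) * of_real (ln (real k)))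
      = ?c * (\<Sum>k=1..l. cis t ^ k * of_real (ln (real k)))"
    unfolding sum_distrib_left c1[symmetric] by (simp only: mult.assoc)
  also have "\<dots> = - (?c * cis t) * lerch_phi_ds (cis t) 0 1
      + (?c * cis t ^ (l + 1)) * (- of_real (ln (real l)) / (1 - cis t))
      + (\<Sum>m=1..<N. (- of_nat l) powi (- int m) / of_nat m * ((?c * cis t ^ (l + 1)) * lerch_phi (cis t) (- of_nat m) 1))
      + (- of_nat l) powi (- int N) / of_nat N * ((?c * cis t ^ (l + 1)) * lerch_R (cis t) N (real l))"
  proof -
    have alg: "c * (- x * d + X * (e + (\<Sum>m=1..<N. A m * P m) + B * R))
      = - (c * x) * d + (c * X) * e + (\<Sum>m=1..<N. A m * ((c * X) * P m)) + B * ((c * X) * R)"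
      for c x d X e B R :: complex and A P
      by (simp add: algebra_simps sum_distrib_left)
    have "norm (cis t) = 1" by simp
    from sum_power_mult_ln[OF this s l N] show ?thesis
      by (simp only: alg)
  qed
  finally show ?thesis
    unfolding c2 c3 c4 .
qed

lemma sin_sum_ln:
  assumes t: "0 < t" "t < 2 * pi" and l: "l \<ge> 1" and N: "N \<ge> 1"
  shows "complex_of_real (\<Sum>k=1..l. sin ((2 * real k - real l) * t / 2) / sin (t / 2) * ln (real k)) =
            - of_real (cos ((real l + 1) * t / 2) / (2 * (sin (t / 2))\<^sup>2) * ln (real l))
            - 1 / (2 * \<i> * of_real (sin (t / 2))) *
                (cis (- (real l - 2) * t / 2) * lerch_phi_ds (cis t) 0 1
                 - cis ((real l - 2) * t / 2) * lerch_phi_ds (cis (- t)) 0 1)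
            + 1 / (2 * \<i> * of_real (sin (t / 2))) *
                (\<Sum>m=1..<N. (- of_nat l) powi (- int m) / of_nat m *
                   (cis ((real l + 2) * t / 2) * lerch_phi (cis t) (- of_nat m) 1
                    - cis (- (real l + 2) * t / 2) * lerch_phi (cis (- t)) (- of_nat m) 1))
            + 1 / (2 * \<i> * of_real (sin (t / 2))) * ((- of_nat l) powi (- int N) / of_nat N) *
                (cis ((real l + 2) * t / 2) * lerch_R (cis t) N (real l)
                 - cis (- (real l + 2) * t / 2) * lerch_R (cis (- t)) N (real l))"
proof -
  let ?s = "complex_of_real (sin (t / 2))"
  have s0: "sin (t / 2) > 0" using t by (intro sin_gt_zero) auto
  let ?S = "\<lambda>t. \<Sum>k=1..l. cis ((2 * real k - real l) * t / 2) * of_real (ln (real k))"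
  have "complex_of_real (\<Sum>k=1..l. sin ((2 * real k - real l) * t / 2) / sin (t / 2) * ln (real k))
     = (\<Sum>k=1..l. 1 / (2 * \<i> * ?s) * (cis ((2 * real k - real l) * t / 2) * of_real (ln (real k))
          - cis ((2 * real k - real l) * (- t) / 2) * of_real (ln (real k))))"
    unfolding of_real_sum
  proof (intro sum.cong refl)
    fix k
    have "(2 * real k - real l) * (- t) / 2 = - ((2 * real k - real l) * t / 2)" by simp
    moreover have "(a - b) / (2 * \<i>) / ?s * L = 1 / (2 * \<i> * ?s) * (a * L - b * L)" for a b L
      by (simp add: diff_divide_distrib algebra_simps)
    ultimately show "complex_of_real (sin ((2 * real k - real l) * t / 2) / sin (t / 2) * ln (real k))
      = 1 / (2 * \<i> * ?s) * (cis ((2 * real k - real l) * t / 2) * of_real (ln (real k))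
          - cis ((2 * real k - real l) * (- t) / 2) * of_real (ln (real k)))"
      by (simp only: of_real_mult of_real_divide sin_eq_cis[of "(2 * real k - real l) * t / 2"])
  qed
  also have "\<dots> = 1 / (2 * \<i> * ?s) * (?S t - ?S (- t))"
    by (simp only: sum_distrib_left sum_subtractf[symmetric])
  finally have *: "complex_of_real (\<Sum>k=1..l. sin ((2 * real k - real l) * t / 2) / sin (t / 2) * ln (real k))
     = 1 / (2 * \<i> * ?s) * (?S t - ?S (- t))" .
  \<comment> \<open>The denominator \<open>sin (- t / 2)\<close> changes sign, so the difference of
    the two exponentials becomes a sum and hence a cosine; the two factors \<open>2 * \<i>\<close>
    multiply to \<open>-4\<close> and give the minus sign.\<close>
  have log: "1 / (2 * \<i> * ?s) * (cis ((real l + 1) * t / 2) / (2 * \<i> * ?s) * L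
       - cis ((real l + 1) * (- t) / 2) / (2 * \<i> * of_real (sin (- t / 2))) * L)
      = - (of_real (cos ((real l + 1) * t / 2) / (2 * (sin (t / 2))\<^sup>2)) * L)" for L
  proof -
    have neg: "(real l + 1) * (- t) / 2 = - ((real l + 1) * t / 2)" "complex_of_real (sin (- t / 2)) = - ?s"
      by simp_all
    have "1 / (2 * \<i> * s) * (a / (2 * \<i> * s) * L - b / (2 * \<i> * (- s)) * L) = - ((a + b) / 2 / (2 * s\<^sup>2) * L)"
      if "s \<noteq> 0" for a b s
      using that by (simp add: field_simps power2_eq_square)
    moreover have "?s \<noteq> 0" using s0 by simp
    ultimately show ?thesis
      unfolding neg by (simp only: of_real_divide cos_eq_cis of_real_mult of_real_numeral of_real_power)
  qed
  have pm: "0 < \<bar>t\<bar>" "\<bar>t\<bar> < 2 * pi" "0 < \<bar>- t\<bar>" "\<bar>- t\<bar> < 2 * pi"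
    using t by auto
  have m: "- (real l - 2) * (- t) / 2 = (real l - 2) * t / 2" "(real l + 2) * (- t) / 2 = - (real l + 2) * t / 2"
    by (simp_all add: field_simps)
  have alg: "C * ((- a1 * p1 + e1 + s1 + R * (b1 * r1)) - (- a2 * p2 + e2 + s2 + R * (b2 * r2)))
     = C * (e1 - e2) - C * (a1 * p1 - a2 * p2) + C * (s1 - s2) + C * R * (b1 * r1 - b2 * r2)"
    for C a1 p1 e1 s1 R b1 r1 a2 p2 e2 s2 b2 r2 :: complex
    by (simp add: algebra_simps)
  show ?thesis
    unfolding * cis_sum_ln[OF pm(1,2) l N] cis_sum_ln[OF pm(3,4) l N] m alg log
      sum_subtractf[symmetric] right_diff_distrib[symmetric]
    by (simp only: of_real_mult)
qed

section \<open>The exponential integral\<close>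

lemma set_integral_power_exp:
  fixes x :: real
  assumes "x > 0"
  shows "set_integrable lborel {0<..} (\<lambda>v. v ^ m * exp (- (x * v)))"
    and "(LINT v:{0<..}|lborel. v ^ m * exp (- (x * v))) = fact m / x ^ Suc m"
proof -
  have eq: "v powr (real (Suc m) - 1) * exp (- (x * v)) = v ^ m * exp (- (x * v))" if "v \<in> {0<..}" for v
    using that by (simp add: powr_realpow)
  show "set_integrable lborel {0<..} (\<lambda>v. v ^ m * exp (- (x * v)))"
    using Gamma_set_integral_real(1)[of "real (Suc m)" x] assms
    by (subst set_integrable_cong[OF refl refl eq[symmetric]]) simp_all
  have "(LINT v:{0<..}|lborel. v ^ m * exp (- (x * v))) = Gamma (real (Suc m)) * x powr (- real (Suc m))"
    using assms by (subst Gamma_set_integral_real(2)[symmetric])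
      (auto intro!: set_lebesgue_integral_cong simp: eq[symmetric])
  also have "\<dots> = fact m / x ^ Suc m"
    using assms by (simp only: powr_minus powr_realpow) (simp add: Gamma_fact field_simps add.commute)
  finally show "(LINT v:{0<..}|lborel. v ^ m * exp (- (x * v))) = fact m / x ^ Suc m" .
qed

text \<open>
  The tail of the exponential integral from \<open>x\<close> to infinity is \<open>exp (i x)\<close> times this absolutely
  convergent integral. Comparing derivatives in \<open>x\<close> proves this without rotating the contour.
\<close>

definition laplace_recip :: "real \<Rightarrow> complex" where
  "laplace_recip x = (LINT v:{0<..}|lborel. of_real (exp (- (x * v))) / (of_real v - \<i>))"

lemma norm_minus_i_ge: "norm (complex_of_real v - \<i>) \<ge> 1"
  using abs_Im_le_cmod[of "complex_of_real v - \<i>"] by simp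

lemma of_real_neq_i: "complex_of_real v \<noteq> \<i>"
  by (simp add: complex_eq_iff)

lemma set_integrable_power_laplace_recip:
  assumes "x > 0"
  shows "set_integrable lborel {0<..} (\<lambda>v. of_real (v ^ m * exp (- (x * v))) / (of_real v - \<i>))"
proof (rule set_integrable_bound[OF set_integral_power_exp(1)[OF assms, of m]])
  show "set_borel_measurable lborel {0<..} (\<lambda>v. of_real (v ^ m * exp (- (x * v))) / (of_real v - \<i>))"
    by (intro set_borel_measurable_Ioi_continuous continuous_intros) (simp add: of_real_neq_i)
  show "AE v in lborel. v \<in> {0<..} \<longrightarrow> norm (of_real (v ^ m * exp (- (x * v))) / (of_real v - \<i>))
      \<le> norm (v ^ m * exp (- (x * v)))"
  proof (intro AE_I2 impI)
    fix v :: real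
    have "norm (v ^ m * exp (- (x * v))) / norm (of_real v - \<i>) \<le> norm (v ^ m * exp (- (x * v))) / 1"
      using norm_minus_i_ge[of v] by (intro divide_left_mono) auto
    then show "norm (of_real (v ^ m * exp (- (x * v))) / (of_real v - \<i>)) \<le> norm (v ^ m * exp (- (x * v)))"
      by (simp only: norm_divide norm_of_real div_by_1 real_norm_def)
  qed
qed

text \<open>Watson's lemma with explicit remainder: \<open>1 / (v - \<i>)\<close> is expanded as a
  finite geometric sum in \<open>v\<close>, and since \<open>v - \<i>\<close> has modulus at least
  \<open>1\<close> the error is no larger than the modulus of the first omitted term.\<close>

lemma laplace_recip_expansion:
  assumes x: "x > 0"
  shows "norm (laplace_recip x - (\<Sum>m<n. \<i> * (- \<i>) ^ m * of_real (fact m / x ^ Suc m))) \<le> fact n / x ^ Suc n"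
proof -
  have geom: "1 / (of_real v - \<i>) = (\<Sum>m<n. \<i> * (- \<i>) ^ m * of_real (v ^ m)) + (- \<i>) ^ n * (of_real (v ^ n) / (of_real v - \<i>))" for v
  proof (induction n)
    case (Suc n)
    have "(- \<i>) ^ n * (of_real (v ^ n) / (of_real v - \<i>))
        = \<i> * (- \<i>) ^ n * of_real (v ^ n) + (- \<i>) ^ Suc n * (of_real (v ^ Suc n) / (of_real v - \<i>))"
      using of_real_neq_i[of v] by (simp add: field_simps)
    with Suc show ?case by simp
  qed simp
  have split: "of_real (exp (- (x * v))) / (of_real v - \<i>)
      = (\<Sum>m<n. \<i> * (- \<i>) ^ m * of_real (v ^ m * exp (- (x * v))))
        + (- \<i>) ^ n * (of_real (v ^ n * exp (- (x * v))) / (of_real v - \<i>))" for v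
  proof -
    have "of_real (exp (- (x * v))) / (of_real v - \<i>) = of_real (exp (- (x * v))) * (1 / (of_real v - \<i>))"
      by simp
    then show ?thesis
      unfolding geom[of v] by (simp add: distrib_left sum_distrib_left mult_ac)
  qed
  have int: "set_integrable lborel {0<..} (\<lambda>v. complex_of_real (v ^ m * exp (- (x * v))))" for m
    using set_integral_power_exp(1)[OF x, of m] unfolding set_integrable_def
    by (simp add: scaleR_conv_of_real complex_of_real_integrable_eq flip: of_real_mult of_real_power)
  let ?J = "LINT v:{0<..}|lborel. of_real (v ^ n * exp (- (x * v))) / (of_real v - \<i>)"
  have "laplace_recip x = (LINT v:{0<..}|lborel. (\<Sum>m<n. \<i> * (- \<i>) ^ m * of_real (v ^ m * exp (- (x * v))))
        + (- \<i>) ^ n * (of_real (v ^ n * exp (- (x * v))) / (of_real v - \<i>)))"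
    unfolding laplace_recip_def split ..
  also have "\<dots> = (\<Sum>m<n. \<i> * (- \<i>) ^ m * (LINT v:{0<..}|lborel. of_real (v ^ m * exp (- (x * v))))) + (- \<i>) ^ n * ?J"
  proof -
    have i0: "set_integrable lborel {0<..} (\<lambda>v. \<i> * (- \<i>) ^ m * complex_of_real (v ^ m * exp (- (x * v))))" for m
      by (intro set_integrable_mult_right int)
    have i1: "set_integrable lborel {0<..} (\<lambda>v. \<Sum>m<n. \<i> * (- \<i>) ^ m * complex_of_real (v ^ m * exp (- (x * v))))"
      by (intro set_integral_finite_sum(1) i0)
    have i2: "set_integrable lborel {0<..} (\<lambda>v. (- \<i>) ^ n * (complex_of_real (v ^ n * exp (- (x * v))) / (of_real v - \<i>)))"
      by (intro set_integrable_mult_right set_integrable_power_laplace_recip x)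
    show ?thesis
      by (simp only: set_integral_add(2)[OF i1 i2] set_integral_finite_sum(2)[OF i0] set_integral_mult_right)
  qed
  finally have *: "laplace_recip x = (\<Sum>m<n. \<i> * (- \<i>) ^ m * (LINT v:{0<..}|lborel. of_real (v ^ m * exp (- (x * v))))) + (- \<i>) ^ n * ?J" .
  have "(LINT v:{0<..}|lborel. complex_of_real (v ^ m * exp (- (x * v)))) = of_real (fact m / x ^ Suc m)" for m
    unfolding set_integral_power_exp(2)[OF x, symmetric] by (rule set_integral_complex_of_real)
  with * have "laplace_recip x - (\<Sum>m<n. \<i> * (- \<i>) ^ m * of_real (fact m / x ^ Suc m)) = (- \<i>) ^ n * ?J"
    by simp
  moreover have "norm ((- \<i>) ^ n * ?J) = norm ?J"
    by (simp add: norm_mult norm_power)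
  moreover have "norm ?J \<le> (LINT v:{0<..}|lborel. v ^ n * exp (- (x * v)))"
    unfolding set_lebesgue_integral_def
  proof (rule Bochner_Integration.integral_norm_bound_integral)
    show "integrable lborel (\<lambda>v. indicator {0<..} v *\<^sub>R (complex_of_real (v ^ n * exp (- (x * v))) / (of_real v - \<i>)))"
      using set_integrable_power_laplace_recip[OF x, of n] unfolding set_integrable_def .
    show "integrable lborel (\<lambda>v. indicator {0<..} v *\<^sub>R (v ^ n * exp (- (x * v))))"
      using set_integral_power_exp(1)[OF x, of n] unfolding set_integrable_def .
    fix v :: real
    show "norm (indicator {0<..} v *\<^sub>R (complex_of_real (v ^ n * exp (- (x * v))) / (of_real v - \<i>)))
        \<le> indicator {0<..} v *\<^sub>R (v ^ n * exp (- (x * v)))"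
    proof (cases "v > 0")
      case True
      have "(v ^ n * exp (- (x * v))) / norm (of_real v - \<i>) \<le> (v ^ n * exp (- (x * v))) / 1"
        using norm_minus_i_ge[of v] True by (intro divide_left_mono) auto
      then show ?thesis using True by (simp add: norm_divide norm_mult norm_power)
    qed simp
  qed
  ultimately show ?thesis
    by (simp only: set_integral_power_exp(2)[OF x])
qed

text \<open>Differentiation brings down \<open>- v\<close>, and
  \<open>v / (v - \<i>) = 1 + \<i> / (v - \<i>)\<close>. Consequently
  \<open>exp (\<i> * x) * laplace_recip x\<close> has derivative
  \<open>- exp (\<i> * x) / x\<close>, which is what makes it a tail of the exponential integral.
  The parameter is made complex only to differentiate under the integral.\<close>

lemma has_vector_derivative_laplace_recip:
  assumes x: "x > 0"
  shows "(laplace_recip has_vector_derivative - of_real (1 / x) - \<i> * laplace_recip x) (at x)"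
proof -
  have "((\<lambda>s. LINT v:{0<..}|lborel. exp (- (s * of_real v)) / (of_real v - \<i>)) has_field_derivative
      (LINT v:{0<..}|lborel. deriv (\<lambda>s. exp (- (s * of_real v)) / (of_real v - \<i>)) (of_real x))) (at (of_real x))"
  proof (rule has_field_derivative_set_lebesgue_integral[where r = "x / 2"])
    show "set_integrable lborel {0<..} (\<lambda>v. v ^ 0 * exp (- (x / 2 * v)))"
      using x by (intro set_integral_power_exp(1)) auto
    show "set_borel_measurable lborel {0<..} (\<lambda>v. exp (- (s * of_real v)) / (of_real v - \<i>))" for s
      by (intro set_borel_measurable_Ioi_continuous continuous_intros) (simp add: of_real_neq_i)
    show "(\<lambda>s. exp (- (s * of_real v)) / (of_real v - \<i>)) holomorphic_on ball (of_real x) (x / 2)" for v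
      by (intro holomorphic_intros) (simp add: of_real_neq_i)
    show "norm (exp (- (s * of_real v)) / (of_real v - \<i>)) \<le> v ^ 0 * exp (- (x / 2 * v))"
      if s: "s \<in> ball (of_real x) (x / 2)" and v: "v \<in> {0<..}" for s v
    proof -
      have "\<bar>x - Re s\<bar> < x / 2"
        using s abs_Re_le_cmod[of "of_real x - s"] by (simp add: dist_norm)
      then have "x / 2 \<le> Re s" by linarith
      then have "x / 2 * v \<le> Re s * v"
        using v by (intro mult_right_mono) auto
      then have "norm (exp (- (s * of_real v))) \<le> exp (- (x / 2 * v))"
        by simp
      then have "norm (exp (- (s * of_real v))) / norm (of_real v - \<i>) \<le> exp (- (x / 2 * v)) / 1"
        using norm_minus_i_ge[of v] by (intro frac_le) auto
      then show ?thesis by (simp add: norm_divide)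
    qed
  qed (use x in auto)
  also have "(LINT v:{0<..}|lborel. deriv (\<lambda>s. exp (- (s * of_real v)) / (of_real v - \<i>)) (of_real x))
     = (LINT v:{0<..}|lborel. - complex_of_real (v ^ 0 * exp (- (x * v))) - \<i> * (of_real (v ^ 0 * exp (- (x * v))) / (of_real v - \<i>)))"
  proof (rule set_lebesgue_integral_cong)
    show "\<forall>v. v \<in> {0<..} \<longrightarrow> deriv (\<lambda>s. exp (- (s * of_real v)) / (of_real v - \<i>)) (of_real x)
      = - complex_of_real (v ^ 0 * exp (- (x * v))) - \<i> * (of_real (v ^ 0 * exp (- (x * v))) / (of_real v - \<i>))"
    proof (intro allI impI DERIV_imp_deriv)
      fix v :: real
      have "((\<lambda>s. exp (- (s * of_real v)) / (of_real v - \<i>)) has_field_derivative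
          (- of_real v * exp (- (of_real x * of_real v))) / (of_real v - \<i>)) (at (of_real x))"
        by (intro DERIV_cdivide) (auto intro!: derivative_eq_intros)
      also have "- of_real v * exp (- (of_real x * of_real v)) / (of_real v - \<i>)
         = - complex_of_real (v ^ 0 * exp (- (x * v))) - \<i> * (of_real (v ^ 0 * exp (- (x * v))) / (of_real v - \<i>))"
        using of_real_neq_i[of v] by (simp add: field_simps flip: exp_of_real)
      finally show "((\<lambda>s. exp (- (s * of_real v)) / (of_real v - \<i>)) has_field_derivative
          - complex_of_real (v ^ 0 * exp (- (x * v))) - \<i> * (of_real (v ^ 0 * exp (- (x * v))) / (of_real v - \<i>))) (at (of_real x))" .
    qed
  qed simp
  also have "\<dots> = - (LINT v:{0<..}|lborel. complex_of_real (v ^ 0 * exp (- (x * v)))) - \<i> * laplace_recip x"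
  proof -
    have int: "set_integrable lborel {0<..} (\<lambda>v. complex_of_real (v ^ 0 * exp (- (x * v))))"
      using set_integral_power_exp(1)[OF x, of 0] unfolding set_integrable_def
      by (simp add: scaleR_conv_of_real complex_of_real_integrable_eq flip: of_real_mult)
    then have "set_integrable lborel {0<..} (\<lambda>v. - complex_of_real (v ^ 0 * exp (- (x * v))))"
      using set_integrable_mult_right[OF int, of "- 1"] by simp
    from set_integral_diff(2)[OF this set_integrable_mult_right[OF set_integrable_power_laplace_recip[OF x, of 0], of "\<i>"]]
    show ?thesis
      unfolding set_integral_uminus[OF int] set_integral_mult_right laplace_recip_def by simp
  qed
  also have "(LINT v:{0<..}|lborel. complex_of_real (v ^ 0 * exp (- (x * v)))) = of_real (1 / x)"
    using set_integral_power_exp(2)[OF x, of 0] by (subst set_integral_complex_of_real) simp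
  finally have "((\<lambda>s. LINT v:{0<..}|lborel. exp (- (s * of_real v)) / (of_real v - \<i>)) has_field_derivative
      - of_real (1 / x) - \<i> * laplace_recip x) (at (of_real x))" .
  from has_vector_derivative_real_field[OF this, of UNIV]
  show ?thesis
    by (simp add: laplace_recip_def[abs_def] flip: exp_of_real)
qed

text \<open>For \<open>u > 0\<close> the argument of \<open>Ln\<close> lies in the right half-plane,
  off the branch cut, also at \<open>x = 0\<close>; so the limit \<open>x = 0\<close> can be taken
  inside the integral and leads to \<open>Digamma_one_integral\<close>.\<close>

definition laplace_log :: "real \<Rightarrow> complex" where
  "laplace_log x = (LINT u:{0<..}|lborel. of_real (exp (- u)) * Ln (of_real u - \<i> * of_real x))"

lemma norm_Ln_le_abs_ln: "w \<noteq> 0 \<Longrightarrow> norm (Ln w) \<le> \<bar>ln (norm w)\<bar> + pi"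
  using cmod_le[of "Ln w"] mpi_less_Im_Ln[of w] Im_Ln_le_pi[of w] by (simp add: abs_le_iff)

lemma minus_ix_not_nonpos: "u > 0 \<Longrightarrow> complex_of_real u - \<i> * of_real x \<notin> \<real>\<^sub>\<le>\<^sub>0"
  by (simp add: complex_nonpos_Reals_iff)

lemma norm_minus_ix_bounds:
  assumes "u > 0" "0 \<le> x"
  shows "u \<le> norm (complex_of_real u - \<i> * of_real x)" "norm (complex_of_real u - \<i> * of_real x) \<le> u + x"
  using abs_Re_le_cmod[of "complex_of_real u - \<i> * of_real x"] norm_triangle_ineq4[of "complex_of_real u" "\<i> * of_real x"] assms
  by (simp_all add: norm_mult)

lemma norm_Ln_minus_ix_le:
  assumes u: "u > 0" and x: "0 \<le> x" "x \<le> 1"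
  shows "norm (Ln (complex_of_real u - \<i> * of_real x)) \<le> u + 2 * u powr (- 1 / 2) + pi"
proof -
  let ?w = "complex_of_real u - \<i> * of_real x"
  have w: "u \<le> norm ?w" "norm ?w \<le> u + 1" "norm ?w > 0"
    using norm_minus_ix_bounds[OF u x(1)] u x by auto
  have "ln (norm ?w) \<le> u"
    using ln_le_minus_one[OF w(3)] w(2) by linarith
  moreover have "- ln (norm ?w) \<le> 2 * u powr (- 1 / 2)"
  proof -
    have "- ln (norm ?w) \<le> - ln u"
      using ln_mono[OF w(1)] u by simp
    also have "\<dots> = 2 * ln (u powr (- 1 / 2))"
      using u by (simp add: ln_powr)
    also have "\<dots> \<le> 2 * u powr (- 1 / 2)"
      using ln_bound[of "u powr (- 1 / 2)"] u by simp
    finally show ?thesis .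
  qed
  moreover have "0 \<le> u" "0 \<le> 2 * u powr (- 1 / 2)" using u by simp_all
  ultimately have "\<bar>ln (norm ?w)\<bar> \<le> u + 2 * u powr (- 1 / 2)"
    unfolding abs_le_iff by (intro conjI; linarith)
  then show ?thesis
    using norm_Ln_le_abs_ln[of ?w] w(3) by force
qed

text \<open>The logarithmic singularity is traded for an integrable power through \<open>- ln u = 2
  * ln (u powr (- 1 / 2)) \<le> 2 * u powr (- 1 / 2)\<close>; \<open>pi\<close> bounds the imaginary
  part of \<open>Ln\<close>. The exponents \<open>1\<close>, \<open>0\<close> and
  \<open>1 / 2 - 1\<close> are written out so that each summand is literally a Gamma
  integrand.\<close>

definition laplace_log_majorant :: "real \<Rightarrow> real" where
  "laplace_log_majorant u = u ^ 1 * exp (- (1 * u)) + 2 * (u powr (1 / 2 - 1) * exp (- (1 * u))) + pi * (u ^ 0 * exp (- (1 * u)))"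

lemma laplace_log_majorant: 
  assumes u: "u > 0" and x: "0 \<le> x" "x \<le> 1"
  shows "norm (of_real (exp (- u)) * Ln (complex_of_real u - \<i> * of_real x)) \<le> laplace_log_majorant u"
proof -
  have "norm (of_real (exp (- u)) * Ln (complex_of_real u - \<i> * of_real x)) \<le> exp (- u) * (u + 2 * u powr (- 1 / 2) + pi)"
    unfolding norm_mult norm_of_real using norm_Ln_minus_ix_le[OF assms] by (intro mult_mono) auto
  then show ?thesis by (simp add: laplace_log_majorant_def algebra_simps)
qed

lemma set_integrable_laplace_log_majorant: "set_integrable lborel {0<..} laplace_log_majorant"
  unfolding laplace_log_majorant_def
  by (intro set_integral_add(1) set_integrable_mult_right set_integral_power_exp(1) Gamma_set_integral_real(1)) auto

lemma set_borel_measurable_laplace_log: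
  "set_borel_measurable lborel {0<..} (\<lambda>u. of_real (exp (- u)) * Ln (complex_of_real u - \<i> * of_real x))"
  by (intro set_borel_measurable_Ioi_continuous continuous_intros) (use minus_ix_not_nonpos in auto)

lemma laplace_log_tendsto:
  assumes X: "X \<longlonglongrightarrow> 0" "\<And>n. 0 \<le> X n" "\<And>n. X n \<le> 1"
  shows "(\<lambda>n. laplace_log (X n)) \<longlonglongrightarrow> - euler_mascheroni"
proof -
  have "(\<lambda>n. laplace_log (X n)) \<longlonglongrightarrow> (LINT u:{0<..}|lborel. of_real (ln u) * of_real (exp (- u)))"
    unfolding laplace_log_def set_lebesgue_integral_def
  proof (rule integral_dominated_convergence)
    show "(\<lambda>u. indicator {0<..} u *\<^sub>R (complex_of_real (ln u) * of_real (exp (- u)))) \<in> borel_measurable lborel"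
      using set_borel_measurable_Ioi_continuous[of "\<lambda>u. complex_of_real (ln u) * of_real (exp (- u))"]
      by (simp add: set_borel_measurable_def continuous_intros)
    show "(\<lambda>u. indicator {0<..} u *\<^sub>R (of_real (exp (- u)) * Ln (complex_of_real u - \<i> * of_real (X n)))) \<in> borel_measurable lborel" for n
      using set_borel_measurable_laplace_log unfolding set_borel_measurable_def .
    show "integrable lborel (\<lambda>u. indicator {0<..} u *\<^sub>R laplace_log_majorant u)"
      using set_integrable_laplace_log_majorant unfolding set_integrable_def .
    show "AE u in lborel. norm (indicator {0<..} u *\<^sub>R (of_real (exp (- u)) * Ln (complex_of_real u - \<i> * of_real (X n))))
        \<le> indicator {0<..} u *\<^sub>R laplace_log_majorant u" for n
      using laplace_log_majorant[OF _ X(2,3)] by (intro AE_I2) (auto simp: indicator_def)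
    show "AE u in lborel. (\<lambda>n. indicator {0<..} u *\<^sub>R (of_real (exp (- u)) * Ln (complex_of_real u - \<i> * of_real (X n))))
        \<longlonglongrightarrow> indicator {0<..} u *\<^sub>R (complex_of_real (ln u) * of_real (exp (- u)))"
    proof (rule AE_I2)
      fix u :: real
      show "(\<lambda>n. indicator {0<..} u *\<^sub>R (of_real (exp (- u)) * Ln (complex_of_real u - \<i> * of_real (X n))))
        \<longlonglongrightarrow> indicator {0<..} u *\<^sub>R (complex_of_real (ln u) * of_real (exp (- u)))"
      proof (cases "u > 0")
        case True
        have "(\<lambda>n. of_real (exp (- u)) * Ln (complex_of_real u - \<i> * of_real (X n)))
            \<longlonglongrightarrow> of_real (exp (- u)) * Ln (complex_of_real u - \<i> * of_real 0)"
          using minus_ix_not_nonpos[OF True, of 0] by (intro tendsto_intros X)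
        then show ?thesis using True by (simp add: Ln_of_real mult.commute)
      qed simp
    qed
  qed
  then show ?thesis by (simp only: Digamma_one_integral)
qed

text \<open>
  Integration by parts and the scaling \<open>u = x v\<close>. As \<open>x\<close> tends to \<open>0\<close> this yields both constants
  \<open>\<pi> / 2\<close> and \<open>\<Gamma>'(1)\<close> of the expansion.
\<close>

lemma laplace_recip_eq_laplace_log:
  assumes x: "x > 0"
  shows "laplace_recip x = \<i> * of_real (pi / 2) + laplace_log x - of_real (ln x)"
proof -
  define F where "F = (\<lambda>v. of_real (exp (- (x * v))) * Ln (of_real v - \<i>))"
  define f where "f = (\<lambda>v. of_real (exp (- (x * v))) / (of_real v - \<i>) - of_real x * F v)"
  have iv: "complex_of_real v - \<i> \<notin> \<real>\<^sub>\<le>\<^sub>0" for v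
    by (simp add: complex_nonpos_Reals_iff)
  have contF: "isCont F v" for v
    unfolding F_def using iv by (intro continuous_intros) auto
  have F_bound: "norm (F v) \<le> v ^ 1 * exp (- (x * v)) + pi * (v ^ 0 * exp (- (x * v)))" if v: "v > 0" for v
  proof -
    have "norm (complex_of_real v - \<i>) \<le> v + 1"
      using norm_minus_ix_bounds(2)[OF v, of 1] by simp
    then have "ln (norm (complex_of_real v - \<i>)) \<le> v"
      using ln_le_minus_one[of "norm (complex_of_real v - \<i>)"] norm_minus_i_ge[of v] by linarith
    moreover have "ln (norm (complex_of_real v - \<i>)) \<ge> 0"
      using norm_minus_i_ge[of v] by simp
    ultimately have "norm (Ln (complex_of_real v - \<i>)) \<le> v + pi"
      using norm_Ln_le_abs_ln[of "complex_of_real v - \<i>"] of_real_neq_i[of v] by simp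
    then have "norm (F v) \<le> exp (- (x * v)) * (v + pi)"
      unfolding F_def norm_mult norm_of_real by (intro mult_mono) auto
    then show ?thesis by (simp add: algebra_simps)
  qed
  have intF: "set_integrable lborel {0<..} F"
  proof (rule set_integrable_bound)
    show "set_integrable lborel {0<..} (\<lambda>v. v ^ 1 * exp (- (x * v)) + pi * (v ^ 0 * exp (- (x * v))))"
      by (intro set_integral_add(1) set_integrable_mult_right set_integral_power_exp(1) x)
    show "set_borel_measurable lborel {0<..} F"
      using contF by (intro set_borel_measurable_Ioi_continuous continuous_at_imp_continuous_on) auto
    show "AE v in lborel. v \<in> {0<..} \<longrightarrow> norm (F v) \<le> norm (v ^ 1 * exp (- (x * v)) + pi * (v ^ 0 * exp (- (x * v))))"
      using F_bound by (intro AE_I2) (auto intro: order_trans[OF _ abs_ge_self])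
  qed
  have intQ: "set_integrable lborel {0<..} (\<lambda>v. of_real (exp (- (x * v))) / (of_real v - \<i>))"
    using set_integrable_power_laplace_recip[OF x, of 0] by simp
  \<comment> \<open>\<open>f\<close> is the derivative of \<open>F\<close>, which vanishes at
    infinity. The boundary value at \<open>0\<close> is
    \<open>Ln (- \<i>) = - \<i> * pi / 2\<close>, the source of the constant
    \<open>pi / 2\<close>.\<close>
  have "(LBINT v=ereal 0..\<infinity>. f v) = 0 - Ln (- \<i>)"
  proof (rule interval_integral_FTC_integrable)
    show "(F has_vector_derivative f v) (at v)" for v
    proof -
      have "((\<lambda>s. exp (- (of_real x * s)) * Ln (s - \<i>)) has_field_derivative f v) (at (of_real v))"
        using iv[of v] of_real_neq_i[of v]
        by (auto intro!: derivative_eq_intros simp: f_def F_def exp_of_real[symmetric] field_simps)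
      from has_vector_derivative_real_field[OF this] show ?thesis
        by (simp add: F_def exp_of_real[symmetric])
    qed
    show "isCont f v" for v
      unfolding f_def using of_real_neq_i[of v] contF by (intro continuous_intros) auto
    show "set_integrable lborel (einterval (ereal 0) \<infinity>) f"
      unfolding f_def using intQ intF by (simp add: set_integral_diff(1) set_integrable_mult_right)
    show "((F \<circ> real_of_ereal) \<longlongrightarrow> Ln (- \<i>)) (at_right (ereal 0))"
    proof -
      have "(F \<longlongrightarrow> F 0) (at_right 0)"
        using contF[of 0] by (simp add: continuous_at_imp_continuous_within continuous_within[symmetric])
      then show ?thesis by (simp add: ereal_tendsto_simps F_def)
    qed
    show "((F \<circ> real_of_ereal) \<longlongrightarrow> 0) (at_left \<infinity>)"
    proof -
      have lim: "filterlim (\<lambda>v. x * v) at_top at_top"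
        using x by (intro filterlim_tendsto_pos_mult_at_top[OF tendsto_const]) (auto simp: filterlim_ident)
      have "((\<lambda>v. (1 / x) * ((x * v) ^ 1 / exp (x * v)) + pi * ((x * v) ^ 0 / exp (x * v))) \<longlongrightarrow> (1 / x) * 0 + pi * 0) at_top"
        by (intro tendsto_intros filterlim_compose[OF tendsto_power_div_exp_0 lim])
      then have "((\<lambda>v. v ^ 1 * exp (- (x * v)) + pi * (v ^ 0 * exp (- (x * v)))) \<longlongrightarrow> 0) at_top"
        using x by (simp add: exp_minus field_simps)
      then have "(F \<longlongrightarrow> 0) at_top"
        by (rule Lim_null_comparison[rotated]) (use F_bound in \<open>auto intro!: eventually_mono[OF eventually_gt_at_top[of 0]]\<close>)
      then show ?thesis by (simp add: ereal_tendsto_simps)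
    qed
  qed auto
  moreover have "(LBINT v=ereal 0..\<infinity>. f v) = laplace_recip x - of_real x * (LINT v:{0<..}|lborel. F v)"
    unfolding interval_integral_to_infinity_eq f_def laplace_recip_def
    using intQ intF by (simp add: set_integral_diff(2) set_integrable_mult_right)
  \<comment> \<open>The substitution splits off \<open>ln x\<close>, because a positive factor
    inside \<open>Ln\<close> does not change the branch.\<close>
  moreover have "of_real x * (LINT v:{0<..}|lborel. F v) = laplace_log x - of_real (ln x)"
  proof -
    have scale: "of_real (exp (- (x * v))) * Ln (of_real (x * v) - \<i> * of_real x)
        = F v + of_real (ln x) * of_real (exp (- (x * v)))" if "v > 0" for v
    proof -
      have "complex_of_real (x * v) - \<i> * of_real x = of_real x * (of_real v - \<i>)"
        by (simp add: algebra_simps)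
      then have "Ln (complex_of_real (x * v) - \<i> * of_real x) = of_real (ln x) + Ln (of_real v - \<i>)"
        using Ln_times_of_real[OF x, of "of_real v - \<i>"] of_real_neq_i[of v] by (simp add: Ln_of_real x)
      then show ?thesis by (simp add: F_def algebra_simps)
    qed
    have intx: "set_integrable lborel {0<..} (\<lambda>u. complex_of_real (exp (- (x * u))))"
      using set_integral_power_exp(1)[OF x, of 0] unfolding set_integrable_def
      by (simp add: scaleR_conv_of_real complex_of_real_integrable_eq flip: of_real_mult)
    have valx: "(LINT u:{0<..}|lborel. complex_of_real (exp (- (x * u)))) = of_real (1 / x)"
      using set_integral_power_exp(2)[OF x, of 0] by (subst set_integral_complex_of_real) simp
    have "laplace_log x = \<bar>x\<bar> *\<^sub>R (\<integral>v. indicator {0<..} (0 + x * v) *\<^sub>R (of_real (exp (- (0 + x * v))) * Ln (of_real (0 + x * v) - \<i> * of_real x)) \<partial>lborel)"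
      unfolding laplace_log_def set_lebesgue_integral_def using x by (intro lborel_integral_real_affine) auto
    also have "(\<lambda>v. indicator {0<..} (0 + x * v) *\<^sub>R (of_real (exp (- (0 + x * v))) * Ln (of_real (0 + x * v) - \<i> * of_real x)))
        = (\<lambda>v. indicator {0<..} v *\<^sub>R (F v + of_real (ln x) * of_real (exp (- (x * v)))))"
      using x scale by (intro ext) (auto simp: indicator_def zero_less_mult_iff)
    also have "\<bar>x\<bar> *\<^sub>R (\<integral>v. indicator {0<..} v *\<^sub>R (F v + of_real (ln x) * of_real (exp (- (x * v)))) \<partial>lborel)
        = of_real x * (LINT v:{0<..}|lborel. F v + of_real (ln x) * of_real (exp (- (x * v))))"
      using x by (simp add: set_lebesgue_integral_def scaleR_conv_of_real)
    also have "(LINT v:{0<..}|lborel. F v + of_real (ln x) * of_real (exp (- (x * v))))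
       = (LINT v:{0<..}|lborel. F v) + of_real (ln x) * of_real (1 / x)"
      using set_integral_add(2)[OF intF set_integrable_mult_right[OF intx, of "of_real (ln x)"]]
      by (simp only: set_integral_mult_right valx)
    finally show ?thesis
      using x by (simp add: distrib_left)
  qed
  moreover have "Ln (- \<i>) = - (\<i> * of_real (pi / 2))"
    by simp
  ultimately have "0 - - (\<i> * of_real (pi / 2)) = laplace_recip x - (laplace_log x - of_real (ln x))"
    by (simp only:)
  then have "laplace_recip x - (laplace_log x - of_real (ln x)) = \<i> * of_real (pi / 2)"
    by simp
  then show ?thesis by (simp only: diff_eq_eq) simp
qed

text \<open>\<open>E y\<close> is the classical function Ein at \<open>- \<i> * y\<close>. The
  quotient \<open>(1 - exp (\<i> * y)) / y\<close> has a removable singularity at \<open>0\<close>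
  with value \<open>- \<i>\<close>, so it is entire and has a primitive on the whole plane.\<close>

lemma exp_integral_exists:
  "\<exists>E :: complex \<Rightarrow> complex. E 0 = 0 \<and>
     (\<forall>y. (E has_field_derivative (if y = 0 then - \<i> else (1 - exp (\<i> * y)) / y)) (at y))"
proof -
  define f :: "complex \<Rightarrow> complex" where "f = (\<lambda>y. - exp (\<i> * y))"
  define e where "e = (\<lambda>y. if y = 0 then deriv f 0 else (f y - f 0) / (y - 0))"
  have "f holomorphic_on UNIV" unfolding f_def by (intro holomorphic_intros)
  then have "e holomorphic_on UNIV"
    unfolding e_def by (rule pole_lemma) auto
  then obtain g where g: "\<And>x. (g has_field_derivative e x) (at x)"
    using holomorphic_convex_primitive'[of UNIV e] by auto
  have "(f has_field_derivative - \<i>) (at 0)"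
    unfolding f_def by (auto intro!: derivative_eq_intros)
  then have "deriv f 0 = - \<i>" by (rule DERIV_imp_deriv)
  then have e: "e y = (if y = 0 then - \<i> else (1 - exp (\<i> * y)) / y)" for y
    by (simp add: e_def f_def)
  have "((\<lambda>y. g y - g 0) has_field_derivative e y) (at y)" for y
    using DERIV_diff[OF g[of y] DERIV_const[of "g 0"]] by simp
  then show ?thesis
    by (intro exI[of _ "\<lambda>y. g y - g 0"]) (simp add: e)
qed

text \<open>The function \<open>D\<close> has derivative \<open>0\<close> on the positive axis by
  the differential equation of \<open>laplace_recip\<close>. Its constant value is found by letting
  \<open>x\<close> tend to \<open>0\<close>, where \<open>E\<close> vanishes and
  \<open>laplace_log\<close> tends to \<open>- euler_mascheroni\<close>.\<close>

lemma exp_integral_eq: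
  fixes E :: "complex \<Rightarrow> complex"
  assumes E0: "E 0 = 0"
    and E': "\<And>y. (E has_field_derivative (if y = 0 then - \<i> else (1 - exp (\<i> * y)) / y)) (at y)"
    and x: "x > 0"
  shows "E (of_real x) = of_real (ln x) - \<i> * of_real (pi / 2) + euler_mascheroni + exp (\<i> * of_real x) * laplace_recip x"
proof -
  define D where "D = (\<lambda>x. E (of_real x) - of_real (ln x) - exp (\<i> * of_real x) * laplace_recip x)"
  have "(D has_vector_derivative 0) (at y within {0<..})" if "y \<in> {0<..}" for y
  proof -
    have y: "y > 0" using that by simp
    have 1: "((\<lambda>x. E (of_real x)) has_vector_derivative (1 - exp (\<i> * of_real y)) / of_real y) (at y)"
      using has_vector_derivative_real_field[OF E'[of "of_real y"], of UNIV] y by simp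
    have "((\<lambda>x. exp (\<i> * x)) has_field_derivative \<i> * exp (\<i> * of_real y)) (at (of_real y))"
      by (auto intro!: derivative_eq_intros)
    from has_vector_derivative_real_field[OF this]
    have 2: "((\<lambda>x. exp (\<i> * of_real x)) has_vector_derivative \<i> * exp (\<i> * of_real y)) (at y)" .
    have "(ln has_real_derivative 1 / y) (at y)"
      using y by (auto intro!: derivative_eq_intros)
    then have 3: "((\<lambda>x. complex_of_real (ln x)) has_vector_derivative of_real (1 / y)) (at y)"
      by (intro has_vector_derivative_of_real) (simp add: has_real_derivative_iff_has_vector_derivative)
    have "(D has_vector_derivative (1 - exp (\<i> * of_real y)) / of_real y - of_real (1 / y)
        - (exp (\<i> * of_real y) * (- of_real (1 / y) - \<i> * laplace_recip y) + \<i> * exp (\<i> * of_real y) * laplace_recip y)) (at y)"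
      unfolding D_def
      by (intro has_vector_derivative_diff has_vector_derivative_mult 1 2 3 has_vector_derivative_laplace_recip y)
    also have "(1 - exp (\<i> * of_real y)) / of_real y - of_real (1 / y)
        - (exp (\<i> * of_real y) * (- of_real (1 / y) - \<i> * laplace_recip y) + \<i> * exp (\<i> * of_real y) * laplace_recip y) = 0"
      using y by (simp add: field_simps)
    finally show ?thesis by (rule has_vector_derivative_at_within)
  qed
  then obtain c where c: "\<And>y. y > 0 \<Longrightarrow> D y = c"
    using has_vector_derivative_zero_constant[of "{0<..}" D] by auto
  define X where "X = (\<lambda>n. 1 / real (Suc n))"
  have X: "X \<longlonglongrightarrow> 0" "\<And>n. 0 < X n" "\<And>n. X n \<le> 1"
    unfolding X_def using LIMSEQ_inverse_real_of_nat by (simp_all add: inverse_eq_divide)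
  \<comment> \<open>Near \<open>0\<close> the logarithm occurs twice, in \<open>D\<close> itself and
    inside \<open>laplace_recip\<close>. The two occurrences combine to the coefficient
    \<open>exp (\<i> * x) - 1\<close>, of modulus at most \<open>x\<close>, which beats
    \<open>ln x\<close>.\<close>
  have lnX: "(\<lambda>n. (exp (\<i> * of_real (X n)) - 1) * of_real (ln (X n))) \<longlonglongrightarrow> 0"
  proof (rule Lim_null_comparison)
    show "(\<lambda>n. ln (real (Suc n)) / real (Suc n)) \<longlonglongrightarrow> 0"
      by (rule LIMSEQ_Suc[OF lim_ln_over_n])
    show "\<forall>\<^sub>F n in sequentially. norm ((exp (\<i> * of_real (X n)) - 1) * of_real (ln (X n))) \<le> ln (real (Suc n)) / real (Suc n)"
    proof (intro always_eventually allI)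
      fix n
      have "norm (exp (\<i> * of_real (X n)) - 1) \<le> X n"
        using dist_exp_i_1[of "X n"] abs_sin_x_le_abs_x[of "X n / 2"] X(2)[of n] by simp
      then have "norm (exp (\<i> * of_real (X n)) - 1) * \<bar>ln (X n)\<bar> \<le> X n * \<bar>ln (X n)\<bar>"
        by (intro mult_right_mono) auto
      moreover have "\<bar>ln (X n)\<bar> = ln (real (Suc n))"
        unfolding X_def by (subst ln_div) auto
      moreover have "X n * ln (real (Suc n)) = ln (real (Suc n)) / real (Suc n)"
        by (simp add: X_def)
      ultimately show "norm ((exp (\<i> * of_real (X n)) - 1) * of_real (ln (X n))) \<le> ln (real (Suc n)) / real (Suc n)"
        by (simp only: norm_mult norm_of_real)
    qed
  qed
  have "isCont E 0" using E'[of 0] DERIV_isCont by blast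
  then have "(\<lambda>n. E (of_real (X n))) \<longlonglongrightarrow> E (of_real 0)"
    by (intro isCont_tendsto_compose[of _ E] tendsto_intros X) simp
  then have "(\<lambda>n. E (of_real (X n)) + (exp (\<i> * of_real (X n)) - 1) * of_real (ln (X n))
      - exp (\<i> * of_real (X n)) * (\<i> * of_real (pi / 2) + laplace_log (X n)))
    \<longlonglongrightarrow> E (of_real 0) + 0 - exp (\<i> * of_real 0) * (\<i> * of_real (pi / 2) + (- euler_mascheroni))"
    by (intro tendsto_intros lnX X laplace_log_tendsto less_imp_le)
  moreover have "E (of_real (X n)) + (exp (\<i> * of_real (X n)) - 1) * of_real (ln (X n))
      - exp (\<i> * of_real (X n)) * (\<i> * of_real (pi / 2) + laplace_log (X n)) = c" for n
    using c[OF X(2)[of n]] by (simp add: D_def laplace_recip_eq_laplace_log[OF X(2)] algebra_simps)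
  ultimately have "c = E (of_real 0) + 0 - exp (\<i> * of_real 0) * (\<i> * of_real (pi / 2) + (- euler_mascheroni))"
    by (simp add: LIMSEQ_const_iff)
  then have "c = euler_mascheroni - \<i> * of_real (pi / 2)"
    by (simp add: E0)
  then show ?thesis
    using c[OF x] by (simp add: D_def algebra_simps)
qed

section \<open>Oscillatory integrals\<close>

lemma holomorphic_eq_off_finite:
  assumes f: "f holomorphic_on S" and g: "g holomorphic_on S" and S: "open S" and K: "finite K"
    and eq: "\<And>z. z \<in> S - K \<Longrightarrow> f z = g z" and p: "p \<in> S"
  shows "f p = g p"
proof (rule LIM_unique)
  have *: "isCont f p" "isCont g p"
    using f g S p by (auto intro!: continuous_on_interior[OF holomorphic_on_imp_continuous_on] simp: interior_open)
  show "f \<midarrow>p\<rightarrow> f p" using *(1) by (rule isContD)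
  have "\<forall>\<^sub>F z in at p. z \<in> S - (K - {p})"
    using S K p by (intro eventually_at_in_open') (auto intro: open_Diff finite_imp_closed)
  then have "\<forall>\<^sub>F z in at p. g z = f z"
    using eventually_neq_at_within[of p] by eventually_elim (use eq in auto)
  from tendsto_cong[OF this] show "f \<midarrow>p\<rightarrow> g p"
    using isContD[OF *(2)] by simp
qed

lemma deriv_of_real_restriction:
  fixes H :: "complex \<Rightarrow> complex" and \<phi> :: "real \<Rightarrow> real"
  assumes H: "H holomorphic_on S" "open S" and I: "open I" "of_real ` I \<subseteq> S"
    and eq: "\<And>r. r \<in> I \<Longrightarrow> H (of_real r) = of_real (\<phi> r)" and r: "r \<in> I"
  shows "deriv H (of_real r) = of_real (deriv \<phi> r)"
proof -
  let ?D = "deriv H (of_real r)"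
  have "(H has_field_derivative ?D) (at (of_real r))"
    using H I r by (intro holomorphic_derivI[of _ S]) auto
  from has_vector_derivative_real_field[OF this, of UNIV]
  have D: "((\<lambda>r. complex_of_real (\<phi> r)) has_vector_derivative ?D) (at r)"
    by (rule has_vector_derivative_transform_within_open[OF _ I(1) r eq])
  have "(\<phi> has_vector_derivative Re ?D) (at r)"
    using bounded_linear.has_vector_derivative[OF bounded_linear_Re D] by simp
  then have "deriv \<phi> r = Re ?D"
    by (intro DERIV_imp_deriv) (simp add: has_real_derivative_iff_has_vector_derivative)
  moreover have "((\<lambda>_. 0::real) has_vector_derivative Im ?D) (at r)"
    using bounded_linear.has_vector_derivative[OF bounded_linear_Im D] by simp
  then have "Im ?D = 0"
    using has_vector_derivative_const[of 0 "at r"] vector_derivative_unique_at by blast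
  ultimately show ?thesis by (simp add: complex_eq_iff)
qed

text \<open>Integration by parts produces complex derivatives of the holomorphic extension, while
  the expansion is stated with iterated real derivatives of \<open>f_ext\<close>; this identifies
  the two.\<close>

lemma higher_deriv_of_real_restriction:
  fixes H :: "complex \<Rightarrow> complex" and \<phi> :: "real \<Rightarrow> real"
  assumes H: "H holomorphic_on S" "open S" and I: "open I" "of_real ` I \<subseteq> S"
    and eq: "\<And>r. r \<in> I \<Longrightarrow> H (of_real r) = of_real (\<phi> r)" and r: "r \<in> I"
  shows "(deriv ^^ m) H (of_real r) = of_real ((deriv ^^ m) \<phi> r)"
  using r
proof (induction m arbitrary: r)
  case (Suc m)
  show ?case
    using deriv_of_real_restriction[OF holomorphic_higher_deriv[OF H] H(2) I Suc.IH Suc.prems] by simp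
qed (simp add: eq)

text \<open>Each integration by parts gains a factor \<open>\<i> / a\<close> and one boundary term.
  The contributions of both end points are kept here; the one at \<open>0\<close> disappears later
  by parity, after taking real parts.\<close>

lemma oscillatory_integral_expansion:
  fixes H :: "complex \<Rightarrow> complex"
  assumes H: "H holomorphic_on S" "open S" "of_real ` {0..1} \<subseteq> S" and a: "a > 0"
  shows "integral {0..1} (\<lambda>r. cis (a * r) * H (of_real r))
    = (\<Sum>m=1..n. - ((\<i> / of_real a) ^ m * (cis a * (deriv ^^ (m - 1)) H 1 - (deriv ^^ (m - 1)) H 0)))
      + (\<i> / of_real a) ^ n * integral {0..1} (\<lambda>r. cis (a * r) * (deriv ^^ n) H (of_real r))"
proof (induction n)
  case (Suc n)
  let ?G = "(deriv ^^ n) H"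
  have G: "?G holomorphic_on S" "deriv ?G holomorphic_on S"
    using holomorphic_higher_deriv[OF H(1,2)] by (simp_all add: holomorphic_deriv H)
  have cont: "continuous_on {0..1} (\<lambda>r. F (complex_of_real r))" if "F holomorphic_on S" for F
    by (rule continuous_on_compose2[OF holomorphic_on_imp_continuous_on[OF that] _ H(3)]) (intro continuous_intros)
  have ints: "(\<lambda>r. cis (a * r) * F (complex_of_real r)) integrable_on {0..1}" if "F holomorphic_on S" for F
    by (intro integrable_continuous_real continuous_intros cont that)
  have "((\<lambda>r. \<i> * of_real a * (cis (a * r) * ?G (of_real r)) + cis (a * r) * deriv ?G (of_real r)) has_integral
      cis (a * 1) * ?G (of_real 1) - cis (a * 0) * ?G (of_real 0)) {0..1}"
  proof (rule fundamental_theorem_of_calculus)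
    fix r :: real assume r: "r \<in> {0..1}"
    have "(?G has_field_derivative deriv ?G (of_real r)) (at (of_real r))"
      using G H r by (intro holomorphic_derivI[of _ S]) auto
    then have "((\<lambda>z. exp (\<i> * of_real a * z) * ?G z) has_field_derivative
        exp (\<i> * of_real a * of_real r) * deriv ?G (of_real r) + exp (\<i> * of_real a * of_real r) * (\<i> * of_real a) * ?G (of_real r)) (at (of_real r))"
      by (intro DERIV_mult') (auto intro!: derivative_eq_intros)
    from has_vector_derivative_real_field[OF this, of "{0..1}"]
    show "((\<lambda>r. cis (a * r) * ?G (of_real r)) has_vector_derivative
        \<i> * of_real a * (cis (a * r) * ?G (of_real r)) + cis (a * r) * deriv ?G (of_real r)) (at r within {0..1})"
      by (simp add: cis_conv_exp algebra_simps)
  qed simp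
  from integral_unique[OF this]
  have parts: "\<i> * of_real a * integral {0..1} (\<lambda>r. cis (a * r) * ?G (of_real r))
      + integral {0..1} (\<lambda>r. cis (a * r) * deriv ?G (of_real r)) = cis a * ?G 1 - ?G 0"
    using ints[OF G(1)] ints[OF G(2)]
    by (subst (asm) integral_add) (auto intro!: integrable_on_mult_right)
  have "I = - (\<i> / c) * B + (\<i> / c) * J" if "\<i> * c * I + J = B" "c \<noteq> 0" for I J B c :: complex
    using that by (auto simp: field_simps)
  from this[OF parts] a
  have step: "integral {0..1} (\<lambda>r. cis (a * r) * ?G (of_real r))
      = - (\<i> / of_real a) * (cis a * ?G 1 - ?G 0) + (\<i> / of_real a) * integral {0..1} (\<lambda>r. cis (a * r) * deriv ?G (of_real r))"
    by simp
  have ring: "X + e ^ n * (- e * B + e * J) = (X + - (e ^ Suc n * B)) + e ^ Suc n * J" for X e B J :: complex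
    by (simp add: algebra_simps)
  show ?case
    unfolding Suc.IH step ring by simp
qed simp

lemma oscillatory_integral_bound:
  fixes H :: "complex \<Rightarrow> complex"
  assumes H: "H holomorphic_on S" "open S" "of_real ` {0..1} \<subseteq> S"
  shows "\<exists>C. \<forall>a. norm (integral {0..1} (\<lambda>r. cis (a * r) * H (of_real r))) \<le> C"
proof -
  have cont: "continuous_on {0..1} (\<lambda>r. H (complex_of_real r))"
    by (rule continuous_on_compose2[OF holomorphic_on_imp_continuous_on[OF H(1)] _ H(3)]) (intro continuous_intros)
  then have "bounded ((\<lambda>r. H (complex_of_real r)) ` {0..1})"
    by (intro compact_imp_bounded compact_continuous_image) auto
  then obtain C where C: "\<And>r. r \<in> {0..1} \<Longrightarrow> norm (H (of_real r)) \<le> C"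
    unfolding bounded_iff image_iff by blast
  have "norm (integral {0..1} (\<lambda>r. cis (a * r) * H (of_real r))) \<le> C * (1 - 0)" for a
    by (intro integral_bound continuous_intros cont) (auto simp: norm_mult C)
  then show ?thesis by auto
qed

lemma power_i_eq_cis: "\<i> ^ m = cis (pi * real m / 2)"
  using Complex.DeMoivre[of "pi / 2" m] by (simp add: mult.commute)

section \<open>The holomorphic extension of \<open>f_ext\<close>\<close>

context
  fixes t :: real
  assumes t: "0 < t" "t < 2 * pi"
begin

lemma sin_half_pos: "sin (t / 2) > 0"
  using t by (intro sin_gt_zero) auto

lemma sin_half_nonzero:
  assumes "z \<noteq> 0" "norm z < 2 * pi / t"
  shows "sin (of_real t * z / 2) \<noteq> (0 :: complex)"
proof
  assume "sin (of_real t * z / 2) = 0"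
  then obtain n :: int where n: "of_real t * z / 2 = complex_of_real (of_int n * pi)"
    by (auto simp: sin_eq_0)
  have "norm (of_real t * z / 2) < pi"
    using assms(2) t by (simp add: norm_mult field_simps)
  moreover have "norm (complex_of_real (of_int n * pi)) = \<bar>of_int n\<bar> * pi"
    unfolding norm_of_real by (simp add: abs_mult)
  ultimately have "\<bar>real_of_int n\<bar> * pi < 1 * pi"
    by (simp only: n mult_1)
  then have "n = 0" by simp
  with n assms t show False by simp
qed

text \<open>The removable singularities are resolved one at a time: \<open>q\<close> treats
  \<open>0\<close>, then \<open>q1\<close> and \<open>q2\<close> divide \<open>h\<close>, which
  vanishes at \<open>1\<close> and \<open>-1\<close>, by \<open>z - 1\<close> and
  \<open>z + 1\<close>. The radius is the modulus of the nearest non-zero zero of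
  \<open>sin (t * z / 2)\<close>. The minus sign in \<open>H\<close> comes from
  \<open>(z - 1) * (z + 1) = - (1 - z\<^sup>2)\<close>.\<close>

lemma f_ext_holomorphic_extension:
  obtains H where "H holomorphic_on ball 0 (2 * pi / t)"
    "\<And>z. norm z < 2 * pi / t \<Longrightarrow> H (- z) = H z"
    "\<And>r. \<bar>r\<bar> < 2 * pi / t \<Longrightarrow> H (of_real r) = of_real (f_ext t r)"
proof -
  let ?B = "ball (0::complex) (2 * pi / t)"
  define s :: "complex \<Rightarrow> complex" where "s = (\<lambda>z. sin (of_real t * z / 2))"
  define q where "q = (\<lambda>z. if z = 0 then deriv s 0 else (s z - s 0) / (z - 0))"
  define h where "h = (\<lambda>z. 1 / q z - 1 / of_real (sin (t / 2)))"
  define q1 where "q1 = (\<lambda>z. if z = 1 then deriv h 1 else (h z - h 1) / (z - 1))"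
  define q2 where "q2 = (\<lambda>z. if z = -1 then deriv q1 (-1) else (q1 z - q1 (-1)) / (z - (-1)))"
  define H where "H = (\<lambda>z. - q2 z / of_real t)"
  have "(s has_field_derivative of_real t / 2) (at 0)"
    unfolding s_def by (auto intro!: derivative_eq_intros)
  then have "deriv s 0 = of_real t / 2" by (rule DERIV_imp_deriv)
  then have q: "q z = (if z = 0 then of_real t / 2 else sin (of_real t * z / 2) / z)" for z
    by (simp add: q_def s_def)
  have q0: "q z \<noteq> 0" if "z \<in> ?B" for z
    using sin_half_nonzero[of z] that t by (auto simp: q)
  have "s holomorphic_on UNIV"
    unfolding s_def by (intro holomorphic_intros) auto
  then have "q holomorphic_on UNIV"
    unfolding q_def by (rule pole_lemma) auto
  then have holh: "h holomorphic_on ?B"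
    unfolding h_def using q0 sin_half_pos by (intro holomorphic_intros) (auto intro: holomorphic_on_subset)
  have hol1: "q1 holomorphic_on ?B"
    unfolding q1_def by (rule pole_lemma_open[OF holh]) auto
  have hol2: "q2 holomorphic_on ?B"
    unfolding q2_def by (rule pole_lemma_open[OF hol1]) auto
  have holH: "H holomorphic_on ?B"
    unfolding H_def using t by (intro holomorphic_intros hol2) auto
  have h1: "h 1 = 0" "h (- 1) = 0"
    using sin_of_real[of "t / 2", where 'a = complex] by (simp_all add: h_def q)
  have H: "H z = (z / sin (of_real t * z / 2) - 1 / of_real (sin (t / 2))) * (1 / (of_real t * (1 - z\<^sup>2)))"
    if "z \<notin> {0, 1, -1}" for z
  proof -
    have "q1 (- 1) = 0" by (simp add: q1_def h1)
    then have "q2 z = h z / ((z - 1) * (z + 1))"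
      using that by (simp add: q2_def q1_def h1)
    also have "(z - 1) * (z + 1) = - (1 - z\<^sup>2)"
      by (simp add: power2_eq_square algebra_simps)
    finally have "q2 z = h z / - (1 - z\<^sup>2)" .
    moreover have "- (X / - Y) / T = X * (1 / (T * Y))" for X Y T :: complex
      by (simp add: mult.commute)
    ultimately have "H z = h z * (1 / (of_real t * (1 - z\<^sup>2)))"
      by (simp only: H_def)
    then show ?thesis
      using that by (simp add: h_def q)
  qed
  have even: "H (- z) = H z" if "norm z < 2 * pi / t" for z
  proof (rule holomorphic_eq_off_finite[where K = "{0, 1, -1}" and S = ?B and f = "\<lambda>z. H (- z)"])
    have "(H \<circ> uminus) holomorphic_on ?B"
      by (intro holomorphic_on_compose_gen[OF _ holH] holomorphic_intros) auto
    then show "(\<lambda>z. H (- z)) holomorphic_on ?B" by (simp add: o_def)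
    show "H (- w) = H w" if "w \<in> ?B - {0, 1, -1}" for w
    proof -
      have w: "- w \<notin> {0, 1, -1}" "w \<notin> {0, 1, -1}"
        using that by (auto simp: minus_equation_iff[of w])
      show ?thesis unfolding H[OF w(1)] H[OF w(2)] by simp
    qed
  qed (use that holH in auto)
  have raw: "H (of_real r) = of_real (f_raw t r)" if "r \<notin> {-1, 0, 1}" for r
  proof -
    have "complex_of_real r \<notin> {0, 1, -1}"
      using that by (auto simp: complex_eq_iff)
    then show ?thesis
      using sin_of_real[of "t * r / 2", where 'a = complex] by (simp add: H f_raw_def)
  qed
  \<comment> \<open>At the three exceptional points \<open>f_ext\<close> is a \<open>Lim\<close>,
    which is meaningful only once the limit is known to exist. Continuity of \<open>H\<close>
    supplies the limit, and comparing imaginary parts shows that it is real.\<close>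
  have ext: "H (of_real r) = of_real (f_ext t r)" if r: "\<bar>r\<bar> < 2 * pi / t" for r
  proof (cases "r \<in> {-1, 0, 1}")
    case True
    have "isCont H (of_real r)"
      using holH r by (intro continuous_on_interior[OF holomorphic_on_imp_continuous_on]) auto
    then have "((\<lambda>y. H (of_real y)) \<longlongrightarrow> H (of_real r)) (at r)"
      by (intro isCont_tendsto_compose[of _ H] tendsto_intros) auto
    moreover have "\<forall>\<^sub>F y in at r. H (of_real y) = of_real (f_raw t y)"
    proof -
      have "\<forall>\<^sub>F y in at r. y \<in> UNIV - ({-1, 0, 1} - {r})"
        by (intro eventually_at_in_open') (auto intro!: finite_imp_closed)
      then show ?thesis
        using eventually_neq_at_within[of r] by eventually_elim (use raw in auto)
    qed
    ultimately have lim: "((\<lambda>y. complex_of_real (f_raw t y)) \<longlongrightarrow> H (of_real r)) (at r)"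
      by (rule Lim_transform_eventually)
    have "(f_raw t \<longlongrightarrow> Re (H (of_real r))) (at r)"
      using tendsto_Re[OF lim] by simp
    then have "f_ext t r = Re (H (of_real r))"
      using True by (simp add: f_ext_def tendsto_Lim)
    moreover have "((\<lambda>_. 0) \<longlongrightarrow> Im (H (of_real r))) (at r)"
      using tendsto_Im[OF lim] by simp
    then have "Im (H (of_real r)) = 0"
      by (simp add: tendsto_const_iff)
    ultimately show ?thesis by (simp add: complex_eq_iff)
  qed (use raw in \<open>simp add: f_ext_def\<close>)
  show ?thesis using that[OF holH even ext] .
qed

end

section \<open>The operator on Laurent series\<close>

lemma higher_deriv_even_at_0:
  fixes H :: "complex \<Rightarrow> complex"
  assumes H: "H holomorphic_on ball 0 \<rho>" and \<rho>: "\<rho> > 0"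
    and even: "\<And>z. norm z < \<rho> \<Longrightarrow> H (- z) = H z" and m: "odd m"
  shows "(deriv ^^ m) H 0 = 0"
proof -
  have "(deriv ^^ m) (\<lambda>w. H (- 1 * w)) 0 = (- 1) ^ m * (deriv ^^ m) H (- 1 * 0)"
    by (rule higher_deriv_compose_linear[OF H, of "ball 0 \<rho>"]) (use \<rho> in auto)
  moreover have "(deriv ^^ m) (\<lambda>w. H (- 1 * w)) 0 = (deriv ^^ m) H 0"
  proof (rule higher_deriv_cong_ev)
    have "\<forall>\<^sub>F w in nhds 0. w \<in> ball 0 \<rho>"
      using \<rho> by (intro eventually_nhds_in_open) auto
    then show "\<forall>\<^sub>F w in nhds 0. H (- 1 * w) = H w"
      by eventually_elim (simp add: even)
  qed simp
  ultimately show ?thesis using m by simp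
qed

lemma cos_half_pi_odd: "odd m \<Longrightarrow> cos (pi * real m / 2) = 0"
proof -
  assume "odd m"
  then obtain k where k: "m = 2 * k + 1" by (auto elim!: oddE)
  have "cos (pi * real m / 2) = cos (real k * pi + pi / 2)"
    by (rule arg_cong[of _ _ cos]) (simp add: k field_simps)
  then show ?thesis by (simp add: cos_add)
qed

text \<open>Twice the reciprocals of the even numbers up to \<open>2 * k\<close> add up to
  \<open>harm k\<close>, so only odd denominators survive. Since \<open>1 / (2 * j + 1)\<close> is
  the integral of \<open>r ^ (2 * j)\<close> over the unit interval, the operator becomes an
  integral.\<close>

lemma two_harm_minus_harm:
  "2 * harm (2 * k + 1) - harm k = 2 * (\<Sum>j\<le>k. 1 / of_nat (2 * j + 1) :: 'a :: real_normed_field)"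
proof (induction k)
  case (Suc k)
  have "harm (2 * Suc k + 1) = harm (2 * k + 1) + 1 / of_nat (2 * Suc k) + (1 / of_nat (2 * Suc k + 1) :: 'a)"
    by (simp add: harm_Suc inverse_eq_divide)
  moreover have "2 * (1 / of_nat (2 * Suc k)) = (1 / of_nat (Suc k) :: 'a)"
    by (simp only: of_nat_mult of_nat_numeral) (simp del: of_nat_Suc)
  moreover have "harm (Suc k) = harm k + (1 / of_nat (Suc k) :: 'a)"
    by (simp add: harm_Suc inverse_eq_divide)
  ultimately show ?case
    using Suc.IH by (simp only: sum.atMost_Suc distrib_left) (simp add: algebra_simps)
qed (simp add: harm_def)

text \<open>Multiplying by \<open>w\<^sup>2\<close> turns the Laurent series of \<open>g\<close>
  into the power series of \<open>K\<close>, and \<open>1 - r ^ (2 * k + 2)\<close> divided by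
  \<open>1 - r\<^sup>2\<close> is the geometric sum whose integral is the harmonic factor. The
  constant term of \<open>K\<close> cancels in \<open>K t - K (r * t)\<close>, in accordance with
  the operator sending \<open>t\<close> to the power \<open>-2\<close> to \<open>0\<close>.\<close>

lemma sharp_has_integral:
  fixes K g :: "complex \<Rightarrow> complex" and t \<rho> :: real
  assumes K: "K holomorphic_on ball 0 \<rho>" and t: "0 < t" "t < \<rho>"
    and even: "\<And>z. norm z < \<rho> \<Longrightarrow> K (- z) = K z"
    and g: "\<And>w. w \<noteq> 0 \<Longrightarrow> norm w < \<rho> \<Longrightarrow> g w = K w / w\<^sup>2"
  shows "((\<lambda>r. 2 * (K (of_real t) - K (of_real (r * t))) / of_real (t\<^sup>2 * (1 - r\<^sup>2))) has_integral sharp g (of_real t)) {0..1}"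
proof -
  define b where "b = fps_nth (fps_expansion K 0)"
  have b_odd: "b n = 0" if "odd n" for n
    using higher_deriv_even_at_0[OF K _ even that] t by (simp add: b_def fps_expansion_def)
  have sums: "(\<lambda>n. b n * w ^ n) sums K w" if "norm w < \<rho>" for w
    using holomorphic_power_series[OF K, of w] that by (simp add: b_def fps_expansion_def)
  have "K has_fps_expansion fps_expansion K 0"
    using K t by (intro has_fps_expansion_fps_expansion[of "ball 0 \<rho>"]) auto
  from has_laurent_expansion_shift'[OF has_laurent_expansion_fps[OF this], of 2]
  have shift: "(\<lambda>x. K x * x powi (- 2)) has_laurent_expansion fls_shift 2 (fps_to_fls (fps_expansion K 0))" .
  have ev: "\<forall>\<^sub>F w in at 0. K w * w powi (- 2) = g w"
  proof -
    have "\<forall>\<^sub>F w in at 0. w \<in> ball 0 \<rho> - {0}"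
      using t by (intro eventually_at_in_open) auto
    then show ?thesis
      by eventually_elim (simp add: g power_int_minus divide_inverse)
  qed
  have "g has_laurent_expansion fls_shift 2 (fps_to_fls (fps_expansion K 0))"
    by (rule iffD1[OF has_laurent_expansion_cong[OF ev refl] shift])
  then have L: "fls_nth (laurent_expansion g 0) (2 * int k) = b (2 * k + 2)" for k
    by (simp add: laurent_expansion_0_eqI b_def nat_add_distrib nat_mult_distrib)
  define T where "T = (\<lambda>k r. 2 * b (2 * k + 2) * of_real t ^ (2 * k) * of_real (\<Sum>j\<le>k. r ^ (2 * j)))"
  \<comment> \<open>The sum over \<open>j\<close> in \<open>T k r\<close> has \<open>k + 1\<close>
    terms, each at most \<open>1\<close>, so the majorant carries the factor
    \<open>2 * k + 2\<close>. It is therefore a subseries of the absolutely convergent, termwise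
    differentiated series of \<open>K\<close>, divided by \<open>t\<close>.\<close>
  define M where "M = (\<lambda>k. norm (diffs b (2 * k + 1) * of_real t ^ (2 * k + 1)) / t)"
  have TM: "norm (T k r) \<le> M k" if "r \<in> {0..1}" for k r
  proof -
    have "(\<Sum>j\<le>k. r ^ (2 * j)) \<le> (\<Sum>j\<le>k. 1)"
      using that by (intro sum_mono power_le_one) auto
    moreover have "0 \<le> (\<Sum>j\<le>k. r ^ (2 * j))"
      using that by (intro sum_nonneg) auto
    ultimately have "norm (T k r) \<le> norm (2 * b (2 * k + 2) * of_real t ^ (2 * k)) * real (Suc k)"
      unfolding T_def norm_mult[of _ "of_real (sum _ _)"] norm_of_real by (intro mult_left_mono) auto
    also have "\<dots> = M k"
      using t by (simp add: M_def diffs_def norm_mult norm_power field_simps del: of_nat_Suc)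
         (simp add: algebra_simps)
    finally show ?thesis .
  qed
  have "summable M"
  proof -
    define t' where "t' = (t + \<rho>) / 2"
    have t': "t < t'" "t' < \<rho>" using t by (auto simp: t'_def)
    have "summable (\<lambda>n. diffs b n * of_real t' ^ n)"
      by (rule termdiff_converges[where K = \<rho>]) (use t t' sums in \<open>auto simp: sums_iff\<close>)
    then have "summable (\<lambda>n. norm (diffs b n * of_real t ^ n))"
      by (rule powser_insidea) (use t t' in auto)
    then have "summable ((\<lambda>n. norm (diffs b n * of_real t ^ n)) \<circ> (\<lambda>k. 2 * k + 1))"
      by (rule summable_reindex) (auto intro: injI)
    then show ?thesis
      unfolding M_def by (intro summable_divide) (simp add: o_def)
  qed
  have "uniform_limit {0..1} (\<lambda>n r. \<Sum>k<n. T k r) (\<lambda>r. \<Sum>k. T k r) sequentially"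
    by (rule Weierstrass_m_test[OF TM \<open>summable M\<close>])
  then obtain I J where IJ: "\<And>n. ((\<lambda>r. \<Sum>k<n. T k r) has_integral I n) {0..1}"
      "((\<lambda>r. \<Sum>k. T k r) has_integral J) {0..1}" "I \<longlonglongrightarrow> J"
    by (rule uniform_limit_integral) (auto simp: T_def intro!: continuous_intros)
  have I: "I n = (\<Sum>k<n. (2 * harm (2 * k + 1) - harm k) * fls_nth (laurent_expansion g 0) (2 * int k) * of_real t ^ (2 * k))" for n
  proof (rule has_integral_unique[OF IJ(1)])
    have "((\<lambda>r. r ^ (2 * j)) has_integral 1 / real (2 * j + 1)) {0..1}" for j
    proof -
      have "((\<lambda>r. r ^ (2 * j)) has_integral 1 ^ (2 * j + 1) / real (2 * j + 1) - 0 ^ (2 * j + 1) / real (2 * j + 1)) {0..1}"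
      proof (rule fundamental_theorem_of_calculus)
        fix x :: real
        have "((\<lambda>x. x ^ (2 * j + 1) / real (2 * j + 1)) has_real_derivative x ^ (2 * j)) (at x within {0..1})"
          by (rule derivative_eq_intros refl | simp)+
        then show "((\<lambda>x. x ^ (2 * j + 1) / real (2 * j + 1)) has_vector_derivative x ^ (2 * j)) (at x within {0..1})"
          by (simp only: has_real_derivative_iff_has_vector_derivative)
      qed simp
      then show ?thesis by simp
    qed
    then have "((\<lambda>r. of_real (\<Sum>j\<le>k. r ^ (2 * j))) has_integral complex_of_real (\<Sum>j\<le>k. 1 / real (2 * j + 1))) {0..1}" for k
      by (intro has_integral_of_real has_integral_sum) auto
    then have "(T k has_integral (2 * b (2 * k + 2) * of_real t ^ (2 * k) * of_real (\<Sum>j\<le>k. 1 / real (2 * j + 1)))) {0..1}" for k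
      unfolding T_def by (intro has_integral_mult_right)
    moreover have "2 * b (2 * k + 2) * of_real t ^ (2 * k) * of_real (\<Sum>j\<le>k. 1 / real (2 * j + 1))
      = (2 * harm (2 * k + 1) - harm k) * fls_nth (laurent_expansion g 0) (2 * int k) * of_real t ^ (2 * k)" for k
      unfolding two_harm_minus_harm L by simp
    ultimately have Ti: "(T k has_integral (2 * harm (2 * k + 1) - harm k) * fls_nth (laurent_expansion g 0) (2 * int k) * of_real t ^ (2 * k)) {0..1}" for k
      by (simp only:)
    show "((\<lambda>r. \<Sum>k<n. T k r) has_integral (\<Sum>k<n. (2 * harm (2 * k + 1) - harm k) * fls_nth (laurent_expansion g 0) (2 * int k) * of_real t ^ (2 * k))) {0..1}"
      by (intro has_integral_sum Ti finite_lessThan)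
  qed
  have J: "J = sharp g (of_real t)"
    using IJ(3) unfolding I sharp_def by (intro sums_unique) (simp add: sums_def)
  \<comment> \<open>The point \<open>r = 1\<close> is left out, since the closed form divides by
    \<open>0\<close> there; a single point does not affect the integral.\<close>
  have T: "(\<Sum>k. T k r) = 2 * (K (of_real t) - K (of_real (r * t))) / of_real (t\<^sup>2 * (1 - r\<^sup>2))" if r: "r \<in> {0..1} - {1}" for r
  proof -
    have r': "r\<^sup>2 \<noteq> 1" "0 \<le> r" "r < 1"
      using r by (auto simp: power2_eq_1_iff)
    have "r * t \<le> 1 * t" using r' t by (intro mult_right_mono) auto
    then have "norm (complex_of_real (r * t)) < \<rho>" "norm (complex_of_real t) < \<rho>"
      using r' t by (simp_all only: norm_of_real abs_of_nonneg mult_nonneg_nonneg less_imp_le)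
    then have "(\<lambda>n. b n * of_real t ^ n - b n * of_real (r * t) ^ n) sums (K (of_real t) - K (of_real (r * t)))"
      by (intro sums_diff sums)
    moreover have "b n * of_real t ^ n - b n * of_real (r * t) ^ n = 0" if "n \<notin> range (\<lambda>k. 2 * k + 2)" for n
    proof (cases "odd n")
      case False
      then obtain k where "n = 2 * k" by auto
      with that have "n = 0" by (cases k) (auto simp: image_iff)
      then show ?thesis by simp
    qed (simp add: b_odd)
    moreover have "strict_mono (\<lambda>k::nat. 2 * k + 2)" by (auto intro!: strict_monoI)
    ultimately have "(\<lambda>k. b (2 * k + 2) * of_real t ^ (2 * k + 2) - b (2 * k + 2) * of_real (r * t) ^ (2 * k + 2)) sums (K (of_real t) - K (of_real (r * t)))"
      by (subst sums_mono_reindex[of "\<lambda>k. 2 * k + 2" "\<lambda>n. b n * of_real t ^ n - b n * of_real (r * t) ^ n"]) auto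
    from sums_mult[OF this, of "2 / of_real (t\<^sup>2 * (1 - r\<^sup>2))"]
    have "(\<lambda>k. 2 / of_real (t\<^sup>2 * (1 - r\<^sup>2)) * (b (2 * k + 2) * of_real t ^ (2 * k + 2) - b (2 * k + 2) * of_real (r * t) ^ (2 * k + 2)))
        sums (2 * (K (of_real t) - K (of_real (r * t))) / of_real (t\<^sup>2 * (1 - r\<^sup>2)))"
      by simp
    moreover have "2 / of_real (t\<^sup>2 * (1 - r\<^sup>2)) * (b (2 * k + 2) * of_real t ^ (2 * k + 2) - b (2 * k + 2) * of_real (r * t) ^ (2 * k + 2)) = T k r" for k
    proof -
      have "(\<Sum>j\<le>k. r ^ (2 * j)) = (\<Sum>j\<le>k. (r\<^sup>2) ^ j)"
        by (simp add: power_mult)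
      also have "\<dots> = (1 - (r\<^sup>2) ^ Suc k) / (1 - r\<^sup>2)"
        by (subst sum_gp0) (use r' in simp)
      also have "(r\<^sup>2) ^ Suc k = r ^ (2 * k + 2)"
        unfolding power_mult[symmetric] by (rule arg_cong[of _ _ "power r"]) simp
      finally have geo: "(\<Sum>j\<le>k. r ^ (2 * j)) = (1 - r ^ (2 * k + 2)) / (1 - r\<^sup>2)" .
      have "2 / (t2 * R) * (B * (X * t2) - B * (X * t2 * Y)) = 2 * B * X * ((1 - Y) / R)"
        if "t2 \<noteq> 0" for t2 R B X Y :: complex
        using that by (cases "R = 0") (simp_all add: field_simps)
      note this[of "of_real (t\<^sup>2)" "of_real (1 - r\<^sup>2)" "b (2 * k + 2)" "of_real t ^ (2 * k)" "of_real (r ^ (2 * k + 2))"]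
      then have gen: "2 / (of_real (t\<^sup>2) * of_real (1 - r\<^sup>2)) * (b (2 * k + 2) * (of_real t ^ (2 * k) * of_real (t\<^sup>2))
            - b (2 * k + 2) * (of_real t ^ (2 * k) * of_real (t\<^sup>2) * of_real (r ^ (2 * k + 2))))
          = 2 * b (2 * k + 2) * of_real t ^ (2 * k) * ((1 - of_real (r ^ (2 * k + 2))) / of_real (1 - r\<^sup>2))"
        using t by simp
      have e1: "of_real t ^ (2 * k + 2) = of_real t ^ (2 * k) * complex_of_real (t\<^sup>2)"
        by (simp only: power_add of_real_power)
      have e2: "of_real (r * t) ^ (2 * k + 2) = of_real t ^ (2 * k) * of_real (t\<^sup>2) * complex_of_real (r ^ (2 * k + 2))"
        by (simp only: of_real_mult power_mult_distrib power_add of_real_power mult_ac)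
      show ?thesis
        unfolding T_def geo e1 e2 of_real_mult[of "t\<^sup>2"] gen by simp
    qed
    ultimately show ?thesis by (simp add: sums_iff)
  qed
  from IJ(2) show ?thesis
    unfolding J by (rule has_integral_spike_finite[of "{1}", rotated 2]) (use T in auto)
qed

text \<open>The two real series of the expansion are one complex series read off by parity: for even
  \<open>m\<close> the coefficient \<open>\<i> * (- \<i>) ^ m\<close> is imaginary and picks out
  \<open>sin a\<close>, for odd \<open>m\<close> it is real and picks out
  \<open>cos a\<close>.\<close>

lemma trig_sum_split:
  fixes x a :: real
  shows "Re (cis a * (\<Sum>m<n. \<i> * (- \<i>) ^ m * of_real (fact m / x ^ Suc m)))
    = - (sin a * (\<Sum>m | 2 * m + 1 \<le> n. (-1) ^ m * fact (2 * m) / x ^ (2 * m + 1))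
       + cos a * (\<Sum>m | 1 \<le> m \<and> 2 * m \<le> n. (-1) ^ m * fact (2 * m - 1) / x ^ (2 * m)))"
proof (induction n)
  case (Suc n)
  have fin: "finite {m. 2 * m + 1 \<le> n}" "finite {m. 1 \<le> m \<and> 2 * m \<le> n}"
    by (rule finite_subset[of _ "{..n}"]; auto)+
  have neg: "(- \<i>) ^ (2 * k) = of_real ((- 1) ^ k)" for k
    by (simp add: power_mult)
  show ?case
  proof (cases "even n")
    case True
    then obtain k where k: "n = 2 * k" by auto
    have sets: "{m. 2 * m + 1 \<le> Suc n} = insert k {m. 2 * m + 1 \<le> n}" "k \<notin> {m. 2 * m + 1 \<le> n}"
        "{m. 1 \<le> m \<and> 2 * m \<le> Suc n} = {m. 1 \<le> m \<and> 2 * m \<le> n}"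
      unfolding k set_eq_iff insert_iff mem_Collect_eq by presburger+
    have "Re (cis a * (\<i> * (- \<i>) ^ n * of_real (fact n / x ^ Suc n))) = - (sin a * ((-1) ^ k * fact (2 * k) / x ^ (2 * k + 1)))"
      unfolding k neg by simp
    then show ?thesis
      unfolding sum.lessThan_Suc distrib_left[of "cis a"] plus_complex.sel Suc.IH sets(1,3)
        sum.insert[OF fin(1) sets(2)]
      by (simp only: distrib_left minus_add_distrib add_ac)
  next
    case False
    then obtain k where k: "n = 2 * k + 1" by (auto elim: oddE)
    have sets: "{m. 1 \<le> m \<and> 2 * m \<le> Suc n} = insert (k + 1) {m. 1 \<le> m \<and> 2 * m \<le> n}"
        "k + 1 \<notin> {m. 1 \<le> m \<and> 2 * m \<le> n}"
        "{m. 2 * m + 1 \<le> Suc n} = {m. 2 * m + 1 \<le> n}"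
      unfolding k set_eq_iff insert_iff mem_Collect_eq by presburger+
    have "Re (cis a * (\<i> * (- \<i>) ^ n * of_real (fact n / x ^ Suc n))) = - (cos a * ((-1) ^ (k + 1) * fact (2 * (k + 1) - 1) / x ^ (2 * (k + 1))))"
      unfolding k power_add[of "- \<i>"] neg by simp
    then show ?thesis
      unfolding sum.lessThan_Suc distrib_left[of "cis a"] plus_complex.sel Suc.IH sets(1,3)
        sum.insert[OF fin(2) sets(2)]
      by (simp only: distrib_left minus_add_distrib add_ac)
  qed
qed (auto intro!: sum.neutral)

text \<open>By partial fractions \<open>2 / (1 - r\<^sup>2) = 1 / (1 + r) + 1 / (1 - r)\<close>, so
  up to the phase an antiderivative is the real part of
  \<open>E (a * (1 + r)) - E (a * (1 - r))\<close>. It vanishes at \<open>r = 0\<close>, and at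
  \<open>r = 1\<close> only \<open>E (2 * a)\<close> is left. The integrand is singular in form at
  \<open>r = 1\<close>, but \<open>E\<close> is entire, so continuity up to the end point
  suffices.\<close>

lemma cos_difference_has_integral:
  fixes E :: "complex \<Rightarrow> complex"
  assumes E0: "E 0 = 0"
    and E': "\<And>y. (E has_field_derivative (if y = 0 then - \<i> else (1 - exp (\<i> * y)) / y)) (at y)"
    and a: "a > 0"
  shows "((\<lambda>r. 2 * (cos a - cos (a * r)) / (1 - r\<^sup>2)) has_integral Re (cis (- a) * E (of_real (2 * a)))) {0..1}"
proof -
  define F where "F = (\<lambda>z. exp (- (\<i> * of_real a)) * (E (of_real a * (1 + z)) - E (of_real a * (1 - z))))"
  have cE: "continuous_on A E" for A
    using E' by (meson DERIV_isCont continuous_at_imp_continuous_on)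
  have "((\<lambda>r. 2 * (cos a - cos (a * r)) / (1 - r\<^sup>2)) has_integral Re (F (of_real 1)) - Re (F (of_real 0))) {0..1}"
  proof (rule fundamental_theorem_of_calculus_interior)
    show "continuous_on {0..1} (\<lambda>r. Re (F (of_real r)))"
      unfolding F_def by (intro continuous_intros continuous_on_compose2[OF cE[of UNIV]]) auto
    fix r :: real assume r: "r \<in> {0<..<1}"
    define p where "p = complex_of_real (a * (1 + r))"
    define q where "q = complex_of_real (a * (1 - r))"
    have pq: "p \<noteq> 0" "q \<noteq> 0" using r a unfolding p_def q_def of_real_eq_0_iff by auto
    have Ep: "((\<lambda>z. E (of_real a * (1 + z))) has_field_derivative (1 - exp (\<i> * p)) / p * of_real a) (at (of_real r))"
    proof (rule DERIV_chain2[where f = E and g = "\<lambda>z. of_real a * (1 + z)"])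
      show "(E has_field_derivative (1 - exp (\<i> * p)) / p) (at (of_real a * (1 + of_real r)))"
        using E'[of p] pq by (simp add: p_def)
    qed (auto intro!: derivative_eq_intros)
    have Eq: "((\<lambda>z. E (of_real a * (1 - z))) has_field_derivative (1 - exp (\<i> * q)) / q * - of_real a) (at (of_real r))"
    proof (rule DERIV_chain2[where f = E and g = "\<lambda>z. of_real a * (1 - z)"])
      show "(E has_field_derivative (1 - exp (\<i> * q)) / q) (at (of_real a * (1 - of_real r)))"
        using E'[of q] pq by (simp add: q_def)
    qed (auto intro!: derivative_eq_intros)
    have "(F has_field_derivative exp (- (\<i> * of_real a)) * ((1 - exp (\<i> * p)) / p * of_real a - (1 - exp (\<i> * q)) / q * - of_real a)) (at (of_real r))"
      unfolding F_def by (intro DERIV_cmult DERIV_diff Ep Eq)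
    from bounded_linear.has_vector_derivative[OF bounded_linear_Re has_vector_derivative_real_field[OF this]]
    have "((\<lambda>r. Re (F (of_real r))) has_vector_derivative
        Re (exp (- (\<i> * of_real a)) * ((1 - exp (\<i> * p)) / p * of_real a - (1 - exp (\<i> * q)) / q * - of_real a))) (at r)" .
    also have "exp (- (\<i> * of_real a)) * ((1 - exp (\<i> * p)) / p * of_real a - (1 - exp (\<i> * q)) / q * - of_real a)
        = (cis (- a) - cis (a * r)) * of_real (1 / (1 + r)) + (cis (- a) - cis (- (a * r))) * of_real (1 / (1 - r))"
    proof -
      have c: "exp (- (\<i> * of_real a)) = cis (- a)" by (simp add: cis_conv_exp)
      have e: "cis (- a) * exp (\<i> * p) = cis (a * r)" "cis (- a) * exp (\<i> * q) = cis (- (a * r))"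
        by (simp_all add: cis_conv_exp p_def q_def algebra_simps flip: exp_add)
      have "of_real a / p = of_real (1 / (1 + r))" "of_real a / q = of_real (1 / (1 - r))"
        using a by (simp_all add: p_def q_def)
      moreover have "c * ((1 - e1) / p * A - (1 - e2) / q * - A) = (c - c * e1) * (A / p) + (c - c * e2) * (A / q)"
        for c e1 e2 A :: complex
        by (simp add: algebra_simps diff_divide_distrib add_divide_distrib)
      ultimately show ?thesis by (simp only: c e)
    qed
    also have "Re \<dots> = 2 * (cos a - cos (a * r)) / (1 - r\<^sup>2)"
    proof -
      have "1 - r\<^sup>2 = (1 + r) * (1 - r)" by (simp add: power2_eq_square algebra_simps)
      moreover have "1 + r \<noteq> 0" "1 - r \<noteq> 0" using r by auto
      moreover have "Re (u * of_real x) = Re u * x" for u x by simp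
      ultimately have "Re ((cis (- a) - cis (a * r)) * of_real (1 / (1 + r)) + (cis (- a) - cis (- (a * r))) * of_real (1 / (1 - r)))
          = (cos a - cos (a * r)) * (1 / (1 + r)) + (cos a - cos (a * r)) * (1 / (1 - r))"
        by (simp only: plus_complex.sel) simp
      also have "\<dots> = 2 * (cos a - cos (a * r)) / ((1 + r) * (1 - r))"
        using \<open>1 + r \<noteq> 0\<close> \<open>1 - r \<noteq> 0\<close> by (simp add: divide_simps) (simp add: algebra_simps)
      finally show ?thesis
        unfolding \<open>1 - r\<^sup>2 = (1 + r) * (1 - r)\<close> .
    qed
    finally show "((\<lambda>r. Re (F (of_real r))) has_vector_derivative 2 * (cos a - cos (a * r)) / (1 - r\<^sup>2)) (at r)" .
  qed simp
  moreover have "F (of_real 1) = cis (- a) * E (of_real (2 * a))" "F (of_real 0) = 0"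
    by (simp_all add: F_def E0 cis_conv_exp mult.commute)
  ultimately show ?thesis by simp
qed

section \<open>The integral formula for the operator and the second expansion\<close>

context
  fixes t :: real
  assumes t: "0 < t" "t < 2 * pi"
begin

lemma continuous_on_f_ext: "continuous_on {0..1} (f_ext t)"
proof -
  obtain H where H: "H holomorphic_on ball 0 (2 * pi / t)"
    "\<And>r. \<bar>r\<bar> < 2 * pi / t \<Longrightarrow> H (of_real r) = of_real (f_ext t r)"
    using f_ext_holomorphic_extension[OF t] by metis
  have "1 < 2 * pi / t" using t by simp
  then have "of_real ` {0..1} \<subseteq> ball (0 :: complex) (2 * pi / t)" by auto
  then have "continuous_on {0..1} (\<lambda>r. Re (H (of_real r)))"
    by (intro continuous_on_Re continuous_on_compose2[OF holomorphic_on_imp_continuous_on[OF H(1)]] continuous_intros)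
  moreover have "Re (H (of_real r)) = f_ext t r" if "r \<in> {0..1}" for r
    using that \<open>1 < 2 * pi / t\<close> by (subst H(2)) auto
  ultimately show ?thesis
    by (rule continuous_on_eq)
qed

lemma cos_integral_f_ext:
  "\<exists>C. \<forall>a>0. \<bar>integral {0..1} (\<lambda>r. cos (a * r) * f_ext t r)
      + (\<Sum>m=1..n. cos (a + pi * real m / 2) / a ^ m * (deriv ^^ (m - 1)) (f_ext t) 1)\<bar> \<le> C / a ^ Suc n"
proof -
  let ?\<rho> = "2 * pi / t"
  let ?d = "\<lambda>m. (deriv ^^ m) (f_ext t)"
  have \<rho>: "?\<rho> > 1" using t by simp
  obtain H where H: "H holomorphic_on ball 0 ?\<rho>"
    "\<And>z. norm z < ?\<rho> \<Longrightarrow> H (- z) = H z"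
    "\<And>r. \<bar>r\<bar> < ?\<rho> \<Longrightarrow> H (of_real r) = of_real (f_ext t r)"
    using f_ext_holomorphic_extension[OF t] by metis
  have S: "of_real ` {0..1} \<subseteq> ball (0 :: complex) ?\<rho>" using \<rho> by auto
  have dH: "(deriv ^^ m) H (of_real r) = of_real (?d m r)" if "\<bar>r\<bar> < ?\<rho>" for m r
    by (rule higher_deriv_of_real_restriction[OF H(1), of "{- ?\<rho><..<?\<rho>}"]) (use that H(3) in auto)
  have d1: "(deriv ^^ m) H 1 = of_real (?d m 1)" for m
    using dH[of 1 m] \<rho> by simp
  have d0: "(deriv ^^ m) H 0 = of_real (?d m 0)" for m
    using dH[of 0 m] \<rho> by simp
  have odd0: "?d m 0 = 0" if "odd m" for m
    using higher_deriv_even_at_0[OF H(1) _ H(2) that] \<rho> by (simp add: d0)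
  obtain C where C: "\<And>a. norm (integral {0..1} (\<lambda>r. cis (a * r) * (deriv ^^ Suc n) H (of_real r))) \<le> C"
    using oscillatory_integral_bound[OF holomorphic_higher_deriv[OF H(1) open_ball] open_ball S, of "Suc n"] by blast
  \<comment> \<open>One more integration by parts is made than the sum shows. Its boundary term is
    absorbed into the error, which explains the constant and the order \<open>Suc n\<close>.\<close>
  have "\<bar>integral {0..1} (\<lambda>r. cos (a * r) * f_ext t r)
      + (\<Sum>m=1..n. cos (a + pi * real m / 2) / a ^ m * ?d (m - 1) 1)\<bar> \<le> (C + \<bar>?d n 1\<bar>) / a ^ Suc n" if a: "a > 0" for a
  proof -
    let ?f = "\<lambda>r. cis (a * r) * H (of_real r)"
    let ?J = "(\<i> / of_real a) ^ Suc n * integral {0..1} (\<lambda>r. cis (a * r) * (deriv ^^ Suc n) H (of_real r))"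
    let ?c = "\<lambda>m. cos (a + pi * real m / 2) / a ^ m * ?d (m - 1) 1"
    have summand: "Re (- ((\<i> / of_real a) ^ m * (cis a * (deriv ^^ (m - 1)) H 1 - (deriv ^^ (m - 1)) H 0))) = - ?c m"
      if "m \<in> {1..Suc n}" for m
    proof -
      have "(\<i> / of_real a) ^ m = cis (pi * real m / 2) * of_real (1 / a ^ m)"
        by (simp add: power_divide power_i_eq_cis)
      \<comment> \<open>The end point \<open>0\<close> drops out: for odd \<open>m\<close> the
        cosine is \<open>0\<close>, and for even \<open>m\<close> the derivative of odd order
        \<open>m - 1\<close> of an even function is \<open>0\<close>.\<close>
      moreover have "cos (pi * real m / 2) * ?d (m - 1) 0 = 0"
        using that odd0[of "m - 1"] cos_half_pi_odd[of m] by (cases "odd m") auto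
      ultimately show ?thesis
        unfolding d0 d1 by (simp add: cos_add algebra_simps diff_divide_distrib add_divide_distrib)
    qed
    have "continuous_on {0..1} (\<lambda>r. H (of_real r))"
      by (rule continuous_on_compose2[OF holomorphic_on_imp_continuous_on[OF H(1)] _ S]) (intro continuous_intros)
    then have "?f integrable_on {0..1}"
      by (intro integrable_continuous_real continuous_intros)
    from integral_linear[OF this bounded_linear_Re]
    have "integral {0..1} (\<lambda>r. Re (?f r)) = Re (integral {0..1} ?f)" by (simp add: o_def)
    also have "integral {0..1} (\<lambda>r. Re (?f r)) = integral {0..1} (\<lambda>r. cos (a * r) * f_ext t r)"
      using \<rho> by (intro integral_cong) (subst H(3), auto)
    also have "Re (integral {0..1} ?f) = (\<Sum>m=1..Suc n. - ?c m) + Re ?J"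
      unfolding oscillatory_integral_expansion[OF H(1) open_ball S a, of "Suc n"] plus_complex.sel Re_sum
      using summand by (intro arg_cong2[of _ _ _ _ plus] sum.cong) auto
    also have "(\<Sum>m=1..Suc n. - ?c m) = - (\<Sum>m=1..n. ?c m) - ?c (Suc n)"
      by (simp add: sum_negf)
    finally have "integral {0..1} (\<lambda>r. cos (a * r) * f_ext t r) + (\<Sum>m=1..n. ?c m) = Re ?J - ?c (Suc n)"
      by simp
    also have "\<bar>\<dots>\<bar> \<le> \<bar>Re ?J\<bar> + \<bar>?c (Suc n)\<bar>" by (rule abs_triangle_ineq4)
    also have "\<bar>Re ?J\<bar> \<le> C / a ^ Suc n"
    proof -
      have "norm ?J \<le> (1 / a) ^ Suc n * C"
        unfolding norm_mult norm_power using C[of a] a by (intro mult_mono) (auto simp: norm_divide)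
      then show ?thesis
        using abs_Re_le_cmod[of ?J] by (simp add: power_divide)
    qed
    also have "\<bar>?c (Suc n)\<bar> \<le> \<bar>?d n 1\<bar> / a ^ Suc n"
    proof -
      have "\<bar>cos (a + pi * real (Suc n) / 2)\<bar> * \<bar>?d n 1\<bar> \<le> 1 * \<bar>?d n 1\<bar>"
        by (intro mult_right_mono) auto
      then show ?thesis
        using a by (simp add: abs_mult divide_right_mono)
    qed
    finally show ?thesis by (simp add: add_divide_distrib)
  qed
  then show ?thesis by blast
qed

text \<open>Here \<open>K w = w * cos (l * w / 2) / sin (w / 2)\<close> up to the removable point.
  In \<open>K t - K (r * t)\<close> the second term has the amplitude
  \<open>r / sin (t * r / 2)\<close>; replacing it by \<open>1 / sin (t / 2)\<close> leaves a pure
  difference of cosines, and the correction, divided by \<open>t * (1 - r\<^sup>2)\<close>, is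
  \<open>f_ext\<close>.\<close>

lemma sharp_cos_eq:
  fixes E :: "complex \<Rightarrow> complex" and l :: nat
  assumes E0: "E 0 = 0"
    and E': "\<And>y. (E has_field_derivative (if y = 0 then - \<i> else (1 - exp (\<i> * y)) / y)) (at y)"
    and l: "l > 0"
  defines "a \<equiv> real l * t / 2"
  shows "sharp (\<lambda>w. cos (of_nat l * w / 2) / (w * sin (w / 2))) (of_real t)
    = of_real (1 / (t * sin (t / 2)) * Re (cis (- a) * E (of_real (2 * a))) - 2 * integral {0..1} (\<lambda>r. cos (a * r) * f_ext t r))"
proof -
  define s :: "complex \<Rightarrow> complex" where "s = (\<lambda>z. sin (z / 2))"
  define q where "q = (\<lambda>z. if z = 0 then deriv s 0 else (s z - s 0) / (z - 0))"
  define K where "K = (\<lambda>w. cos (of_nat l * w / 2) / q w)"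
  have a: "a > 0" using l t by (simp add: a_def)
  have "(s has_field_derivative 1 / 2) (at 0)"
    unfolding s_def by (auto intro!: derivative_eq_intros)
  then have "deriv s 0 = 1 / 2" by (rule DERIV_imp_deriv)
  then have q: "q z = (if z = 0 then 1 / 2 else sin (z / 2) / z)" for z
    by (simp add: q_def s_def)
  have q0: "q z \<noteq> 0" if "norm z < 2 * pi" for z
  proof (cases "z = 0")
    case False
    have "norm (z / of_real t) < 2 * pi / t"
      using that t by (simp add: norm_divide divide_strict_right_mono)
    then have "sin (z / 2) \<noteq> 0"
      using sin_half_nonzero[OF t, of "z / of_real t"] False t by simp
    then show ?thesis using False by (simp add: q)
  qed (simp add: q)
  have "s holomorphic_on UNIV"
    unfolding s_def by (intro holomorphic_intros) auto
  then have "q holomorphic_on UNIV"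
    unfolding q_def by (rule pole_lemma) auto
  then have holK: "K holomorphic_on ball 0 (2 * pi)"
    unfolding K_def using q0 by (intro holomorphic_intros) (auto intro: holomorphic_on_subset)
  have i1: "((\<lambda>r. 2 * (K (of_real t) - K (of_real (r * t))) / of_real (t\<^sup>2 * (1 - r\<^sup>2))) has_integral
      sharp (\<lambda>w. cos (of_nat l * w / 2) / (w * sin (w / 2))) (of_real t)) {0..1}"
  proof (rule sharp_has_integral[OF holK t])
    show "K (- z) = K z" for z by (simp add: K_def q)
    show "cos (of_nat l * w / 2) / (w * sin (w / 2)) = K w / w\<^sup>2" if "w \<noteq> 0" for w
      using that by (simp add: K_def q power2_eq_square)
  qed
  have i2: "((\<lambda>r. complex_of_real (1 / (t * sin (t / 2)) * (2 * (cos a - cos (a * r)) / (1 - r\<^sup>2)) - 2 * (cos (a * r) * f_ext t r)))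
     has_integral of_real (1 / (t * sin (t / 2)) * Re (cis (- a) * E (of_real (2 * a))) - 2 * integral {0..1} (\<lambda>r. cos (a * r) * f_ext t r))) {0..1}"
    by (intro has_integral_of_real has_integral_diff has_integral_mult_right cos_difference_has_integral[OF E0 E' a]
         integrable_integral integrable_continuous_real continuous_intros continuous_on_f_ext)
  \<comment> \<open>At \<open>0\<close> and \<open>1\<close> the function \<open>f_ext\<close> is a
    limit, not the quotient, so the integrands are compared only away from these two points.\<close>
  have eq: "complex_of_real (1 / (t * sin (t / 2)) * (2 * (cos a - cos (a * r)) / (1 - r\<^sup>2)) - 2 * (cos (a * r) * f_ext t r))
     = 2 * (K (of_real t) - K (of_real (r * t))) / of_real (t\<^sup>2 * (1 - r\<^sup>2))" if r: "r \<in> {0..1} - {0, 1}" for r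
  proof -
    have Kt: "K (of_real (y * t)) = of_real (y * t * cos (a * y) / sin (t * y / 2))" if "y > 0" for y
    proof -
      have "of_nat l * of_real (y * t) / 2 = complex_of_real (a * y)" "of_real (y * t) / 2 = complex_of_real (t * y / 2)"
        by (simp_all add: a_def)
      then show ?thesis
        using that t by (simp only: K_def q cos_of_real sin_of_real) (simp add: field_simps)
    qed
    have r': "0 < r" "1 - r\<^sup>2 \<noteq> 0"
      using r by (auto simp: power2_eq_1_iff)
    have "f_ext t r = (r / sin (t * r / 2) - 1 / sin (t / 2)) * (1 / (t * (1 - r\<^sup>2)))"
      using r by (auto simp: f_ext_def f_raw_def)
    moreover have "1 / (t * s) * (2 * (A - B) / D) - 2 * (B * ((r / s' - 1 / s) * (1 / (t * D))))
        = 2 * (t * A / s - r * t * B / s') / (t\<^sup>2 * D)" for A B D s s'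
      using t by (cases "D = 0"; cases "s = 0"; cases "s' = 0") (simp_all add: field_simps power2_eq_square)
    ultimately have "1 / (t * sin (t / 2)) * (2 * (cos a - cos (a * r)) / (1 - r\<^sup>2)) - 2 * (cos (a * r) * f_ext t r)
       = 2 * (t * cos a / sin (t / 2) - r * t * cos (a * r) / sin (t * r / 2)) / (t\<^sup>2 * (1 - r\<^sup>2))"
      by (simp only:)
    then show ?thesis
      using Kt[of 1] Kt[OF r'(1)] by simp
  qed
  show ?thesis
    by (rule has_integral_unique[OF i1 has_integral_spike_finite[of "{0, 1}", OF _ eq[symmetric] i2]]) simp
qed

end

lemma deriv_Gamma_1: "deriv Gamma 1 = (- euler_mascheroni :: real)"
proof -
  have "(Gamma has_field_derivative Gamma 1 * Digamma 1) (at (1::real))"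
    by (rule has_field_derivative_Gamma) auto
  from DERIV_imp_deriv[OF this] show ?thesis by simp
qed

text \<open>Both error estimates are of order \<open>Suc n\<close>, one better than the claim, and
  the spare factor \<open>1 / l\<close> yields the little-o.\<close>

lemma smallo_of_norm_le:
  fixes f :: "nat \<Rightarrow> complex"
  assumes "\<And>l. l > 0 \<Longrightarrow> norm (f l) \<le> C / real l ^ Suc n"
  shows "f \<in> o(\<lambda>l. of_real (1 / real l ^ n))"
proof (rule landau_o.smallI)
  fix c :: real assume c: "c > 0"
  show "\<forall>\<^sub>F l in sequentially. norm (f l) \<le> c * norm (complex_of_real (1 / real l ^ n))"
    using eventually_gt_at_top[of 0] eventually_ge_at_top[of "nat \<lceil>C / c\<rceil>"]
  proof eventually_elim
    case (elim l)
    then have "C / c \<le> real l" by linarith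
    then have "C \<le> c * real l"
      using c by (simp add: field_simps)
    then have "C / real l ^ Suc n \<le> c * real l / real l ^ Suc n"
      by (intro divide_right_mono) auto
    also have "\<dots> = c * norm (complex_of_real (1 / real l ^ n))"
      using elim by (simp add: norm_divide norm_power)
    finally show ?case using assms[of l] elim by linarith
  qed
qed

lemma sharp_asymptotics:
  fixes t :: real and n :: nat
  assumes t: "0 < t" "t < 2 * pi"
  shows "(\<lambda>l::nat.
           sharp (\<lambda>w. cos (of_nat l * w / 2) / (w * sin (w / 2))) (of_real t)
           - complex_of_real
              (- (1 / (t * sin (t / 2))) *
                 (sin (real l * t / 2) *
                    (pi / 2 + (\<Sum>m | 2 * m + 1 \<le> n. (-1) ^ m * fact (2 * m) / (real l * t) ^ (2 * m + 1)))
                  + cos (real l * t / 2) *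
                    (- ln (real l * t) + deriv Gamma 1
                     + (\<Sum>m | 1 \<le> m \<and> 2 * m \<le> n. (-1) ^ m * fact (2 * m - 1) / (real l * t) ^ (2 * m))))
               + (\<Sum>m=1..n. 2 * (2 / (real l * t)) ^ m * cos ((real l * t + pi * real m) / 2)
                    * (deriv ^^ (m - 1)) (f_ext t) 1)))
        \<in> o(\<lambda>l. of_real (1 / real l ^ n))"
proof -
  obtain E :: "complex \<Rightarrow> complex" where E0: "E 0 = 0"
    and E': "\<And>y. (E has_field_derivative (if y = 0 then - \<i> else (1 - exp (\<i> * y)) / y)) (at y)"
    using exp_integral_exists by blast
  obtain C where C: "\<And>a. a > 0 \<Longrightarrow> \<bar>integral {0..1} (\<lambda>r. cos (a * r) * f_ext t r)
      + (\<Sum>m=1..n. cos (a + pi * real m / 2) / a ^ m * (deriv ^^ (m - 1)) (f_ext t) 1)\<bar> \<le> C / a ^ Suc n"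
    using cos_integral_f_ext[OF t, of n] by blast
  let ?s = "sin (t / 2)"
  have s: "t * ?s > 0" using sin_half_pos[OF t] t by simp
  show ?thesis
  \<comment> \<open>The constant adds the two errors with the powers of \<open>l\<close> taken out:
    the Laplace expansion is used at \<open>x = l * t\<close>, the oscillatory integral at
    \<open>a = l * t / 2\<close>.\<close>
  proof (rule smallo_of_norm_le[where C = "1 / (t * ?s) * (fact n / t ^ Suc n) + 2 * (C / (t / 2) ^ Suc n)"])
    fix l :: nat assume l: "l > 0"
    define a where "a = real l * t / 2"
    define x where "x = real l * t"
    have x: "x > 0" "x = 2 * a" and a: "a > 0" using l t by (simp_all add: x_def a_def)
    define S1 where "S1 = (\<Sum>m | 2 * m + 1 \<le> n. (-1) ^ m * fact (2 * m) / x ^ (2 * m + 1))"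
    define S2 where "S2 = (\<Sum>m | 1 \<le> m \<and> 2 * m \<le> n. (-1) ^ m * fact (2 * m - 1) / x ^ (2 * m))"
    define I where "I = integral {0..1} (\<lambda>r. cos (a * r) * f_ext t r)"
    define S3 where "S3 = (\<Sum>m=1..n. cos (a + pi * real m / 2) / a ^ m * (deriv ^^ (m - 1)) (f_ext t) 1)"
    define Q where "Q = (\<Sum>m<n. \<i> * (- \<i>) ^ m * complex_of_real (fact m / x ^ Suc m))"
    have Q: "Re (cis a * Q) = - (sin a * S1 + cos a * S2)"
      unfolding Q_def S1_def S2_def by (rule trig_sum_split)
    have "cis (- a) * E (of_real x) = cis (- a) * (of_real (ln x + euler_mascheroni) - \<i> * of_real (pi / 2)) + cis (- a) * exp (\<i> * of_real x) * laplace_recip x"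
      unfolding exp_integral_eq[OF E0 E' x(1)] by (simp add: algebra_simps)
    also have "cis (- a) * exp (\<i> * of_real x) = cis a"
      by (simp add: cis_conv_exp x(2) flip: exp_add)
    finally have cisE: "cis (- a) * E (of_real x) = cis (- a) * (of_real (ln x + euler_mascheroni) - \<i> * of_real (pi / 2)) + cis a * laplace_recip x" .
    have E: "Re (cis (- a) * E (of_real x)) = cos a * (ln x + euler_mascheroni) - sin a * (pi / 2) + Re (cis a * laplace_recip x)"
    proof -
      have "Re (euler_mascheroni :: complex) = euler_mascheroni" "Im (euler_mascheroni :: complex) = 0"
        by (metis of_real_euler_mascheroni Re_complex_of_real, metis of_real_euler_mascheroni Im_complex_of_real)
      then show ?thesis
        unfolding cisE by (simp add: algebra_simps)
    qed
    have xa: "x / 2 = a" by (simp add: x_def a_def)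
    have S3: "(\<Sum>m=1..n. 2 * (2 / x) ^ m * cos ((x + pi * real m) / 2) * (deriv ^^ (m - 1)) (f_ext t) 1) = 2 * S3"
    proof -
      have e: "2 / x = 1 / a" "(x + pi * real m) / 2 = a + pi * real m / 2" for m
        by (simp_all add: x(2) add_divide_distrib)
      show ?thesis
        unfolding e S3_def sum_distrib_left by (intro sum.cong refl) (simp add: power_divide)
    qed
    have "\<bar>Re (cis a * laplace_recip x) + (sin a * S1 + cos a * S2)\<bar> = \<bar>Re (cis a * (laplace_recip x - Q))\<bar>"
      using Q by (simp add: right_diff_distrib)
    also have "\<dots> \<le> norm (laplace_recip x - Q)"
      using abs_Re_le_cmod[of "cis a * (laplace_recip x - Q)"] by (simp add: norm_mult)
    also have "\<dots> \<le> fact n / x ^ Suc n"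
      unfolding Q_def by (rule laplace_recip_expansion[OF x(1)])
    finally have b1: "\<bar>Re (cis a * laplace_recip x) + (sin a * S1 + cos a * S2)\<bar> \<le> fact n / x ^ Suc n" .
    have b2: "\<bar>I + S3\<bar> \<le> C / a ^ Suc n"
      unfolding I_def S3_def by (rule C[OF a])
    \<comment> \<open>All explicit terms cancel, with \<open>- g\<close> standing for the derivative
      of \<open>Gamma\<close> at \<open>1\<close>. What remains is the truncation error of the
      Laplace integral and that of the oscillatory integral.\<close>
    have alg: "1 / T * (c * (L + g) - d * p + R) - 2 * i - (- (1 / T) * (d * (p + u) + c * (- L + - g + v)) + 2 * w)
        = 1 / T * (R + (d * u + c * v)) - 2 * (i + w)" for T c L g d p R i u v w :: real
      by (simp add: algebra_simps)
    have "\<bar>1 / (t * ?s) * (Re (cis a * laplace_recip x) + (sin a * S1 + cos a * S2)) - 2 * (I + S3)\<bar>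
        \<le> 1 / (t * ?s) * (fact n / x ^ Suc n) + 2 * (C / a ^ Suc n)"
    proof -
      have "\<bar>1 / (t * ?s) * (Re (cis a * laplace_recip x) + (sin a * S1 + cos a * S2))\<bar> \<le> 1 / (t * ?s) * (fact n / x ^ Suc n)"
        unfolding abs_mult using s b1 by (intro mult_mono) auto
      moreover have "\<bar>u - 2 * v\<bar> \<le> A + 2 * B" if "\<bar>u\<bar> \<le> A" "\<bar>v\<bar> \<le> B" for u v A B :: real
        using that by linarith
      ultimately show ?thesis using b2 by blast
    qed
    also have "\<dots> = (1 / (t * ?s) * (fact n / t ^ Suc n) + 2 * (C / (t / 2) ^ Suc n)) / real l ^ Suc n"
    proof -
      have "x ^ Suc n = real l ^ Suc n * t ^ Suc n" "a ^ Suc n = real l ^ Suc n * (t / 2) ^ Suc n"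
        by (simp_all only: x_def a_def power_mult_distrib[symmetric] times_divide_eq_right)
      moreover have "k * (p / (L * q)) + 2 * (c / (L * r)) = (k * (p / q) + 2 * (c / r)) / L" for k p L q c r :: real
        by (simp add: add_divide_distrib mult.commute[of L])
      ultimately show ?thesis by (simp only:)
    qed
    finally have fin: "\<bar>1 / (t * ?s) * (Re (cis a * laplace_recip x) + (sin a * S1 + cos a * S2)) - 2 * (I + S3)\<bar>
        \<le> (1 / (t * ?s) * (fact n / t ^ Suc n) + 2 * (C / (t / 2) ^ Suc n)) / real l ^ Suc n" .
    have sh: "sharp (\<lambda>w. cos (of_nat l * w / 2) / (w * sin (w / 2))) (of_real t)
       = of_real (1 / (t * ?s) * (cos a * (ln x + euler_mascheroni) - sin a * (pi / 2) + Re (cis a * laplace_recip x)) - 2 * I)"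
      unfolding E[symmetric] using sharp_cos_eq[OF t E0 E' l] by (simp only: a_def[symmetric] x(2)[symmetric] I_def)
    show "norm (sharp (\<lambda>w. cos (of_nat l * w / 2) / (w * sin (w / 2))) (of_real t)
           - complex_of_real
              (- (1 / (t * sin (t / 2))) *
                 (sin (real l * t / 2) *
                    (pi / 2 + (\<Sum>m | 2 * m + 1 \<le> n. (-1) ^ m * fact (2 * m) / (real l * t) ^ (2 * m + 1)))
                  + cos (real l * t / 2) *
                    (- ln (real l * t) + deriv Gamma 1
                     + (\<Sum>m | 1 \<le> m \<and> 2 * m \<le> n. (-1) ^ m * fact (2 * m - 1) / (real l * t) ^ (2 * m))))
               + (\<Sum>m=1..n. 2 * (2 / (real l * t)) ^ m * cos ((real l * t + pi * real m) / 2)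
                    * (deriv ^^ (m - 1)) (f_ext t) 1)))
      \<le> (1 / (t * ?s) * (fact n / t ^ Suc n) + 2 * (C / (t / 2) ^ Suc n)) / real l ^ Suc n"
      unfolding sh of_real_diff[symmetric] norm_of_real deriv_Gamma_1
        x_def[symmetric] S1_def[symmetric] S2_def[symmetric] xa S3 alg
      by (rule fin)
  qed
qed

text \<open>Boundedness of \<open>lerch_R\<close> is what makes the exact identity for each
  \<open>N\<close> an expansion: the last term is of order \<open>l\<close> to the power
  \<open>- N\<close>. In the second part the asymptotic sign is read as follows: for every
  \<open>n\<close>, keeping all terms up to order \<open>n\<close> in \<open>1 / l\<close> leaves an
  error that is little-o of \<open>1 / l ^ n\<close>.\<close>

theorem theorem9p1:
  fixes t :: real
  assumes "0 < t" and "t < 2 * pi"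
  shows
    "(\<forall>N::nat. N \<ge> 1 \<longrightarrow>
        (\<forall>l::nat. l \<ge> 1 \<longrightarrow>
          complex_of_real (\<Sum>k=1..l. sin ((2 * real k - real l) * t / 2) / sin (t / 2) * ln (real k)) =
            - of_real (cos ((real l + 1) * t / 2) / (2 * (sin (t / 2))\<^sup>2) * ln (real l))
            - 1 / (2 * \<i> * of_real (sin (t / 2))) *
                (cis (- (real l - 2) * t / 2) * lerch_phi_ds (cis t) 0 1
                 - cis ((real l - 2) * t / 2) * lerch_phi_ds (cis (- t)) 0 1)
            + 1 / (2 * \<i> * of_real (sin (t / 2))) *
                (\<Sum>m=1..<N. (- of_nat l) powi (- int m) / of_nat m *
                   (cis ((real l + 2) * t / 2) * lerch_phi (cis t) (- of_nat m) 1
                    - cis (- (real l + 2) * t / 2) * lerch_phi (cis (- t)) (- of_nat m) 1))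
            + 1 / (2 * \<i> * of_real (sin (t / 2))) * ((- of_nat l) powi (- int N) / of_nat N) *
                (cis ((real l + 2) * t / 2) * lerch_R (cis t) N (real l)
                 - cis (- (real l + 2) * t / 2) * lerch_R (cis (- t)) N (real l)))
        \<and> bounded (lerch_R (cis t) N ` {0<..})
        \<and> bounded (lerch_R (cis (- t)) N ` {0<..}))
     \<and>
     (\<forall>n::nat.
        (\<lambda>l::nat.
           sharp (\<lambda>w. cos (of_nat l * w / 2) / (w * sin (w / 2))) (of_real t)
           - complex_of_real
              (- (1 / (t * sin (t / 2))) *
                 (sin (real l * t / 2) *
                    (pi / 2 + (\<Sum>m | 2 * m + 1 \<le> n. (-1) ^ m * fact (2 * m) / (real l * t) ^ (2 * m + 1)))
                  + cos (real l * t / 2) *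
                    (- ln (real l * t) + deriv Gamma 1
                     + (\<Sum>m | 1 \<le> m \<and> 2 * m \<le> n. (-1) ^ m * fact (2 * m - 1) / (real l * t) ^ (2 * m))))
               + (\<Sum>m=1..n. 2 * (2 / (real l * t)) ^ m * cos ((real l * t + pi * real m) / 2)
                    * (deriv ^^ (m - 1)) (f_ext t) 1)))
        \<in> o(\<lambda>l. of_real (1 / real l ^ n)))"
proof (intro conjI allI impI)
  have ne: "cis t \<noteq> 1" "cis (- t) \<noteq> 1"
    using assms by (simp_all only: cis_neq_1 abs_minus_cancel abs_of_pos not_False_eq_True)
  fix N :: nat assume N: "N \<ge> 1"
  show "bounded (lerch_R (cis t) N ` {0<..})" "bounded (lerch_R (cis (- t)) N ` {0<..})"
    by (rule bounded_lerch_R[OF norm_cis ne(1) N], rule bounded_lerch_R[OF norm_cis ne(2) N])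
qed ((rule sin_sum_ln[OF assms], assumption+) | rule sharp_asymptotics[OF assms])+

end
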